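(* For a greedy policy and an alternating policy applied to the same label sequences, with match counts $M_{\mathbf G}(n)$ and $M_{\mathbf A}(n)$, $$\liminf_{n\to\infty}\frac{M_{\mathbf G}(n)-M_{\mathbf A}(n)}{n^{5/4}(\log_2 n)^{1/4}}=-\infty\ \text{a.s.},\qquad \limsup_{n\to\infty}\frac{M_{\mathbf G}(n)-M_{\mathbf A}(n)}{n^{5/4}(\log_2 n)^{1/4}}=\infty\ \text{a.s.},$$ and $$\frac{M_{\mathbf G}(n)-M_{\mathbf A}(n)}{n^{5/4}(\log_2 n)^{1/4}}=O\bigl((\log n)^{1/2}\bigr)\quad\text{a.s.}$$
   Context: Let $(r_i)_{i\ge1}$, $(s_i)_{i\ge1}$ be probability vectors on the positive integers with $\mu:=\sum_i r_is_i>0$. Let $\{L_{\mathbf R}(n)\}_{n\ge1}$, $\{L_{\mathbf S}(n)\}_{n\ge1}$ be independent i.i.d. sequences with $\Pr(L_{\mathbf R}(1)=i)=r_i$, $\Pr(L_{\mathbf S}(1)=i)=s_i$. For $m\ge0$ let $\tilde N_{\mathbf R}(m)$ be the vector with entries $N_{\mathbf R}(m,i)=\sum_{j=1}^m\mathbf 1\{L_{\mathbf R}(j)=i\}$, and $\tilde N_{\mathbf S}(m)$ analogously. Put $X_{\mathbf R}(n)=s_{L_{\mathbf R}(n)}$, $X_{\mathbf S}(n)=r_{L_{\mathbf S}(n)}$ (common mean $\mu$, variances $\sigma_{\mathbf R}^2,\sigma_{\mathbf S}^2$; standing assumption $\sigma_{\mathbf R}+\sigma_{\mathbf S}>0$),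 $\Gamma_{\mathbf R}[m]=\sum_{j=1}^mX_{\mathbf R}(j)$, $\Gamma_{\mathbf S}[m]=\sum_{j=1}^mX_{\mathbf S}(j)$. A reading policy is a $\{0,1\}$-valued process $C(n)$ ($C(n)=1$ iff the $n$-th record is read from $\mathbf R$), $R(n)=\sum_{j\le n}C(j)$, $S(n)=n-R(n)$, with $C(n)$ being $\mathcal F_{n-1}$-measurable where $\mathcal F_n=\mathcal F_0\vee\sigma(L_{\mathbf R}(1),\dots,L_{\mathbf R}(R(n));L_{\mathbf S}(1),\dots,L_{\mathbf S}(S(n)))$ and $\mathcal F_0$ (randomization, for both policies) is independent of the labels. Matches: $M(n)=\tilde N_{\mathbf R}(R(n))\cdot\tilde N_{\mathbf S}(S(n))$. An alternating policy is $\mathcal F_0$-measurable with $R(2n)=n$ for all $n$. A greedy policy satisfies, for $n\ge1$, $C(n+1)=1$ if $\Gamma_{\mathbf S}[S(n)]>\Gamma_{\mathbf R}[R(n)]$ and $C(n+1)=0$ if $\Gamma_{\mathbf S}[S(n)]<\Gamma_{\mathbf R}[R(n)]$ (ties arbitrary). $\log_2 n=\log\log n$. *)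

theory Defs
  imports "HOL-Probability.Probability" "HOL-Library.Landau_Symbols"
begin

text \<open>A reading policy is represented by C :: nat => 'a => bool, where C n w = True iff
  the n-th record (n >= 1) is read from R.  The value C 0 is irrelevant.\<close>

definition Rcnt :: "(nat \<Rightarrow> 'a \<Rightarrow> bool) \<Rightarrow> nat \<Rightarrow> 'a \<Rightarrow> nat" where
  "Rcnt C n \<omega> = card {j \<in> {1..n}. C j \<omega>}"

definition Scnt :: "(nat \<Rightarrow> 'a \<Rightarrow> bool) \<Rightarrow> nat \<Rightarrow> 'a \<Rightarrow> nat" where
  "Scnt C n \<omega> = n - Rcnt C n \<omega>"

definition obs :: "(nat \<Rightarrow> 'a \<Rightarrow> nat) \<Rightarrow> nat \<Rightarrow> 'a \<Rightarrow> nat list" where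
  "obs L m \<omega> = map (\<lambda>j. L j \<omega>) [1..<Suc m]"

text \<open>F_n = F_0 joined with sigma(L_R(1..R(n)); L_S(1..S(n))).  Since the observed
  data is countably valued, its sigma-algebra is generated by its level sets.\<close>
definition Fil :: "'a measure \<Rightarrow> 'a set set \<Rightarrow> (nat \<Rightarrow> 'a \<Rightarrow> nat) \<Rightarrow> (nat \<Rightarrow> 'a \<Rightarrow> nat)
    \<Rightarrow> (nat \<Rightarrow> 'a \<Rightarrow> bool) \<Rightarrow> nat \<Rightarrow> 'a measure" where
  "Fil M F0 LR LS C n = sigma (space M)
     (F0 \<union> {{\<omega> \<in> space M. obs LR (Rcnt C n \<omega>) \<omega> = xs \<and> obs LS (Scnt C n \<omega>) \<omega> = ys} | xs ys. True})"

definition Ncnt :: "(nat \<Rightarrow> 'a \<Rightarrow> nat) \<Rightarrow> nat \<Rightarrow> nat \<Rightarrow> 'a \<Rightarrow> nat" where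
  "Ncnt L m i \<omega> = card {j \<in> {1..m}. L j \<omega> = i}"

text \<open>M(n) = N_R(R(n)) . N_S(S(n)); the sum runs over the (finite) set of labels for which
  N_R(R(n),i) can be nonzero, all other terms vanish.\<close>
definition matches :: "(nat \<Rightarrow> 'a \<Rightarrow> nat) \<Rightarrow> (nat \<Rightarrow> 'a \<Rightarrow> nat) \<Rightarrow> (nat \<Rightarrow> 'a \<Rightarrow> bool)
    \<Rightarrow> nat \<Rightarrow> 'a \<Rightarrow> real" where
  "matches LR LS C n \<omega> =
     (\<Sum>i \<in> (\<lambda>j. LR j \<omega>) ` {1..Rcnt C n \<omega>}.
        real (Ncnt LR (Rcnt C n \<omega>) i \<omega>) * real (Ncnt LS (Scnt C n \<omega>) i \<omega>))"

definition Gam :: "(nat \<Rightarrow> real) \<Rightarrow> (nat \<Rightarrow> 'a \<Rightarrow> nat) \<Rightarrow> nat \<Rightarrow> 'a \<Rightarrow> real" where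
  "Gam x L m \<omega> = (\<Sum>j = 1..m. x (L j \<omega>))"

definition reading_policy :: "'a measure \<Rightarrow> 'a set set \<Rightarrow> (nat \<Rightarrow> 'a \<Rightarrow> nat)
    \<Rightarrow> (nat \<Rightarrow> 'a \<Rightarrow> nat) \<Rightarrow> (nat \<Rightarrow> 'a \<Rightarrow> bool) \<Rightarrow> bool" where
  "reading_policy M F0 LR LS C \<longleftrightarrow>
     (\<forall>n\<ge>1. C n \<in> measurable (Fil M F0 LR LS C (n - 1)) (count_space UNIV))"

definition alternating_policy :: "'a measure \<Rightarrow> 'a set set \<Rightarrow> (nat \<Rightarrow> 'a \<Rightarrow> bool) \<Rightarrow> bool" where
  "alternating_policy M F0 C \<longleftrightarrow>
     (\<forall>n\<ge>1. C n \<in> measurable (sigma (space M) F0) (count_space UNIV)) \<and>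
     (\<forall>\<omega>\<in>space M. \<forall>n. Rcnt C (2 * n) \<omega> = n)"

definition greedy_policy :: "'a measure \<Rightarrow> 'a set set \<Rightarrow> (nat \<Rightarrow> real) \<Rightarrow> (nat \<Rightarrow> real)
    \<Rightarrow> (nat \<Rightarrow> 'a \<Rightarrow> nat) \<Rightarrow> (nat \<Rightarrow> 'a \<Rightarrow> nat) \<Rightarrow> (nat \<Rightarrow> 'a \<Rightarrow> bool) \<Rightarrow> bool" where
  "greedy_policy M F0 r s LR LS C \<longleftrightarrow>
     reading_policy M F0 LR LS C \<and>
     (\<forall>\<omega>\<in>space M. \<forall>n\<ge>1.
        (Gam r LS (Scnt C n \<omega>) \<omega> > Gam s LR (Rcnt C n \<omega>) \<omega> \<longrightarrow> C (Suc n) \<omega>) \<and>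
        (Gam r LS (Scnt C n \<omega>) \<omega> < Gam s LR (Rcnt C n \<omega>) \<omega> \<longrightarrow> \<not> C (Suc n) \<omega>))"

definition prob_vector :: "(nat \<Rightarrow> real) \<Rightarrow> bool" where
  "prob_vector p \<longleftrightarrow> p 0 = 0 \<and> (\<forall>i. p i \<ge> 0) \<and> p sums 1"

end

theory Submission
  imports Defs "HOL-Real_Asymp.Real_Asymp"
begin

text \<open>
  Write \<open>W\<close> for the centred walks of the two score sequences and \<open>\<delta>\<close> for the number of R-records
  by which the greedy policy is ahead of the alternating one. Greedy keeps the two score sums within
  distance 1, so \<open>2 \<mu> \<delta>\<close> is \<open>W\<^sub>S - W\<^sub>R\<close> up to a bounded error. A record read from R matches
  \<open>S s\<^sub>i + O(sqrt (n log n))\<close> earlier S-records, hence up to smaller terms the difference of the match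
  counts is \<open>n / 2\<close> times the sum of the increments of \<open>W\<^sub>R\<close> from \<open>n/2\<close> to \<open>n/2 + \<delta>\<close> and of
  \<open>W\<^sub>S\<close> from \<open>n/2\<close> to \<open>n/2 - \<delta>\<close>. The law of the iterated logarithm bounds \<open>\<delta>\<close> and Hoeffding's inequality
  bounds all increments, which gives the O-statement. For the two infinite limits, at the scales
  \<open>n = 2 * 4^(k\<^sup>2)\<close> one prescribes \<open>\<delta>\<close> of order \<open>sqrt n\<close> together with an atypically large increment
  over the corresponding window; these events are independent, with non-summable probabilities.
\<close>

subsection \<open>Independent labels\<close>

text \<open>The exponent 5/4 comes from a cancellation. Moving \<delta> records from S to R gains
  about n/2 * \<mu> * \<delta> matches on one side and loses as many on the other; the drift leaves
  only terms of order \<delta>^2, which is n up to logarithms. What survives is n times a walk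
  increment over a stretch of length about sqrt n, hence n * n^(1/4). The obstacle is that this
  stretch is itself selected by the walks. For the upper bound all stretches are estimated
  simultaneously, and this uniformity costs the factor sqrt (log n). For the infinite limits
  independence is restored by cutting the label sequences: the labels well before the window decide
  where the path lies, up to an error of smaller order, and monotonicity of the score sums turns
  this into upper and lower bounds on the position of the path. The labels inside the window remain
  free for the large increment. As \<delta> has its typical size sqrt n there, and not the size
  allowed by the iterated logarithm, the increment must exceed its typical size by more than a
  factor (log log n)^(1/4).\<close>

text \<open>Events are given by predicates on label configurations that depend on finitely many
  coordinates. Labels being countably valued, such predicates are automatically measurable, and
  predicates depending on disjoint sets of coordinates are independent.\<close>

definition depends_on :: "'i set \<Rightarrow> (('i \<Rightarrow> nat) \<Rightarrow> bool) \<Rightarrow> bool" where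
  "depends_on K Q \<longleftrightarrow> (\<forall>f g. (\<forall>i\<in>K. f i = g i) \<longrightarrow> Q f = Q g)"

lemma depends_onI:
  "(\<And>f g. (\<And>i. i \<in> K \<Longrightarrow> f i = g i) \<Longrightarrow> Q f \<Longrightarrow> Q g) \<Longrightarrow> depends_on K Q"
  unfolding depends_on_def by metis

lemma depends_on_mono: "depends_on K Q \<Longrightarrow> K \<subseteq> K' \<Longrightarrow> depends_on K' Q"
  unfolding depends_on_def by blast

lemma depends_on_restrict: "depends_on K Q \<Longrightarrow> Q (restrict f K) = Q f"
  unfolding depends_on_def by (metis restrict_apply')

lemma depends_on_not: "depends_on K Q \<Longrightarrow> depends_on K (\<lambda>f. \<not> Q f)"
  unfolding depends_on_def by metis

lemma depends_on_conj:
  "depends_on K Q \<Longrightarrow> depends_on K Q' \<Longrightarrow> depends_on K (\<lambda>f. Q f \<and> Q' f)"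
  unfolding depends_on_def by metis

lemma depends_on_Ball:
  "(\<And>x. x \<in> A \<Longrightarrow> depends_on K (Q x)) \<Longrightarrow> depends_on K (\<lambda>f. \<forall>x\<in>A. Q x f)"
  unfolding depends_on_def by metis

lemma depends_on_Bex:
  "(\<And>x. x \<in> A \<Longrightarrow> depends_on K (Q x)) \<Longrightarrow> depends_on K (\<lambda>f. \<exists>x\<in>A. Q x f)"
  unfolding depends_on_def by metis

lemma depends_on_sum:
  assumes "J \<subseteq> K"
  shows "depends_on K (\<lambda>f. P (\<Sum>i\<in>J. x i (f i)))"
proof (rule depends_onI)
  fix f g :: "'a \<Rightarrow> nat" assume fg: "\<And>i. i \<in> K \<Longrightarrow> f i = g i" and P: "P (\<Sum>i\<in>J. x i (f i))"
  have "(\<Sum>i\<in>J. x i (f i)) = (\<Sum>i\<in>J. x i (g i))"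
    by (rule sum.cong) (use fg assms in auto)
  with P show "P (\<Sum>i\<in>J. x i (g i))" by simp
qed

text \<open>Transports independence along an injective renaming of indices. It serves to exchange
  the two label sequences and to pass from the optional index type of the theorem to the label
  coordinates.\<close>

lemma (in prob_space) indep_sets_reindex:
  assumes h: "inj_on h I" and ind: "indep_sets F (h ` I)"
  shows "indep_sets (\<lambda>i. F (h i)) I"
proof (rule indep_setsI)
  show "F (h i) \<subseteq> events" if "i \<in> I" for i using ind that by (auto simp: indep_sets_def)
  fix A J assume J: "J \<noteq> {}" "J \<subseteq> I" "finite J" and A: "\<forall>j\<in>J. A j \<in> F (h j)"
  have hJ: "inj_on h J" using h J by (rule_tac inj_on_subset)
  define A' where "A' = A \<circ> the_inv_into J h"
  have A': "A' (h j) = A j" if "j \<in> J" for j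
    using that hJ by (simp add: A'_def the_inv_into_f_f)
  have "prob (\<Inter>k\<in>h ` J. A' k) = (\<Prod>k\<in>h ` J. prob (A' k))"
    by (rule indep_setsD[OF ind]) (use J A A' in auto)
  then show "prob (\<Inter>j\<in>J. A j) = (\<Prod>j\<in>J. prob (A j))"
    using A' by (simp add: prod.reindex[OF hJ] cong: INF_cong prod.cong)
qed

text \<open>Expand \<open>h (X \<omega>)\<close> over the level sets of \<open>X\<close>; the
  domination by \<open>c * p i\<close> permits exchanging series and expectation.\<close>

lemma (in prob_space) expectation_label:
  fixes h :: "nat \<Rightarrow> real"
  assumes X: "X \<in> measurable M (count_space UNIV)"
    and dist: "\<And>i. prob {\<omega> \<in> space M. X \<omega> = i} = p i" and p: "prob_vector p"
    and h: "\<And>i. \<bar>h i\<bar> \<le> c"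
  shows "expectation (\<lambda>\<omega>. h (X \<omega>)) = (\<Sum>i. p i * h i)"
proof -
  note [measurable] = X
  have p0: "p i \<ge> 0" and psum: "summable p" for i
    using p unfolding prob_vector_def by (auto simp: sums_iff)
  define f where "f i \<omega> = h i * indicator {\<omega> \<in> space M. X \<omega> = i} \<omega>" for i \<omega>
  have f_eq: "(\<lambda>i. f i \<omega>) sums h (X \<omega>)" if "\<omega> \<in> space M" for \<omega>
    using sums_single[of "X \<omega>" h] that unfolding f_def
    by (rule_tac back_subst[of "\<lambda>g. g sums h (X \<omega>)"]) (auto simp: fun_eq_iff)
  have "expectation (\<lambda>\<omega>. h (X \<omega>)) = expectation (\<lambda>\<omega>. \<Sum>i. f i \<omega>)"
    by (rule Bochner_Integration.integral_cong) (use f_eq in \<open>auto simp: sums_iff\<close>)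
  also have "\<dots> = (\<Sum>i. expectation (f i))"
  proof (rule integral_suminf)
    show "integrable M (f i)" for i unfolding f_def
      by (intro integrable_mult_right integrable_real_indicator) (auto simp: emeasure_eq_measure)
    show "AE \<omega> in M. summable (\<lambda>i. norm (f i \<omega>))"
    proof (rule AE_I2)
      fix \<omega> assume "\<omega> \<in> space M"
      show "summable (\<lambda>i. norm (f i \<omega>))"
        by (rule summable_finite[of "{X \<omega>}"]) (auto simp: f_def)
    qed
    have "(\<integral>\<omega>. norm (f i \<omega>) \<partial>M) = \<bar>h i\<bar> * p i" for i
      unfolding f_def using dist[of i] by (simp add: abs_mult)
    moreover have "summable (\<lambda>i. \<bar>h i\<bar> * p i)"
      by (rule summable_comparison_test'[OF summable_mult[OF psum, of c], of 0])
         (auto simp: abs_mult p0 intro!: mult_right_mono h)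
    ultimately show "summable (\<lambda>i. \<integral>\<omega>. norm (f i \<omega>) \<partial>M)" by simp
  qed
  also have "\<dots> = (\<Sum>i. p i * h i)"
    unfolding f_def using dist by (simp add: mult.commute)
  finally show ?thesis .
qed

section \<open>Events on finitely many coordinates, product formula, Borel-Cantelli lemmas\<close>

locale indep_labels = prob_space M for M :: "'a measure" +
  fixes I :: "'i set" and L :: "'i \<Rightarrow> 'a \<Rightarrow> nat"
  assumes indep_L: "indep_vars (\<lambda>_. count_space UNIV) L I"
begin

abbreviation event :: "(('i \<Rightarrow> nat) \<Rightarrow> bool) \<Rightarrow> 'a set" where
  "event Q \<equiv> {\<omega> \<in> space M. Q (\<lambda>i. L i \<omega>)}"

lemma L_measurable [measurable]: "i \<in> I \<Longrightarrow> L i \<in> measurable M (count_space UNIV)"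
  using indep_L unfolding indep_vars_def by auto

text \<open>A finite product of countable discrete spaces carries the full power set as its
  sigma-algebra. Hence every predicate on finitely many labels is a preimage of a measurable set,
  whatever the predicate looks like.\<close>

lemma event_restrict:
  assumes "finite K" "K \<subseteq> I" "depends_on K Q"
  shows "event Q = (\<lambda>\<omega>. restrict (\<lambda>i. L i \<omega>) K) -` {f \<in> PiE K (\<lambda>_. UNIV). Q f} \<inter> space M"
    and "{f \<in> PiE K (\<lambda>_. UNIV). Q f} \<in> sets (PiM K (\<lambda>_. count_space (UNIV :: nat set)))"
  using depends_on_restrict[OF assms(3)] count_space_PiM_finite[OF assms(1), of "\<lambda>_. UNIV :: nat set"]
  by auto

lemma event_measurable:
  assumes "finite K" "K \<subseteq> I" "depends_on K Q"
  shows "event Q \<in> events"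
proof -
  have "(\<lambda>\<omega>. restrict (\<lambda>i. L i \<omega>) K) \<in> measurable M (PiM K (\<lambda>_. count_space UNIV))"
    using assms(2) by (intro measurable_restrict) auto
  from measurable_sets[OF this event_restrict(2)[OF assms]]
  show ?thesis unfolding event_restrict(1)[OF assms] .
qed

lemma prob_event_prod:
  assumes J: "finite J" "J \<noteq> {}" and disj: "disjoint_family_on K J"
    and K: "\<And>j. j \<in> J \<Longrightarrow> finite (K j)" "\<And>j. j \<in> J \<Longrightarrow> K j \<subseteq> I"
    and dep: "\<And>j. j \<in> J \<Longrightarrow> depends_on (K j) (Q j)"
  shows "prob (event (\<lambda>f. \<forall>j\<in>J. Q j f)) = (\<Prod>j\<in>J. prob (event (Q j)))"
proof -
  have iv: "indep_vars (\<lambda>j. PiM (K j) (\<lambda>_. count_space UNIV)) (\<lambda>j \<omega>. restrict (\<lambda>i. L i \<omega>) (K j)) J"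
    by (rule indep_vars_restrict[OF indep_L]) (use K disj in auto)
  define A where "A j = {f \<in> PiE (K j) (\<lambda>_. UNIV). Q j f}" for j
  have e: "event (Q j) = (\<lambda>\<omega>. restrict (\<lambda>i. L i \<omega>) (K j)) -` A j \<inter> space M"
    and A: "A j \<in> sets (PiM (K j) (\<lambda>_. count_space (UNIV :: nat set)))" if "j \<in> J" for j
    using event_restrict[OF K(1) K(2) dep] that unfolding A_def by auto
  have "event (\<lambda>f. \<forall>j\<in>J. Q j f) = (\<Inter>j\<in>J. event (Q j))"
    using J by auto
  also have "\<dots> = (\<Inter>j\<in>J. (\<lambda>\<omega>. restrict (\<lambda>i. L i \<omega>) (K j)) -` A j \<inter> space M)"
    using e by auto
  also have "prob \<dots> = (\<Prod>j\<in>J. prob ((\<lambda>\<omega>. restrict (\<lambda>i. L i \<omega>) (K j)) -` A j \<inter> space M))"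
    by (rule indep_varsD_finite[OF iv]) (use J A in auto)
  also have "\<dots> = (\<Prod>j\<in>J. prob (event (Q j)))"
    using e by (intro prod.cong) auto
  finally show ?thesis .
qed

lemma prob_event_conj:
  assumes "finite K1" "K1 \<subseteq> I" "depends_on K1 Q1" "finite K2" "K2 \<subseteq> I" "depends_on K2 Q2"
    and "K1 \<inter> K2 = {}"
  shows "prob (event (\<lambda>f. Q1 f \<and> Q2 f)) = prob (event Q1) * prob (event Q2)"
proof -
  have "prob (event (\<lambda>f. \<forall>j\<in>(UNIV::bool set). case_bool Q1 Q2 j f))
      = (\<Prod>j\<in>UNIV. prob (event (case_bool Q1 Q2 j)))"
    by (rule prob_event_prod[where K = "case_bool K1 K2"])
       (use assms in \<open>auto split: bool.split simp: disjoint_family_on_def\<close>)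
  moreover have "(\<forall>j\<in>(UNIV::bool set). case_bool Q1 Q2 j f) \<longleftrightarrow> Q1 f \<and> Q2 f" for f
    by (auto simp: UNIV_bool)
  ultimately show ?thesis by (simp add: UNIV_bool mult.commute)
qed

lemma prob_event_neg:
  assumes "finite K" "K \<subseteq> I" "depends_on K Q"
  shows "prob (event (\<lambda>f. \<not> Q f)) = 1 - prob (event Q)"
proof -
  have "event (\<lambda>f. \<not> Q f) = space M - event Q" by auto
  then show ?thesis using prob_compl[OF event_measurable[OF assms]] by simp
qed

lemma AE_eventually_not_event:
  fixes Q :: "nat \<Rightarrow> ('i \<Rightarrow> nat) \<Rightarrow> bool"
  assumes "\<And>n. finite (K n)" "\<And>n. K n \<subseteq> I" "\<And>n. depends_on (K n) (Q n)"
    and bound: "\<And>n. n \<ge> start \<Longrightarrow> prob (event (Q n)) \<le> b n" and b: "summable b"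
  shows "AE \<omega> in M. eventually (\<lambda>n. \<not> Q n (\<lambda>i. L i \<omega>)) sequentially"
proof -
  have "AE \<omega> in M. eventually (\<lambda>n. \<omega> \<in> space M - event (Q n)) sequentially"
  proof (rule borel_cantelli_AE1)
    show "event (Q n) \<in> events" for n by (rule event_measurable[of "K n"]) (use assms in auto)
    show "summable (\<lambda>n. prob (event (Q n)))"
      by (rule summable_comparison_test'[OF b, of start]) (use bound in auto)
  qed (simp add: emeasure_eq_measure)
  then show ?thesis
    by (rule AE_mp) (auto intro!: AE_I2 elim: eventually_mono)
qed

text \<open>The second Borel-Cantelli lemma, in a form that needs only lower bounds \<open>b\<close>
  for the probabilities. From 1 - x \<le> exp (-x) and independence, the chance that no event occurs
  between \<open>a\<close> and \<open>c\<close> is at most exp of minus the partial sum of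
  \<open>b\<close>.\<close>

lemma AE_frequently_event:
  fixes Q :: "nat \<Rightarrow> ('i \<Rightarrow> nat) \<Rightarrow> bool"
  assumes K: "\<And>n. finite (K n)" "\<And>n. K n \<subseteq> I" and dep: "\<And>n. depends_on (K n) (Q n)"
    and disj: "disjoint_family_on K {start..}"
    and bound: "\<And>n. n \<ge> start \<Longrightarrow> b n \<le> prob (event (Q n))"
    and b0: "\<And>n. b n \<ge> 0" and b: "\<not> summable b"
  shows "AE \<omega> in M. frequently (\<lambda>n. Q n (\<lambda>i. L i \<omega>)) sequentially"
proof -
  have tail: "AE \<omega> in M. \<exists>n\<ge>a. Q n (\<lambda>i. L i \<omega>)" if a: "a \<ge> start" for a
  proof -
    define N where "N = {\<omega> \<in> space M. \<forall>n\<ge>a. \<not> Q n (\<lambda>i. L i \<omega>)}"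
    have ev: "event (\<lambda>f. \<not> Q n f) \<in> events" for n
      by (rule event_measurable[of "K n"]) (use K dep in \<open>auto intro: depends_on_not\<close>)
    have Neq: "N = (\<Inter>n\<in>{a..}. event (\<lambda>f. \<not> Q n f))" unfolding N_def by auto
    have Nm: "N \<in> events"
      unfolding Neq using ev by (intro sets.countable_INT') auto
    have le: "prob N \<le> exp (- (\<Sum>n=a..<c. b n))" if "c > a" for c
    proof -
      have "prob N \<le> prob (event (\<lambda>f. \<forall>n\<in>{a..<c}. \<not> Q n f))"
      proof (rule finite_measure_mono)
        show "event (\<lambda>f. \<forall>n\<in>{a..<c}. \<not> Q n f) \<in> events"
        proof (rule event_measurable[of "\<Union>n\<in>{a..<c}. K n"])
          show "depends_on (\<Union>n\<in>{a..<c}. K n) (\<lambda>f. \<forall>n\<in>{a..<c}. \<not> Q n f)"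
          proof (rule depends_on_Ball)
            fix n assume "n \<in> {a..<c}"
            then show "depends_on (\<Union>n\<in>{a..<c}. K n) (\<lambda>f. \<not> Q n f)"
              by (intro depends_on_not depends_on_mono[OF dep]) auto
          qed
        qed (use K in auto)
      qed (auto simp: N_def)
      also have "\<dots> = (\<Prod>n\<in>{a..<c}. prob (event (\<lambda>f. \<not> Q n f)))"
        by (rule prob_event_prod[where K = K])
           (use K dep that a disj in \<open>auto intro: depends_on_not disjoint_family_on_mono[of _ "{start..}"]\<close>)
      also have "\<dots> \<le> (\<Prod>n\<in>{a..<c}. exp (- b n))"
      proof (rule prod_mono, safe)
        fix n assume n: "n \<in> {a..<c}"
        have "prob (event (\<lambda>f. \<not> Q n f)) = 1 - prob (event (Q n))"
          by (rule prob_event_neg[OF K(1) K(2) dep])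
        also have "\<dots> \<le> 1 + (- b n)" using bound[of n] n a by auto
        also have "\<dots> \<le> exp (- b n)" by (rule exp_ge_add_one_self)
        finally show "prob (event (\<lambda>f. \<not> Q n f)) \<le> exp (- b n)" .
      qed auto
      also have "\<dots> = exp (- (\<Sum>n=a..<c. b n))" by (simp add: exp_sum sum_negf[symmetric])
      finally show ?thesis .
    qed
    \<comment> \<open>If \<open>N\<close> had positive probability, its logarithm would bound all
      partial sums of \<open>b\<close>, which would make \<open>b\<close> summable.\<close>
    have "prob N = 0"
    proof (rule ccontr)
      assume "prob N \<noteq> 0"
      then have pos: "prob N > 0" by (simp add: less_le)
      have bd: "(\<Sum>n=a..<c. b n) \<le> - ln (prob N)" if "c > a" for c
      proof -
        have "exp (ln (prob N)) \<le> exp (- (\<Sum>n=a..<c. b n))"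
          using le[OF that] pos by simp
        then show ?thesis by simp
      qed
      have "summable b"
      proof (rule bounded_imp_summable)
        fix m
        have "(\<Sum>n\<le>m. b n) \<le> (\<Sum>n<Suc (max m a). b n)"
          by (rule sum_mono2) (use b0 in auto)
        also have "{..<Suc (max m a)} = {..<a} \<union> {a..<Suc (max m a)}" by auto
        also have "sum b \<dots> = sum b {..<a} + sum b {a..<Suc (max m a)}"
          by (rule sum.union_disjoint) auto
        also have "\<dots> \<le> sum b {..<a} - ln (prob N)" using bd[of "Suc (max m a)"] by auto
        finally show "(\<Sum>n\<le>m. b n) \<le> sum b {..<a} - ln (prob N)" .
      qed (use b0 in auto)
      with b show False by simp
    qed
    then have "AE \<omega> in M. \<omega> \<notin> N" using Nm by (simp add: prob_eq_0)
    then show ?thesis by (rule AE_mp) (auto intro!: AE_I2 simp: N_def)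
  qed
  have "AE \<omega> in M. \<forall>a. \<exists>n\<ge>max a start. Q n (\<lambda>i. L i \<omega>)"
    unfolding AE_all_countable by (intro allI tail) simp
  then show ?thesis
    by (rule AE_mp) (auto intro!: AE_I2 simp: frequently_sequentially)
qed

subsection \<open>Concentration and anti-concentration\<close>

text \<open>The summand may vary with the coordinate, so that one sum can mix labels of both
  sequences and carry signs. The bound holds for every value \<open>y\<close>, not just almost
  surely, which makes all powers integrable at once.\<close>

definition centred :: "('i \<Rightarrow> nat \<Rightarrow> real) \<Rightarrow> 'i set \<Rightarrow> bool" where
  "centred x K \<longleftrightarrow> (\<forall>i\<in>K. (\<forall>y. \<bar>x i y\<bar> \<le> 1) \<and> expectation (\<lambda>\<omega>. x i (L i \<omega>)) = 0)"

lemma centred_subset: "centred x K \<Longrightarrow> J \<subseteq> K \<Longrightarrow> centred x J"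
  unfolding centred_def by auto

lemma indep_real:
  assumes "K \<subseteq> I"
  shows "indep_vars (\<lambda>_. borel) (\<lambda>i \<omega>. x i (L i \<omega>) :: real) K"
  by (rule indep_vars_compose2[OF indep_vars_subset[OF indep_L assms]]) auto

lemma hoeffding:
  assumes K: "finite K" "K \<subseteq> I" "centred x K" "card K \<le> n" and t: "t \<ge> 0"
  shows "prob (event (\<lambda>f. \<bar>\<Sum>i\<in>K. x i (f i)\<bar> > t)) \<le> 2 * exp (- t\<^sup>2 / (2 * real n))"
proof (cases "K = {}")
  case True
  then show ?thesis using t by simp
next
  case False
  then have c: "card K > 0" using K by (simp add: card_gt_0_iff)
  interpret H: Hoeffding_ineq M K "\<lambda>i \<omega>. x i (L i \<omega>)" "\<lambda>_. -1" "\<lambda>_. 1"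
      "\<Sum>i\<in>K. expectation (\<lambda>\<omega>. x i (L i \<omega>))"
  proof unfold_locales
    show "indep_vars (\<lambda>_. borel) (\<lambda>i \<omega>. x i (L i \<omega>)) K" by (rule indep_real[OF K(2)])
  qed (use K in \<open>auto simp: centred_def abs_le_iff minus_le_iff intro!: AE_I2\<close>)
  have e: "(\<Sum>i\<in>K. expectation (\<lambda>\<omega>. x i (L i \<omega>))) = 0"
    using K unfolding centred_def by simp
  have "prob (event (\<lambda>f. \<bar>\<Sum>i\<in>K. x i (f i)\<bar> > t)) \<le> prob (event (\<lambda>f. \<bar>\<Sum>i\<in>K. x i (f i)\<bar> \<ge> t))"
    by (rule finite_measure_mono)
       (auto intro!: event_measurable[OF K(1,2)] depends_on_sum[where P="\<lambda>s. t \<le> \<bar>s\<bar>"])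
  also have "\<dots> \<le> 2 * exp (-2 * t\<^sup>2 / (\<Sum>i\<in>K. (1 - (-1))\<^sup>2))"
    using H.Hoeffding_ineq_abs_ge[OF t] c unfolding e by simp
  also have "\<dots> = 2 * exp (- (t\<^sup>2 / (2 * real (card K))))" by (simp add: field_simps)
  also have "\<dots> \<le> 2 * exp (- (t\<^sup>2 / (2 * real n)))"
    using c K(4) by (auto intro!: divide_left_mono mult_pos_pos)
  finally show ?thesis by simp
qed

lemma integrable_bounded:
  fixes f :: "'a \<Rightarrow> real"
  assumes "f \<in> borel_measurable M" "\<And>\<omega>. \<bar>f \<omega>\<bar> \<le> c"
  shows "integrable M f"
  by (rule integrable_const_bound[of _ c]) (use assms in auto)

lemma sum_centred_bound:
  assumes "centred x K" "finite K"
  shows "\<bar>\<Sum>i\<in>K. x i (f i)\<bar> \<le> real (card K)"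
proof -
  have "\<bar>\<Sum>i\<in>K. x i (f i)\<bar> \<le> (\<Sum>i\<in>K. \<bar>x i (f i)\<bar>)" by (rule sum_abs)
  also have "\<dots> \<le> (\<Sum>i\<in>K. 1)" by (rule sum_mono) (use assms in \<open>auto simp: centred_def\<close>)
  finally show ?thesis by simp
qed

definition vsum :: "('i \<Rightarrow> nat \<Rightarrow> real) \<Rightarrow> 'i set \<Rightarrow> real" where
  "vsum x K = (\<Sum>i\<in>K. expectation (\<lambda>\<omega>. (x i (L i \<omega>))\<^sup>2))"

lemma vsum_nonneg: "vsum x K \<ge> 0"
  unfolding vsum_def by (intro sum_nonneg integral_nonneg) auto

text \<open>Induction on \<open>K\<close>, splitting off one summand X with second moment v from the
  rest Z with second moment V. The odd mixed terms vanish since X and Z have mean 0, and E X^4 \<le>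
  v since \<bar>X\<bar> \<le> 1. This leaves v + 6 v V + V + 3 V^2, which is at most (v + V) + 3 (v
  + V)^2. The three claims are proved together because the fourth moment uses the other two.\<close>

lemma moments:
  assumes "finite K" "K \<subseteq> I" "centred x K"
  shows "expectation (\<lambda>\<omega>. \<Sum>i\<in>K. x i (L i \<omega>)) = 0"
    and "expectation (\<lambda>\<omega>. (\<Sum>i\<in>K. x i (L i \<omega>))\<^sup>2) = vsum x K"
    and "expectation (\<lambda>\<omega>. (\<Sum>i\<in>K. x i (L i \<omega>)) ^ 4) \<le> vsum x K + 3 * (vsum x K)\<^sup>2"
  using assms
proof (induction K rule: finite_induct)
  case empty
  { case 1 then show ?case by simp }
  { case 2 then show ?case by (simp add: vsum_def) }
  { case 3 then show ?case by (simp add: vsum_def) }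
next
  case (insert a K)
  define X where "X \<omega> = x a (L a \<omega>)" for \<omega>
  define Z where "Z \<omega> = (\<Sum>i\<in>K. x i (L i \<omega>))" for \<omega>
  have goal: "expectation (\<lambda>\<omega>. \<Sum>i\<in>insert a K. x i (L i \<omega>)) = 0 \<and>
     expectation (\<lambda>\<omega>. (\<Sum>i\<in>insert a K. x i (L i \<omega>))\<^sup>2) = vsum x (insert a K) \<and>
     expectation (\<lambda>\<omega>. (\<Sum>i\<in>insert a K. x i (L i \<omega>)) ^ 4)
        \<le> vsum x (insert a K) + 3 * (vsum x (insert a K))\<^sup>2"
    if sub: "insert a K \<subseteq> I" and cen: "centred x (insert a K)"
  proof -
    have cK: "centred x K" using cen by (rule centred_subset) auto
    have [measurable]: "X \<in> borel_measurable M" unfolding X_def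
      by (rule measurable_compose[OF L_measurable]) (use sub in auto)
    have [measurable]: "Z \<in> borel_measurable M" unfolding Z_def
      using sub by (intro borel_measurable_sum measurable_compose[OF L_measurable]) auto
    have ind: "indep_var borel X borel Z"
      unfolding X_def[abs_def] Z_def[abs_def]
      by (rule indep_vars_sum[OF insert(1,2) indep_real[OF sub, of x]])
    define c where "c = real (card K) + 1"
    have bX: "\<bar>X \<omega>\<bar> \<le> 1" for \<omega> using cen unfolding X_def centred_def by auto
    have bZ: "\<bar>Z \<omega>\<bar> \<le> c" for \<omega>
      using sum_centred_bound[OF cK insert(1), of "\<lambda>i. L i \<omega>"] unfolding Z_def c_def by simp
    have c0: "c \<ge> 0" unfolding c_def by simp
    have mom: "integrable M (\<lambda>\<omega>. X \<omega> ^ k * Z \<omega> ^ l)"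
      "expectation (\<lambda>\<omega>. X \<omega> ^ k * Z \<omega> ^ l) = expectation (\<lambda>\<omega>. X \<omega> ^ k) * expectation (\<lambda>\<omega>. Z \<omega> ^ l)"
      for k l
    proof -
      have iX: "integrable M (\<lambda>\<omega>. X \<omega> ^ k)"
        by (rule integrable_bounded[of _ 1]) (auto simp: power_abs intro!: power_le_one bX)
      have iZ: "integrable M (\<lambda>\<omega>. Z \<omega> ^ l)"
        by (rule integrable_bounded[of _ "c ^ l"]) (auto simp: power_abs intro!: power_mono bZ)
      have "indep_var borel ((\<lambda>u. u ^ k) \<circ> X) borel ((\<lambda>u. u ^ l) \<circ> Z)"
        by (rule indep_var_compose[OF ind]) auto
      then have ik: "indep_var borel (\<lambda>\<omega>. X \<omega> ^ k) borel (\<lambda>\<omega>. Z \<omega> ^ l)" by (simp add: comp_def)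
      show "integrable M (\<lambda>\<omega>. X \<omega> ^ k * Z \<omega> ^ l)"
        by (rule indep_var_integrable[OF ik iX iZ])
      show "expectation (\<lambda>\<omega>. X \<omega> ^ k * Z \<omega> ^ l) = expectation (\<lambda>\<omega>. X \<omega> ^ k) * expectation (\<lambda>\<omega>. Z \<omega> ^ l)"
        by (rule indep_var_lebesgue_integral[OF ik iX iZ])
    qed
    have EX: "expectation X = 0" using cen unfolding centred_def X_def[abs_def] by auto
    have EZ: "expectation Z = 0" and EZ2: "expectation (\<lambda>\<omega>. Z \<omega> ^ 2) = vsum x K"
      and EZ4: "expectation (\<lambda>\<omega>. Z \<omega> ^ 4) \<le> vsum x K + 3 * (vsum x K)\<^sup>2"
      using insert.IH sub cK unfolding Z_def[abs_def] by auto
    define v where "v = expectation (\<lambda>\<omega>. X \<omega> ^ 2)"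
    have v0: "v \<ge> 0" unfolding v_def by (rule Bochner_Integration.integral_nonneg) auto
    have vs: "vsum x (insert a K) = v + vsum x K"
      unfolding vsum_def v_def X_def using insert by simp
    have s: "(\<Sum>i\<in>insert a K. x i (L i \<omega>)) = X \<omega> + Z \<omega>" for \<omega>
      unfolding X_def Z_def using insert by simp
    have intX: "integrable M (\<lambda>\<omega>. X \<omega> ^ k)" and intZ: "integrable M (\<lambda>\<omega>. Z \<omega> ^ k)" for k
      using mom(1)[of k 0] mom(1)[of 0 k] by auto
    have X4: "expectation (\<lambda>\<omega>. X \<omega> ^ 4) \<le> v" unfolding v_def
    proof (rule integral_mono[OF intX intX])
      fix \<omega>
      have "\<bar>X \<omega>\<bar> ^ 4 \<le> \<bar>X \<omega>\<bar> ^ 2" by (rule power_decreasing) (use bX in auto)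
      then show "X \<omega> ^ 4 \<le> X \<omega> ^ 2" by simp
    qed
    have e1: "expectation (\<lambda>\<omega>. X \<omega> + Z \<omega>) = 0"
      using intX[of 1] intZ[of 1] EX EZ by simp
    have "expectation (\<lambda>\<omega>. (X \<omega> + Z \<omega>)\<^sup>2)
        = expectation (\<lambda>\<omega>. X \<omega> ^ 2 + 2 * (X \<omega> ^ 1 * Z \<omega> ^ 1) + Z \<omega> ^ 2)"
      by (rule arg_cong[where f = expectation]) (auto simp: power2_eq_square algebra_simps)
    also have "\<dots> = v + 2 * (expectation (\<lambda>\<omega>. X \<omega> ^ 1) * expectation (\<lambda>\<omega>. Z \<omega> ^ 1)) + vsum x K"
      unfolding v_def EZ2[symmetric] mom(2)[symmetric]
      using intX[of 2] intZ[of 2] mom(1)[of 1 1] by simp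
    finally have e2: "expectation (\<lambda>\<omega>. (X \<omega> + Z \<omega>)\<^sup>2) = vsum x (insert a K)"
      using EX vs by simp
    have "expectation (\<lambda>\<omega>. (X \<omega> + Z \<omega>) ^ 4)
        = expectation (\<lambda>\<omega>. X \<omega> ^ 4 + 4 * (X \<omega> ^ 3 * Z \<omega> ^ 1) + 6 * (X \<omega> ^ 2 * Z \<omega> ^ 2)
             + 4 * (X \<omega> ^ 1 * Z \<omega> ^ 3) + Z \<omega> ^ 4)"
      by (rule arg_cong[where f = expectation]) (auto simp: power2_eq_square power3_eq_cube power4_eq_xxxx algebra_simps)
    also have "\<dots> = expectation (\<lambda>\<omega>. X \<omega> ^ 4)
        + 4 * (expectation (\<lambda>\<omega>. X \<omega> ^ 3) * expectation (\<lambda>\<omega>. Z \<omega> ^ 1))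
        + 6 * (expectation (\<lambda>\<omega>. X \<omega> ^ 2) * expectation (\<lambda>\<omega>. Z \<omega> ^ 2))
        + 4 * (expectation (\<lambda>\<omega>. X \<omega> ^ 1) * expectation (\<lambda>\<omega>. Z \<omega> ^ 3)) + expectation (\<lambda>\<omega>. Z \<omega> ^ 4)"
      unfolding mom(2)[symmetric]
      using intX[of 4] intZ[of 4] mom(1)[of 3 1] mom(1)[of 2 2] mom(1)[of 1 3] by simp
    also have "\<dots> \<le> v + 6 * (v * vsum x K) + (vsum x K + 3 * (vsum x K)\<^sup>2)"
      using EX EZ EZ4 X4 EZ2 by (simp add: v_def)
    also have "\<dots> \<le> vsum x (insert a K) + 3 * (vsum x (insert a K))\<^sup>2"
      unfolding vs by (simp add: power2_eq_square algebra_simps)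
    finally have e4: "expectation (\<lambda>\<omega>. (X \<omega> + Z \<omega>) ^ 4)
        \<le> vsum x (insert a K) + 3 * (vsum x (insert a K))\<^sup>2" .
    show ?thesis unfolding s using e1 e2 e4 by simp
  qed
  { case 1 then show ?case using goal by blast }
  { case 2 then show ?case using goal by blast }
  { case 3 then show ?case using goal by blast }
qed

text \<open>A polynomial form of the Paley--Zygmund argument. The quartic
  \<open>w + 7/10 w\<^sup>2 - 6/100 w\<^sup>4 - 11/100\<close> is nonpositive for \<open>w < 1/10\<close> and never exceeds 5, whereas a
  centred variable with variance 1 and fourth moment at most 4 gives it mean at least 35/100.\<close>

lemma anti_concentration:
  assumes K: "finite K" "K \<subseteq> I" "centred x K" and V: "vsum x K \<ge> 1"
  shows "prob (event (\<lambda>f. (\<Sum>i\<in>K. x i (f i)) \<ge> sqrt (vsum x K) / 10)) \<ge> 1 / 16"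
proof -
  define s where "s = sqrt (vsum x K)"
  have s: "s > 0" "s\<^sup>2 = vsum x K" using V unfolding s_def by auto
  define W where "W \<omega> = (\<Sum>i\<in>K. x i (L i \<omega>)) / s" for \<omega>
  define E where "E = event (\<lambda>f. (\<Sum>i\<in>K. x i (f i)) \<ge> s / 10)"
  have E_ev: "E \<in> events" unfolding E_def
    by (rule event_measurable[OF K(1,2)]) (rule depends_on_sum[where P="\<lambda>u. s / 10 \<le> u"], simp)
  have "(\<lambda>\<omega>. x i (L i \<omega>)) \<in> borel_measurable M" if "i \<in> K" for i
    by (rule measurable_compose[OF L_measurable]) (use that K in auto)
  then have [measurable]: "W \<in> borel_measurable M" unfolding W_def
    by (intro borel_measurable_divide borel_measurable_sum borel_measurable_const)
  have bW: "\<bar>W \<omega>\<bar> \<le> real (card K) / s" for \<omega>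
    using sum_centred_bound[OF K(3,1), of "\<lambda>i. L i \<omega>"] s unfolding W_def
    by (auto simp: abs_mult divide_simps)
  have intW: "integrable M (\<lambda>\<omega>. W \<omega> ^ k)" for k
    by (rule integrable_bounded[of _ "(real (card K) / s) ^ k"])
       (auto simp: power_abs simp del: power_divide intro!: power_mono bW)
  have W1: "expectation W = 0"
    unfolding W_def[abs_def] using moments(1)[OF K] by simp
  have W2: "expectation (\<lambda>\<omega>. W \<omega> ^ 2) = 1"
    unfolding W_def[abs_def] power_divide using moments(2)[OF K] s V by simp
  \<comment> \<open>The assumption \<open>vsum x K \<ge> 1\<close> absorbs the linear term of the
    fourth-moment bound into the quadratic one.\<close>
  have W4: "expectation (\<lambda>\<omega>. W \<omega> ^ 4) \<le> 4"
  proof -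
    have "expectation (\<lambda>\<omega>. (\<Sum>i\<in>K. x i (L i \<omega>)) ^ 4) \<le> vsum x K * 1 + 3 * (vsum x K)\<^sup>2"
      using moments(3)[OF K] by simp
    also have "\<dots> \<le> vsum x K * vsum x K + 3 * (vsum x K)\<^sup>2"
      by (intro add_right_mono mult_left_mono V vsum_nonneg)
    also have "\<dots> = 4 * s ^ 4" using s(2) by (simp add: power2_eq_square power4_eq_xxxx flip: s(2))
    finally show ?thesis using s(1) unfolding W_def[abs_def] power_divide by (simp add: divide_simps)
  qed
  have pw: "W \<omega> + 7/10 * W \<omega> ^ 2 - 6/100 * W \<omega> ^ 4 - 11/100 \<le> 5 * indicator E \<omega>"
    if \<omega>: "\<omega> \<in> space M" for \<omega>
  proof -
    define w where "w = W \<omega>"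
    have up: "w + 7/10 * w\<^sup>2 - 6/100 * w^4 - 11/100 \<le> 5"
    proof -
      \<comment> \<open>The two squares are chosen so that 96/100 - 26/100 gives the coefficient
        7/10 of the square and 2 * 26/100 * 100/52 = 1 that of the linear term; their constants add
        up to less than 5 + 11/100.\<close>
      have "0 \<le> 6/100 * (w\<^sup>2 - 8)\<^sup>2 + 26/100 * (w - 100/52)\<^sup>2" by simp
      also have "\<dots> \<le> 5 + 11/100 - w - 7/10 * w\<^sup>2 + 6/100 * w^4"
        by (simp add: power2_eq_square power4_eq_xxxx algebra_simps)
      finally show ?thesis by simp
    qed
    have low: "w + 7/10 * w\<^sup>2 - 6/100 * w^4 - 11/100 \<le> 0" if "w < 1/10"
    proof (cases "w \<ge> 0")
      case True
      have "w * w \<le> 1/10 * (1/10)" using True that by (intro mult_mono) auto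
      then have "w\<^sup>2 \<le> 1/100" by (simp add: power2_eq_square)
      moreover have "w ^ 4 \<ge> 0" using True by simp
      ultimately show ?thesis using that by linarith
    next
      case False
      define v where "v = - w"
      have v: "v > 0" using False unfolding v_def by simp
      \<comment> \<open>The factorisation is v^3 - 12 v + 16 = (v - 2)^2 (v + 4), a cubic with a
        double root; the terms behind it make up the remaining coefficients.\<close>
      have "0 \<le> v * (6/100 * ((v - 2)\<^sup>2 * (v + 4)) + 2/100 * v + 4/100) + 11/100"
        using v by (intro add_nonneg_nonneg mult_nonneg_nonneg) auto
      also have "\<dots> = - (w + 7/10 * w\<^sup>2 - 6/100 * w^4 - 11/100)"
        unfolding v_def by (simp add: power2_eq_square power4_eq_xxxx algebra_simps)
      finally show ?thesis by simp
    qed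
    have "\<omega> \<in> E \<longleftrightarrow> w \<ge> 1/10"
      unfolding E_def w_def W_def using \<omega> s(1) by (auto simp: field_simps)
    then show ?thesis using up low unfolding w_def[symmetric] by (auto simp: indicator_def not_le)
  qed
  \<comment> \<open>The left side is 35/100; dividing by the maximum 5 gives 7/100, which exceeds
    1/16.\<close>
  have "7/10 - 6/100 * 4 - 11/100 \<le> 0 + 7/10 * 1 - 6/100 * expectation (\<lambda>\<omega>. W \<omega> ^ 4) - 11/100"
    using W4 by simp
  also have "\<dots> = expectation (\<lambda>\<omega>. W \<omega> + 7/10 * W \<omega> ^ 2 - 6/100 * W \<omega> ^ 4 - 11/100)"
    using intW[of 1] intW[of 2] intW[of 4] W1 W2 by (simp add: prob_space)
  also have "\<dots> \<le> expectation (\<lambda>\<omega>. 5 * indicator E \<omega>)"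
    using intW[of 1] intW[of 2] intW[of 4] E_ev pw
    by (intro integral_mono) (auto simp: emeasure_eq_measure)
  also have "\<dots> = 5 * prob E" using E_ev by simp
  finally show ?thesis unfolding E_def s_def by simp
qed

text \<open>Ottaviani's argument: after the first passage above \<open>2 * t\<close>, the remaining increment stays
  below \<open>t\<close> with probability at least one half.\<close>

lemma maximal_inequality:
  assumes g: "inj g" "g ` {a<..b} \<subseteq> I" "centred x (g ` {a<..b})" and t: "t \<ge> 0" and ab: "a \<le> b"
    and small: "2 * exp (- t\<^sup>2 / (2 * real (b - a))) \<le> 1 / 2"
  shows "prob (event (\<lambda>f. \<exists>k\<in>{a..b}. \<bar>\<Sum>j\<in>{a<..k}. x (g j) (f (g j))\<bar> > 2 * t))
    \<le> 4 * exp (- t\<^sup>2 / (2 * real (b - a)))"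
proof -
  define S where "S k l f = (\<Sum>j\<in>{k<..l}. x (g j) (f (g j)))" for k l f
  have S_eq: "S k l f = (\<Sum>i\<in>g ` {k<..l}. x i (f i))" for k l f
    unfolding S_def using g(1) by (subst sum.reindex) (auto intro: inj_on_subset)
  have dep: "depends_on (g ` {k<..l}) (\<lambda>f. P (S k' l' f))" if "k \<le> k'" "l' \<le> l" for P k l k' l'
    unfolding S_eq by (rule depends_on_sum) (use that in auto)
  define F where "F k f \<longleftrightarrow> \<bar>S a k f\<bar> > 2 * t \<and> (\<forall>i\<in>{a..<k}. \<not> \<bar>S a i f\<bar> > 2 * t)" for k f
  have F_dep: "depends_on (g ` {a<..k}) (F k)" for k
    unfolding F_def by (intro depends_on_conj depends_on_Ball depends_on_not dep) auto
  have sub: "g ` {k<..l} \<subseteq> I" "centred x (g ` {k<..l})" if "a \<le> k" "l \<le> b" for k l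
    using g that by (auto intro: centred_subset[OF g(3)])
  have S_meas: "event (\<lambda>f. P (S k l f)) \<in> events" if "a \<le> k" "l \<le> b" for P k l
    by (rule event_measurable[OF _ sub(1)[OF that] dep]) auto
  have F_meas: "event (F k) \<in> events" if "k \<le> b" for k
    by (rule event_measurable[OF _ sub(1)[OF _ that] F_dep]) auto
  have tail: "prob (event (\<lambda>f. \<bar>S k b f\<bar> \<le> t)) \<ge> 1 / 2" if "a \<le> k" "k \<le> b" for k
  proof -
    have "prob (event (\<lambda>f. \<bar>S k b f\<bar> > t)) \<le> 2 * exp (- t\<^sup>2 / (2 * real (b - a)))"
      unfolding S_eq
      by (rule hoeffding) (use that sub[of k b] t card_image_le[of "{k<..b}" g] in auto)
    moreover have "prob (event (\<lambda>f. \<not> \<bar>S k b f\<bar> > t)) = 1 - prob (event (\<lambda>f. \<bar>S k b f\<bar> > t))"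
      by (rule prob_event_neg[of "g ` {k<..b}"]) (use sub[of k b] that in \<open>auto intro: dep\<close>)
    ultimately show ?thesis using small by (simp add: not_less)
  qed
  \<comment> \<open>On \<open>D k\<close> the walk passes level 2 t for the first time at k and
    afterwards moves by at most t, so its endpoint exceeds t in absolute value. First passage times
    being unique, the sets \<open>D k\<close> are disjoint and their probabilities sum to at most
    that of a large endpoint.\<close>
  define D where "D k = event (\<lambda>f. F k f \<and> \<bar>S k b f\<bar> \<le> t)" for k
  have D_eq: "D k = event (F k) \<inter> event (\<lambda>f. \<bar>S k b f\<bar> \<le> t)" for k
    unfolding D_def by auto
  have D_meas: "D k \<in> events" if "a \<le> k" "k \<le> b" for k
    unfolding D_eq using that by (intro sets.Int F_meas S_meas) auto
  have D_prob: "prob (event (F k)) \<le> 2 * prob (D k)" if "a \<le> k" "k \<le> b" for k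
  proof -
    have "prob (D k) = prob (event (F k)) * prob (event (\<lambda>f. \<bar>S k b f\<bar> \<le> t))"
      unfolding D_def
      by (rule prob_event_conj[of "g ` {a<..k}" _ "g ` {k<..b}"])
         (use that sub[of a k] sub[of k b] F_dep g(1) in \<open>auto intro: dep dest: injD\<close>)
    moreover have "prob (event (F k)) * (1/2) \<le> prob (event (F k)) * prob (event (\<lambda>f. \<bar>S k b f\<bar> \<le> t))"
      by (rule mult_left_mono[OF tail[OF that]]) simp
    ultimately show ?thesis by simp
  qed
  have disj: "disjoint_family_on D {a..b}"
    unfolding disjoint_family_on_def
  proof (intro ballI impI)
    fix m n assume mn: "m \<in> {a..b}" "n \<in> {a..b}" "m \<noteq> n"
    show "D m \<inter> D n = {}"
      using mn unfolding D_def F_def by (cases m n rule: linorder_cases) auto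
  qed
  have "event (\<lambda>f. \<exists>k\<in>{a..b}. \<bar>S a k f\<bar> > 2 * t) \<subseteq> (\<Union>k\<in>{a..b}. event (F k))"
  proof
    fix \<omega> assume "\<omega> \<in> event (\<lambda>f. \<exists>k\<in>{a..b}. \<bar>S a k f\<bar> > 2 * t)"
    then have \<omega>: "\<omega> \<in> space M" and ex: "\<exists>k. k \<in> {a..b} \<and> \<bar>S a k (\<lambda>i. L i \<omega>)\<bar> > 2 * t" by auto
    define k where "k = (LEAST k. k \<in> {a..b} \<and> \<bar>S a k (\<lambda>i. L i \<omega>)\<bar> > 2 * t)"
    have k: "k \<in> {a..b}" "\<bar>S a k (\<lambda>i. L i \<omega>)\<bar> > 2 * t"
      using LeastI_ex[OF ex] unfolding k_def by auto
    moreover have "\<not> \<bar>S a i (\<lambda>i. L i \<omega>)\<bar> > 2 * t" if "i \<in> {a..<k}" for i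
      using not_less_Least[of i "\<lambda>k. k \<in> {a..b} \<and> \<bar>S a k (\<lambda>i. L i \<omega>)\<bar> > 2 * t"] that k(1)
      unfolding k_def[symmetric] by auto
    ultimately show "\<omega> \<in> (\<Union>k\<in>{a..b}. event (F k))" using \<omega> unfolding F_def by auto
  qed
  then have "prob (event (\<lambda>f. \<exists>k\<in>{a..b}. \<bar>S a k f\<bar> > 2 * t)) \<le> prob (\<Union>k\<in>{a..b}. event (F k))"
    by (rule finite_measure_mono) (auto intro!: sets.finite_UN F_meas)
  also have "\<dots> \<le> (\<Sum>k\<in>{a..b}. prob (event (F k)))"
    by (rule finite_measure_subadditive_finite) (auto intro!: F_meas)
  also have "\<dots> \<le> (\<Sum>k\<in>{a..b}. 2 * prob (D k))" by (rule sum_mono) (use D_prob in auto)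
  also have "\<dots> = 2 * prob (\<Union>k\<in>{a..b}. D k)"
    unfolding sum_distrib_left[symmetric]
    by (subst finite_measure_finite_Union[OF _ _ disj]) (auto intro: D_meas)
  also have "prob (\<Union>k\<in>{a..b}. D k) \<le> prob (event (\<lambda>f. \<bar>S a b f\<bar> > t))"
  proof (rule finite_measure_mono)
    show "event (\<lambda>f. \<bar>S a b f\<bar> > t) \<in> events" by (rule S_meas) auto
    show "(\<Union>k\<in>{a..b}. D k) \<subseteq> event (\<lambda>f. \<bar>S a b f\<bar> > t)"
    proof
      fix \<omega> assume "\<omega> \<in> (\<Union>k\<in>{a..b}. D k)"
      then obtain k where k: "k \<in> {a..b}" "\<omega> \<in> D k" by auto
      have "S a b f = S a k f + S k b f" for f
      proof -
        have "{a<..b} = {a<..k} \<union> {k<..b}" using k by auto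
        then show ?thesis unfolding S_def by (simp add: sum.union_disjoint)
      qed
      then show "\<omega> \<in> event (\<lambda>f. \<bar>S a b f\<bar> > t)"
        using k(2) unfolding D_def F_def by auto
    qed
  qed
  also have "prob (event (\<lambda>f. \<bar>S a b f\<bar> > t)) \<le> 2 * exp (- t\<^sup>2 / (2 * real (b - a)))"
    unfolding S_eq
    by (rule hoeffding) (use sub[of a b] t card_image_le[of "{a<..b}" g] in auto)
  finally show ?thesis unfolding S_def by simp
qed

section \<open>Union bounds and randomly chosen labels\<close>

lemma prob_event_Bex:
  assumes X: "finite X" and K: "finite K" "K \<subseteq> I"
    and dep: "\<And>x. x \<in> X \<Longrightarrow> depends_on K (Q x)" and c: "\<And>x. x \<in> X \<Longrightarrow> prob (event (Q x)) \<le> c"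
  shows "prob (event (\<lambda>f. \<exists>x\<in>X. Q x f)) \<le> real (card X) * c"
proof -
  have "event (\<lambda>f. \<exists>x\<in>X. Q x f) = (\<Union>x\<in>X. event (Q x))" by auto
  also have "prob \<dots> \<le> (\<Sum>x\<in>X. prob (event (Q x)))"
    by (rule finite_measure_subadditive_finite) (use X event_measurable[OF K dep] in auto)
  also have "\<dots> \<le> (\<Sum>x\<in>X. c)" by (rule sum_mono) (rule c)
  finally show ?thesis by simp
qed

text \<open>Condition on the label at a coordinate outside \<open>K\<close>: whatever its value, the
  event it selects is independent of it and has probability at most \<open>c\<close>. This controls
  counts of randomly drawn labels without a union over the infinitely many possible labels.\<close>

lemma prob_event_label:
  assumes K: "finite K" "K \<subseteq> I" and k: "k \<in> I" "k \<notin> K"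
    and dep: "\<And>y. depends_on K (Q y)" and c: "\<And>y. prob (event (Q y)) \<le> c"
  shows "prob (event (\<lambda>f. Q (f k) f)) \<le> c"
proof -
  have dk: "depends_on {k} (\<lambda>f. f k = y)" for y by (auto simp: depends_on_def)
  have dky: "depends_on (insert k K) (\<lambda>f. Q y f \<and> f k = y)" for y
    by (intro depends_on_conj depends_on_mono[OF dep] depends_on_mono[OF dk]) auto
  have "(\<lambda>y. prob (event (\<lambda>f. Q y f \<and> f k = y))) sums prob (\<Union>y. event (\<lambda>f. Q y f \<and> f k = y))"
    by (rule finite_measure_UNION)
       (use K k in \<open>auto simp: disjoint_family_on_def intro!: event_measurable[OF _ _ dky]\<close>)
  moreover have "(\<Union>y. event (\<lambda>f. Q y f \<and> f k = y)) = event (\<lambda>f. Q (f k) f)" by auto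
  ultimately have s1: "(\<lambda>y. prob (event (\<lambda>f. Q y f \<and> f k = y))) sums prob (event (\<lambda>f. Q (f k) f))"
    by simp
  have "(\<lambda>y. prob (event (\<lambda>f. f k = y))) sums prob (\<Union>y. event (\<lambda>f. f k = y))"
    by (rule finite_measure_UNION)
       (use K k in \<open>auto simp: disjoint_family_on_def intro!: event_measurable[OF _ _ dk]\<close>)
  moreover have "(\<Union>y. event (\<lambda>f. f k = y)) = space M" by auto
  ultimately have "(\<lambda>y. prob (event (\<lambda>f. f k = y))) sums 1" by (simp add: prob_space)
  then have s2: "(\<lambda>y. c * prob (event (\<lambda>f. f k = y))) sums (c * 1)" by (rule sums_mult)
  have "prob (event (\<lambda>f. Q y f \<and> f k = y)) \<le> c * prob (event (\<lambda>f. f k = y))" for y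
  proof -
    have "prob (event (\<lambda>f. Q y f \<and> f k = y)) = prob (event (Q y)) * prob (event (\<lambda>f. f k = y))"
      by (rule prob_event_conj[OF K dep _ _ dk]) (use k in auto)
    then show ?thesis using c[of y] by (simp add: mult_right_mono)
  qed
  from sums_le[OF this s1 s2] show ?thesis by simp
qed

end

subsection \<open>The two label sequences\<close>

definition dotp :: "(nat \<Rightarrow> real) \<Rightarrow> (nat \<Rightarrow> real) \<Rightarrow> real" where
  "dotp p q = (\<Sum>i. p i * q i)"

lemma dotp_commute: "dotp p q = dotp q p"
  unfolding dotp_def by (simp add: mult.commute)

definition incr :: "(nat \<Rightarrow> real) \<Rightarrow> real \<Rightarrow> (nat \<Rightarrow> 'a \<Rightarrow> nat) \<Rightarrow> nat \<Rightarrow> nat \<Rightarrow> 'a \<Rightarrow> real" where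
  "incr q m A k l \<omega> = (\<Sum>j\<in>{k<..l}. q (A j \<omega>) - m)"

lemma incr_split: "k \<le> l \<Longrightarrow> l \<le> n \<Longrightarrow> incr q m A k n \<omega> = incr q m A k l \<omega> + incr q m A l n \<omega>"
proof -
  assume "k \<le> l" "l \<le> n"
  then have "{k<..n} = {k<..l} \<union> {l<..n}" by auto
  then show ?thesis unfolding incr_def by (simp add: sum.union_disjoint)
qed

lemma Gam_incr: "Gam q A n \<omega> = m * real n + incr q m A 0 n \<omega>"
proof -
  have "{1..n} = {0<..n}" by auto
  then show ?thesis unfolding Gam_def incr_def by (simp add: sum_subtractf)
qed

lemma prob_vector_bounds:
  assumes "prob_vector p" shows "0 \<le> p i" "p i \<le> 1"
proof -
  show "0 \<le> p i" using assms unfolding prob_vector_def by auto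
  have "sum p {i} \<le> suminf p"
    by (rule sum_le_suminf) (use assms in \<open>auto simp: prob_vector_def sums_iff\<close>)
  then show "p i \<le> 1" using assms by (auto simp: prob_vector_def sums_iff)
qed

text \<open>Coordinate \<open>Inl j\<close> is the j-th label of \<open>A\<close> and \<open>Inr j\<close> the j-th label of \<open>B\<close>; the model is
  symmetric under exchanging \<open>(p, A)\<close> with \<open>(q, B)\<close>.\<close>

locale match_model = prob_space M for M :: "'a measure" +
  fixes p q :: "nat \<Rightarrow> real" and A B :: "nat \<Rightarrow> 'a \<Rightarrow> nat"
  assumes p: "prob_vector p" and q: "prob_vector q"
    and indep_AB: "indep_vars (\<lambda>_. count_space UNIV) (case_sum A B) (Inl ` {1..} \<union> Inr ` {1..})"
    and dist_A: "\<And>j i. j \<ge> 1 \<Longrightarrow> prob {\<omega> \<in> space M. A j \<omega> = i} = p i"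
    and dist_B: "\<And>j i. j \<ge> 1 \<Longrightarrow> prob {\<omega> \<in> space M. B j \<omega> = i} = q i"
    and mu_pos: "dotp p q > 0"
begin

sublocale indep_labels M "Inl ` {1..} \<union> Inr ` {1..}" "case_sum A B"
  by unfold_locales (rule indep_AB)

abbreviation mu :: real where "mu \<equiv> dotp p q"

lemma A_measurable: "j \<ge> 1 \<Longrightarrow> A j \<in> measurable M (count_space UNIV)"
  using L_measurable[of "Inl j"] by auto

lemma B_measurable: "j \<ge> 1 \<Longrightarrow> B j \<in> measurable M (count_space UNIV)"
  using L_measurable[of "Inr j"] by auto

text \<open>Lets every estimate for \<open>A\<close> be reused for \<open>B\<close>, and covers the
  case in which only the scores of the second sequence have positive variance.\<close>

lemma swap: "match_model M q p B A"
proof unfold_locales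
  let ?h = "case_sum Inr Inl :: nat + nat \<Rightarrow> nat + nat" and ?I = "Inl ` {1..} \<union> Inr ` {1..} :: (nat + nat) set"
  have eq: "case_sum A B (?h i) = case_sum B A i" for i
    by (simp split: sum.split)
  have "indep_sets (\<lambda>i. {case_sum A B (?h i) -` S \<inter> space M | S. S \<in> sets (count_space UNIV)}) ?I"
    by (rule indep_sets_reindex[of ?h ?I "\<lambda>i. {case_sum A B i -` S \<inter> space M | S. S \<in> sets (count_space UNIV)}"])
       (use indep_AB in \<open>auto simp: inj_on_def image_Un image_image Un_commute indep_vars_def2\<close>)
  then have "indep_sets (\<lambda>i. {case_sum B A i -` S \<inter> space M | S. S \<in> sets (count_space UNIV)}) ?I"
    unfolding eq .
  then show "indep_vars (\<lambda>_. count_space UNIV) (case_sum B A) ?I"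
    unfolding indep_vars_def2 using A_measurable B_measurable by auto
qed (use p q dist_A dist_B mu_pos dotp_commute in auto)

lemma mu_le_1: "mu \<le> 1"
proof -
  have s: "summable p" "suminf p = 1" using p by (auto simp: prob_vector_def sums_iff)
  have "mu \<le> suminf p" unfolding dotp_def
  proof (rule suminf_le)
    show "p i * q i \<le> p i" for i
      using prob_vector_bounds[OF p, of i] prob_vector_bounds[OF q, of i] by (simp add: mult_left_le)
    show "summable (\<lambda>i. p i * q i)"
      by (rule summable_comparison_test'[OF s(1), of 0])
         (use prob_vector_bounds[OF p] prob_vector_bounds[OF q] in \<open>auto simp: abs_mult mult_left_le\<close>)
  qed (rule s)
  then show ?thesis using s by simp
qed

lemma expectation_A:
  "j \<ge> 1 \<Longrightarrow> (\<And>i. \<bar>h i\<bar> \<le> c) \<Longrightarrow> expectation (\<lambda>\<omega>. h (A j \<omega>) :: real) = (\<Sum>i. p i * h i)"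
  by (rule expectation_label[OF A_measurable dist_A p])

lemma expectation_B:
  "j \<ge> 1 \<Longrightarrow> (\<And>i. \<bar>h i\<bar> \<le> c) \<Longrightarrow> expectation (\<lambda>\<omega>. h (B j \<omega>) :: real) = (\<Sum>i. q i * h i)"
  by (rule expectation_label[OF B_measurable dist_B q])

definition step :: "nat + nat \<Rightarrow> nat \<Rightarrow> real" where
  "step i y = case_sum (\<lambda>_. q y - mu) (\<lambda>_. p y - mu) i"

lemma step_simps [simp]: "step (Inl j) y = q y - mu" "step (Inr j) y = p y - mu"
  by (simp_all add: step_def)

lemma expectation_q_A: "j \<ge> 1 \<Longrightarrow> expectation (\<lambda>\<omega>. q (A j \<omega>)) = mu"
  using expectation_A[of j q 1] prob_vector_bounds[OF q] by (simp add: dotp_def)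

lemma expectation_p_B: "j \<ge> 1 \<Longrightarrow> expectation (\<lambda>\<omega>. p (B j \<omega>)) = mu"
  using expectation_B[of j p 1] prob_vector_bounds[OF p] by (simp add: dotp_def mult.commute)

lemma integrable_label:
  assumes "i \<in> Inl ` {1..} \<union> Inr ` {1..}" "\<And>y. \<bar>h y :: real\<bar> \<le> c"
  shows "integrable M (\<lambda>\<omega>. h (case_sum A B i \<omega>))"
  by (rule integrable_bounded[OF measurable_compose[OF L_measurable[OF assms(1)]]]) (use assms in auto)

lemma step_centred: "centred step (Inl ` {1..} \<union> Inr ` {1..})"
  unfolding centred_def
proof (intro ballI conjI allI)
  fix i :: "nat + nat" and y assume i: "i \<in> Inl ` {1..} \<union> Inr ` {1..}"
  show "\<bar>step i y\<bar> \<le> 1"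
    using prob_vector_bounds[OF p, of y] prob_vector_bounds[OF q, of y] mu_le_1 mu_pos i
    by (auto simp: abs_le_iff)
  show "expectation (\<lambda>\<omega>. step i (case_sum A B i \<omega>)) = 0"
    using integrable_label[OF i, of q 1] integrable_label[OF i, of p 1] i
      prob_vector_bounds[OF p] prob_vector_bounds[OF q]
    by (auto simp: expectation_q_A expectation_p_B prob_space)
qed

lemma incr_A: "incr q mu A k l \<omega> = (\<Sum>j\<in>{k<..l}. step (Inl j) (case_sum A B (Inl j) \<omega>))"
  and incr_B: "incr p mu B k l \<omega> = (\<Sum>j\<in>{k<..l}. step (Inr j) (case_sum A B (Inr j) \<omega>))"
  by (simp_all add: incr_def)

lemma abs_incr_le: "\<bar>incr q mu A k l \<omega>\<bar> \<le> real (l - k)"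
proof -
  have "\<bar>incr q mu A k l \<omega>\<bar> \<le> (\<Sum>j\<in>{k<..l}. \<bar>q (A j \<omega>) - mu\<bar>)"
    unfolding incr_def by (rule sum_abs)
  also have "\<dots> \<le> (\<Sum>j\<in>{k<..l}. 1)"
  proof (rule sum_mono)
    fix j show "\<bar>q (A j \<omega>) - mu\<bar> \<le> 1"
      using prob_vector_bounds[OF q, of "A j \<omega>"] mu_le_1 mu_pos by (auto simp: abs_le_iff)
  qed
  finally show ?thesis by simp
qed

section \<open>Almost sure bounds for the walks and the label counts\<close>

lemma summable_union_bound: "summable (\<lambda>n. 16 / real n ^ 2)"
  using summable_mult[OF inverse_power_summable[of 2], of "16::real"] by (simp add: field_simps)

text \<open>There are at most (n+1)^2 pairs, each contributing 2 / n^8. The generous right side is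
  the common summable series of all applications of the first Borel-Cantelli lemma.\<close>

lemma union_bound_le:
  assumes "n \<ge> 1"
  shows "real ((n + 1) * (n + 1)) * (2 * exp (- 8 * ln (real n))) \<le> 16 / real n ^ 2"
proof -
  have "exp (- 8 * ln (real n)) = 1 / real n ^ 8"
    using assms exp_of_nat_mult[of 8 "ln (real n)"] by (simp add: exp_minus inverse_eq_divide)
  moreover have "real ((n + 1) * (n + 1)) \<le> 4 * real n ^ 2"
  proof -
    have "real (n + 1) * real (n + 1) \<le> (2 * real n) * (2 * real n)"
      by (rule mult_mono) (use assms in auto)
    also have "\<dots> = 4 * real n ^ 2" by (simp add: power2_eq_square)
    finally show ?thesis by (simp only: of_nat_mult)
  qed
  ultimately have "real ((n + 1) * (n + 1)) * (2 * exp (- 8 * ln (real n)))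
      \<le> (4 * real n ^ 2) * (2 * (1 / real n ^ 8))"
    by (simp add: mult_right_mono divide_right_mono)
  also have "\<dots> = 8 / real n ^ 6" using assms by (simp add: field_simps eval_nat_numeral)
  also have "\<dots> \<le> 16 / real n ^ 2"
    using assms by (intro frac_le) (auto intro!: power_increasing)
  finally show ?thesis .
qed

text \<open>Uniformity over all windows is essential, because the window between the two policies is
  random. The factor 4 makes Hoeffding's exponent -8 ln n for every window length, which survives
  the union over all pairs.\<close>

lemma AE_incr:
  "AE \<omega> in M. eventually (\<lambda>n. \<forall>l\<le>n. \<forall>k\<le>l. \<bar>incr q mu A k l \<omega>\<bar> \<le> 4 * sqrt (real (l - k) * ln (real n)))
     sequentially"
proof -
  define Q where "Q n f \<longleftrightarrow> (\<exists>x\<in>{..n}\<times>{..n}. fst x < snd x \<and>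
      \<bar>\<Sum>i\<in>Inl ` {fst x<..snd x}. step i (f i)\<bar> > 4 * sqrt (real (snd x - fst x) * ln (real n)))"
    for n and f :: "nat + nat \<Rightarrow> nat"
  have depx: "depends_on (Inl ` {0<..n}) (\<lambda>f. fst x < snd x \<and>
      \<bar>\<Sum>i\<in>Inl ` {fst x<..snd x}. step i (f i)\<bar> > 4 * sqrt (real (snd x - fst x) * ln (real n)))"
    if "x \<in> {..n}\<times>{..n}" for n and x :: "nat \<times> nat"
    by (intro depends_on_conj depends_on_sum) (use that in \<open>auto simp: depends_on_def\<close>)
  have "AE \<omega> in M. eventually (\<lambda>n. \<not> Q n (\<lambda>i. case_sum A B i \<omega>)) sequentially"
  proof (rule AE_eventually_not_event[where K = "\<lambda>n. Inl ` {0<..n}" and start = 1])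
    show "depends_on (Inl ` {0<..n}) (Q n)" for n
      unfolding Q_def by (rule depends_on_Bex) (rule depx)
    fix n :: nat assume n: "n \<ge> 1"
    have "prob (event (Q n)) \<le> real (card ({..n} \<times> {..n})) * (2 * exp (- 8 * ln (real n)))"
      unfolding Q_def
    proof (rule prob_event_Bex[OF _ _ _ depx])
      fix x :: "nat \<times> nat" assume x: "x \<in> {..n} \<times> {..n}"
      obtain k l where kl: "x = (k, l)" by (cases x)
      show "prob (event (\<lambda>f. fst x < snd x \<and> \<bar>\<Sum>i\<in>Inl ` {fst x<..snd x}. step i (f i)\<bar>
          > 4 * sqrt (real (snd x - fst x) * ln (real n)))) \<le> 2 * exp (- 8 * ln (real n))"
      proof (cases "k < l")
        case True
        have "prob (event (\<lambda>f. \<bar>\<Sum>i\<in>Inl ` {k<..l}. step i (f i)\<bar> > 4 * sqrt (real (l - k) * ln (real n))))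
            \<le> 2 * exp (- (4 * sqrt (real (l - k) * ln (real n)))\<^sup>2 / (2 * real (l - k)))"
          by (rule hoeffding)
             (use n card_image_le[of "{k<..l}" Inl] in \<open>auto intro!: centred_subset[OF step_centred]\<close>)
        also have "(4 * sqrt (real (l - k) * ln (real n)))\<^sup>2 = 16 * (real (l - k) * ln (real n))"
          using n by (simp add: power_mult_distrib)
        also have "- (16 * (real (l - k) * ln (real n))) / (2 * real (l - k)) = - 8 * ln (real n)"
          using True by (simp add: field_simps)
        finally show ?thesis using True kl by simp
      qed (use kl in simp)
    qed auto
    also have "\<dots> \<le> 16 / real n ^ 2" using union_bound_le[OF n] by simp
    finally show "prob (event (Q n)) \<le> 16 / real n ^ 2" .
  qed (auto intro: summable_union_bound)
  then show ?thesis
  proof (rule AE_mp, intro AE_I2 impI)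
    fix \<omega> assume "eventually (\<lambda>n. \<not> Q n (\<lambda>i. case_sum A B i \<omega>)) sequentially"
    then show "eventually (\<lambda>n. \<forall>l\<le>n. \<forall>k\<le>l. \<bar>incr q mu A k l \<omega>\<bar> \<le> 4 * sqrt (real (l - k) * ln (real n)))
       sequentially"
    proof (rule eventually_mono, intro allI impI)
      fix n k l assume n: "\<not> Q n (\<lambda>i. case_sum A B i \<omega>)" and kl: "l \<le> n" "k \<le> l"
      show "\<bar>incr q mu A k l \<omega>\<bar> \<le> 4 * sqrt (real (l - k) * ln (real n))"
      proof (cases "k = l")
        case False
        then have "\<not> \<bar>\<Sum>i\<in>Inl ` {k<..l}. step i (case_sum A B i \<omega>)\<bar> > 4 * sqrt (real (l - k) * ln (real n))"
          using n kl unfolding Q_def by auto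
        then show ?thesis by (simp add: sum.reindex incr_def)
      qed (simp add: incr_def)
    qed
  qed
qed

text \<open>For a fixed label y the count is a sum of indicators centred by \<open>p y\<close>, to
  which Hoeffding's inequality applies. The label of interest is \<open>B j \<omega>\<close>,
  independent of the \<open>A\<close> labels, so conditioning on it leaves a union over pairs (m, j)
  only.\<close>

lemma AE_Ncnt:
  "AE \<omega> in M. eventually (\<lambda>n. \<forall>m\<le>n. \<forall>j\<in>{1..n}.
      \<bar>real (Ncnt A m (B j \<omega>) \<omega>) - real m * p (B j \<omega>)\<bar> \<le> 4 * sqrt (real n * ln (real n))) sequentially"
proof -
  define R where "R m t y f \<longleftrightarrow> \<bar>\<Sum>i\<in>Inl ` {0<..m}. of_bool (f i = y) - p y\<bar> > t"
    for m t y and f :: "nat + nat \<Rightarrow> nat"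
  have R_dep: "depends_on (Inl ` {0<..m}) (R m t y)" for m t y
    unfolding R_def
    by (rule depends_on_sum[where x = "\<lambda>_ z. of_bool (z = y) - p y" and P = "\<lambda>s. t < \<bar>s\<bar>"]) auto
  have R_prob: "prob (event (R m (4 * sqrt (real n * ln (real n))) y)) \<le> 2 * exp (- 8 * ln (real n))"
    if "n \<ge> 1" "m \<le> n" for m n y
  proof -
    have "centred (\<lambda>_ z. of_bool (z = y) - p y) (Inl ` {0<..m})"
      unfolding centred_def
    proof (intro ballI conjI allI)
      fix i :: "nat + nat" and z :: nat assume i: "i \<in> Inl ` {0<..m}"
      show "\<bar>of_bool (z = y) - p y\<bar> \<le> 1"
        using prob_vector_bounds[OF p, of y] by (auto simp: abs_le_iff)
      obtain j where j: "i = Inl j" "j \<ge> 1" using i by auto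
      have "expectation (\<lambda>\<omega>. of_bool (A j \<omega> = y) - p y) = (\<Sum>i. p i * (of_bool (i = y) - p y))"
        by (rule expectation_A[OF j(2), of _ 1])
           (use prob_vector_bounds[OF p, of y] in \<open>auto simp: abs_le_iff\<close>)
      also have "\<dots> = 0"
      proof (rule sums_unique[symmetric])
        have "(\<lambda>i. p i * of_bool (i = y)) sums p y"
          using sums_single[of y p] by (simp add: of_bool_def if_distrib eq_commute cong: if_cong)
        moreover have "(\<lambda>i. p i * p y) sums (1 * p y)"
          by (rule sums_mult2) (use p in \<open>auto simp: prob_vector_def\<close>)
        ultimately have "(\<lambda>i. p i * of_bool (i = y) - p i * p y) sums (p y - 1 * p y)"
          by (rule sums_diff)
        then show "(\<lambda>i. p i * (of_bool (i = y) - p y)) sums 0" by (simp add: algebra_simps)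
      qed
      finally show "expectation (\<lambda>\<omega>. of_bool (case_sum A B i \<omega> = y) - p y) = 0" using j by simp
    qed
    then have "prob (event (R m (4 * sqrt (real n * ln (real n))) y))
        \<le> 2 * exp (- (4 * sqrt (real n * ln (real n)))\<^sup>2 / (2 * real n))"
      unfolding R_def using that
      by (intro hoeffding) (auto simp: card_image)
    also have "(4 * sqrt (real n * ln (real n)))\<^sup>2 = 16 * (real n * ln (real n))"
      using that by (simp add: power_mult_distrib)
    also have "- (16 * (real n * ln (real n))) / (2 * real n) = - 8 * ln (real n)"
      using that by (simp add: field_simps)
    finally show ?thesis .
  qed
  define Q where "Q n f \<longleftrightarrow> (\<exists>x\<in>{..n}\<times>{1..n}. R (fst x) (4 * sqrt (real n * ln (real n))) (f (Inr (snd x))) f)"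
    for n and f :: "nat + nat \<Rightarrow> nat"
  have depx: "depends_on (Inl ` {0<..n} \<union> Inr ` {0<..n}) (\<lambda>f. R (fst x) t (f (Inr (snd x))) f)"
    if "x \<in> {..n}\<times>{1..n}" for n t and x :: "nat \<times> nat"
  proof (rule depends_onI)
    fix f g :: "nat + nat \<Rightarrow> nat"
    assume fg: "\<And>i. i \<in> Inl ` {0<..n} \<union> Inr ` {0<..n} \<Longrightarrow> f i = g i"
      and "R (fst x) t (f (Inr (snd x))) f"
    moreover have "f (Inr (snd x)) = g (Inr (snd x))" by (rule fg) (use that in auto)
    moreover have "R (fst x) t y f = R (fst x) t y g" for y
    proof -
      have "\<forall>i\<in>Inl ` {0<..fst x}. f i = g i" using fg that by auto
      then show ?thesis using R_dep[of "fst x" t y] unfolding depends_on_def by blast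
    qed
    ultimately show "R (fst x) t (g (Inr (snd x))) g" by simp
  qed
  have "AE \<omega> in M. eventually (\<lambda>n. \<not> Q n (\<lambda>i. case_sum A B i \<omega>)) sequentially"
  proof (rule AE_eventually_not_event[where K = "\<lambda>n. Inl ` {0<..n} \<union> Inr ` {0<..n}" and start = 1])
    show "depends_on (Inl ` {0<..n} \<union> Inr ` {0<..n}) (Q n)" for n
      unfolding Q_def by (rule depends_on_Bex) (rule depx)
    fix n :: nat assume n: "n \<ge> 1"
    have "prob (event (Q n)) \<le> real (card ({..n} \<times> {1..n})) * (2 * exp (- 8 * ln (real n)))"
      unfolding Q_def
    proof (rule prob_event_Bex[OF _ _ _ depx])
      fix x :: "nat \<times> nat" assume x: "x \<in> {..n} \<times> {1..n}"
      show "prob (event (\<lambda>f. R (fst x) (4 * sqrt (real n * ln (real n))) (f (Inr (snd x))) f))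
          \<le> 2 * exp (- 8 * ln (real n))"
        by (rule prob_event_label[of "Inl ` {0<..fst x}" "Inr (snd x)"])
           (use x n R_dep R_prob in auto)
    qed auto
    also have "\<dots> \<le> real ((n + 1) * (n + 1)) * (2 * exp (- 8 * ln (real n)))"
      by (rule mult_right_mono) (auto simp del: of_nat_mult of_nat_add)
    also have "\<dots> \<le> 16 / real n ^ 2" using union_bound_le[OF n] by simp
    finally show "prob (event (Q n)) \<le> 16 / real n ^ 2" .
  qed (auto intro: summable_union_bound)
  then show ?thesis
  proof (rule AE_mp, intro AE_I2 impI)
    fix \<omega> assume "eventually (\<lambda>n. \<not> Q n (\<lambda>i. case_sum A B i \<omega>)) sequentially"
    then show "eventually (\<lambda>n. \<forall>m\<le>n. \<forall>j\<in>{1..n}.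
      \<bar>real (Ncnt A m (B j \<omega>) \<omega>) - real m * p (B j \<omega>)\<bar> \<le> 4 * sqrt (real n * ln (real n))) sequentially"
    proof (rule eventually_mono, intro allI impI ballI)
      fix n m j assume n: "\<not> Q n (\<lambda>i. case_sum A B i \<omega>)" and mj: "m \<le> n" "j \<in> {1..n}"
      have "(m, j) \<in> {..n} \<times> {1..n}" using mj by auto
      then have "\<not> R m (4 * sqrt (real n * ln (real n))) (B j \<omega>) (\<lambda>i. case_sum A B i \<omega>)"
        using n unfolding Q_def by fastforce
      moreover have "real (Ncnt A m y \<omega>) = (\<Sum>i\<in>{0<..m}. of_bool (A i \<omega> = y))" for y
      proof -
        have "{j \<in> {1..m}. A j \<omega> = y} = {0<..m} \<inter> {i. A i \<omega> = y}" by auto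
        then show ?thesis unfolding Ncnt_def by simp
      qed
      moreover have "(\<Sum>i\<in>Inl ` {0<..m}. of_bool (case_sum A B i \<omega> = y) - p y)
          = (\<Sum>i\<in>{0<..m}. of_bool (A i \<omega> = y)) - real m * p y" for y
        by (subst sum.reindex) (simp_all add: sum_subtractf del: sum_of_bool_eq)
      ultimately show "\<bar>real (Ncnt A m (B j \<omega>) \<omega>) - real m * p (B j \<omega>)\<bar> \<le> 4 * sqrt (real n * ln (real n))"
        unfolding R_def by (simp del: sum_of_bool_eq)
    qed
  qed
qed

text \<open>The easy half of the law of the iterated logarithm, without the sharp constant: the
  maximal inequality at times 2^k fails with probability at most 4 / k^2, and a general n is
  compared with the power of 2 in the interval (n, 2 n]. There ln k \<le> 2 ln (ln n), so the bound
  4 sqrt (2^k ln k) becomes 8 sqrt (n ln (ln n)).\<close>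

lemma AE_iterated_log:
  "AE \<omega> in M. eventually (\<lambda>n. \<forall>m\<le>n. \<bar>incr q mu A 0 m \<omega>\<bar> \<le> 8 * sqrt (real n * ln (ln (real n)))) sequentially"
proof -
  define t where "t k = 2 * sqrt (2 ^ k * ln (real k))" for k :: nat
  define Q where "Q k f \<longleftrightarrow> (\<exists>m\<in>{0..2 ^ k}. \<bar>\<Sum>j\<in>{0<..m}. step (Inl j) (f (Inl j))\<bar> > 2 * t k)"
    for k and f :: "nat + nat \<Rightarrow> nat"
  have "AE \<omega> in M. eventually (\<lambda>k. \<not> Q k (\<lambda>i. case_sum A B i \<omega>)) sequentially"
  proof (rule AE_eventually_not_event[where K = "\<lambda>k. Inl ` {0<..2 ^ k}" and start = 2])
    have "depends_on (Inl ` {0<..2 ^ k})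
       (\<lambda>f. \<exists>m\<in>{0..2 ^ k}. \<bar>\<Sum>i\<in>Inl ` {0<..m}. step i (f i)\<bar> > 2 * t k)" for k
      by (intro depends_on_Bex depends_on_sum) auto
    then show "depends_on (Inl ` {0<..2 ^ k}) (Q k)" for k
      unfolding Q_def by (simp add: sum.reindex)
    fix k :: nat assume k: "k \<ge> 2"
    have e: "exp (- (t k)\<^sup>2 / (2 * real (2 ^ k - 0))) = 1 / real k ^ 2"
    proof -
      have "(t k)\<^sup>2 = 4 * (2 ^ k * ln (real k))" unfolding t_def using k by (simp add: power_mult_distrib)
      then have "- (t k)\<^sup>2 / (2 * real (2 ^ k - 0)) = - (2 * ln (real k))" by simp
      then show ?thesis using k exp_of_nat_mult[of 2 "ln (real k)"] by (simp add: exp_minus inverse_eq_divide)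
    qed
    \<comment> \<open>The maximal inequality requires 2 / k^2 \<le> 1/2, which is why the sequence
      of events starts at k = 2.\<close>
    have "real k ^ 2 \<ge> 2 ^ 2" by (rule power_mono) (use k in auto)
    then have le: "2 * exp (- (t k)\<^sup>2 / (2 * real (2 ^ k - 0))) \<le> 1 / 2"
      unfolding e using k by (simp add: field_simps)
    have "prob (event (Q k)) \<le> 4 * exp (- (t k)\<^sup>2 / (2 * real (2 ^ k - 0)))"
      unfolding Q_def
      by (rule maximal_inequality[OF _ _ _ _ _ le])
         (use k in \<open>auto simp: t_def intro!: centred_subset[OF step_centred]\<close>)
    also have "\<dots> \<le> 16 / real k ^ 2" unfolding e by (simp add: divide_right_mono)
    finally show "prob (event (Q k)) \<le> 16 / real k ^ 2" .
  qed (auto intro: summable_union_bound)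
  then show ?thesis
  proof (rule AE_mp, intro AE_I2 impI)
    fix \<omega> assume "eventually (\<lambda>k. \<not> Q k (\<lambda>i. case_sum A B i \<omega>)) sequentially"
    then obtain k0 where k0: "\<And>k. k \<ge> k0 \<Longrightarrow> \<not> Q k (\<lambda>i. case_sum A B i \<omega>)"
      unfolding eventually_sequentially by auto
    \<comment> \<open>The left side bounds the dyadic index k belonging to n; comparing it with the
      square of ln n is what gives ln k \<le> 2 ln (ln n).\<close>
    have "eventually (\<lambda>x::real. 1 + ln x / ln 2 \<le> (ln x)\<^sup>2) at_top" by real_asymp
    then have "eventually (\<lambda>n. 1 + ln (real n) / ln 2 \<le> (ln (real n))\<^sup>2) sequentially"
      by (rule eventually_compose_filterlim[OF _ filterlim_real_sequentially])
    moreover have "eventually (\<lambda>n. n \<ge> max 8 (2 ^ k0)) sequentially"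
      by (rule eventually_ge_at_top)
    ultimately show "eventually (\<lambda>n. \<forall>m\<le>n. \<bar>incr q mu A 0 m \<omega>\<bar> \<le> 8 * sqrt (real n * ln (ln (real n)))) sequentially"
    proof (eventually_elim, intro allI impI)
      fix n m :: nat assume ln: "1 + ln (real n) / ln 2 \<le> (ln (real n))\<^sup>2" and n: "n \<ge> max 8 (2 ^ k0)" and m: "m \<le> n"
      define k where "k = Suc (nat \<lfloor>log 2 (real n)\<rfloor>)"
      have l0: "log 2 (real n) \<ge> 0" using n by simp
      have k_le: "real k \<le> 1 + log 2 (real n)" unfolding k_def using l0 by linarith
      have k_gt: "log 2 (real n) < real k" unfolding k_def using l0 by linarith
      have n_lt: "real n < 2 ^ k"
      proof -
        have "real n = 2 powr log 2 (real n)" using n by simp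
        also have "\<dots> < 2 powr real k" using k_gt by simp
        finally show ?thesis by (simp add: powr_realpow)
      qed
      have n_ge: "2 ^ k \<le> 2 * real n"
      proof -
        have "(2::real) ^ k = 2 powr real k" by (simp add: powr_realpow)
        also have "\<dots> \<le> 2 powr (1 + log 2 (real n))" using k_le by simp
        also have "\<dots> = 2 * real n" using n by (simp add: powr_add)
        finally show ?thesis .
      qed
      have "k0 \<le> k"
      proof (rule ccontr)
        assume "\<not> k0 \<le> k"
        then have "(2::real) ^ k \<le> 2 ^ k0" by (intro power_increasing) auto
        also have "\<dots> = real (2 ^ k0)" by simp
        also have "\<dots> \<le> real n" using n by (intro of_nat_mono) auto
        finally show False using n_lt by simp
      qed
      moreover have "m \<le> 2 ^ k"
      proof -
        have "real m < 2 ^ k" using m n_lt by linarith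
        then have "real m < real (2 ^ k)" by simp
        then show ?thesis by (simp only: of_nat_less_iff less_imp_le)
      qed
      ultimately have "\<bar>incr q mu A 0 m \<omega>\<bar> \<le> 2 * t k"
        using k0[of k] unfolding Q_def incr_def by (auto simp: not_less)
      also have "\<dots> \<le> 4 * sqrt (4 * (real n * ln (ln (real n))))"
      proof -
        have k1: "real k \<ge> 1" unfolding k_def by simp
        have lnpos: "ln (real n) > 0" using n by simp
        have "ln (real k) \<le> ln ((ln (real n))\<^sup>2)"
          using k1 k_le ln lnpos by (subst ln_le_cancel_iff) (auto simp: log_def)
        also have "\<dots> = 2 * ln (ln (real n))" using lnpos by (simp add: ln_realpow)
        finally have "2 ^ k * ln (real k) \<le> (2 * real n) * (2 * ln (ln (real n)))"
          using n_ge k1 by (intro mult_mono) auto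
        then show ?thesis unfolding t_def by simp
      qed
      also have "\<dots> = 8 * sqrt (real n * ln (ln (real n)))"
        by (simp only: real_sqrt_mult real_sqrt_four)
      finally show "\<bar>incr q mu A 0 m \<omega>\<bar> \<le> 8 * sqrt (real n * ln (ln (real n)))" .
    qed
  qed
qed

end

subsection \<open>Match counts\<close>

text \<open>Matches are counted record by record instead of label by label; in this form a change of
  position adds or removes a range of summands.\<close>

definition mcount :: "(nat \<Rightarrow> 'a \<Rightarrow> nat) \<Rightarrow> (nat \<Rightarrow> 'a \<Rightarrow> nat) \<Rightarrow> nat \<Rightarrow> nat \<Rightarrow> 'a \<Rightarrow> real" where
  "mcount A B m n \<omega> = (\<Sum>j\<in>{1..m}. real (Ncnt B n (A j \<omega>) \<omega>))"

lemma matches_mcount: "matches A B C n \<omega> = mcount A B (Rcnt C n \<omega>) (Scnt C n \<omega>) \<omega>"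
proof -
  let ?R = "Rcnt C n \<omega>" and ?S = "Scnt C n \<omega>"
  have "mcount A B ?R ?S \<omega> = (\<Sum>i\<in>(\<lambda>j. A j \<omega>) ` {1..?R}.
      \<Sum>j\<in>{j \<in> {1..?R}. A j \<omega> = i}. real (Ncnt B ?S (A j \<omega>) \<omega>))"
    unfolding mcount_def by (rule sum.image_gen) simp
  also have "\<dots> = (\<Sum>i\<in>(\<lambda>j. A j \<omega>) ` {1..?R}. real (Ncnt A ?R i \<omega>) * real (Ncnt B ?S i \<omega>))"
    unfolding Ncnt_def by (intro sum.cong) auto
  finally show ?thesis unfolding matches_def by simp
qed

lemma mcount_commute: "mcount A B m n \<omega> = mcount B A n m \<omega>"
proof -
  have N: "real (Ncnt L k i \<omega>) = (\<Sum>j\<in>{1..k}. of_bool (L j \<omega> = i))" for L :: "nat \<Rightarrow> 'a \<Rightarrow> nat" and k i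
  proof -
    have "{j \<in> {1..k}. L j \<omega> = i} = {1..k} \<inter> {j. L j \<omega> = i}" by auto
    then show ?thesis unfolding Ncnt_def by simp
  qed
  show ?thesis unfolding mcount_def N
    by (subst sum.swap) (simp only: eq_commute)
qed

text \<open>The j-th \<open>A\<close> record matches as many of the first \<open>S\<close>
  \<open>B\<close> records as carry its label, that is \<open>S * q (A j \<omega>)\<close> up to
  \<open>E\<close>; summing over the additional records gives an increment of the score sum.\<close>

lemma mcount_diff:
  assumes le: "m' \<le> m" "m \<le> n"
    and E: "\<And>j. j \<in> {1..n} \<Longrightarrow> \<bar>real (Ncnt B S (A j \<omega>) \<omega>) - real S * q (A j \<omega>)\<bar> \<le> E"
  shows "\<bar>mcount A B m S \<omega> - mcount A B m' S \<omega> - real S * (Gam q A m \<omega> - Gam q A m' \<omega>)\<bar>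
    \<le> (real m - real m') * E"
proof -
  have split: "sum f {1..m} - sum f {1..m'} = sum f {m'<..m}" for f :: "nat \<Rightarrow> real"
  proof -
    have "{1..m} = {1..m'} \<union> {m'<..m}" using le by auto
    then have "sum f {1..m} = sum f {1..m'} + sum f {m'<..m}"
      by (simp only:) (rule sum.union_disjoint, auto)
    then show ?thesis by simp
  qed
  have "mcount A B m S \<omega> - mcount A B m' S \<omega> - real S * (Gam q A m \<omega> - Gam q A m' \<omega>)
      = (\<Sum>j\<in>{m'<..m}. real (Ncnt B S (A j \<omega>) \<omega>) - real S * q (A j \<omega>))"
    unfolding mcount_def Gam_def split by (simp add: sum_subtractf sum_distrib_left)
  also have "\<bar>\<dots>\<bar> \<le> (\<Sum>j\<in>{m'<..m}. E)"
    by (rule order_trans[OF sum_abs sum_mono]) (use E le in auto)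
  also have "\<dots> = (real m - real m') * E" using le by (simp add: of_nat_diff)
  finally show ?thesis .
qed

lemma mcount_diff_abs:
  assumes le: "m \<le> n" "m' \<le> n"
    and E: "\<And>j. j \<in> {1..n} \<Longrightarrow> \<bar>real (Ncnt B S (A j \<omega>) \<omega>) - real S * q (A j \<omega>)\<bar> \<le> E"
  shows "\<bar>mcount A B m S \<omega> - mcount A B m' S \<omega> - real S * (Gam q A m \<omega> - Gam q A m' \<omega>)\<bar>
    \<le> \<bar>real m - real m'\<bar> * E"
proof (cases "m' \<le> m")
  case True
  have "\<bar>mcount A B m S \<omega> - mcount A B m' S \<omega> - real S * (Gam q A m \<omega> - Gam q A m' \<omega>)\<bar>
      \<le> (real m - real m') * E"
    by (rule mcount_diff[OF True le(1)]) (rule E)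
  then show ?thesis using True by simp
next
  case False
  then have "m \<le> m'" by simp
  have "\<bar>mcount A B m' S \<omega> - mcount A B m S \<omega> - real S * (Gam q A m' \<omega> - Gam q A m \<omega>)\<bar>
      \<le> (real m' - real m) * E"
    by (rule mcount_diff[OF \<open>m \<le> m'\<close> le(2)]) (rule E)
  then show ?thesis using False by (simp add: algebra_simps abs_le_iff)
qed

text \<open>Pass from \<open>(R', S')\<close> to \<open>(R, S)\<close> through the corner
  \<open>(R', S)\<close>, changing one coordinate at a time. This is why the weights are
  \<open>S\<close> for the first increment and \<open>R'\<close> for the second.\<close>

lemma match_diff:
  assumes le: "R \<le> n" "R' \<le> n" "S \<le> n" "S' \<le> n"
    and E1: "\<And>j. j \<in> {1..n} \<Longrightarrow> \<bar>real (Ncnt B S (A j \<omega>) \<omega>) - real S * q (A j \<omega>)\<bar> \<le> E"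
    and E2: "\<And>j. j \<in> {1..n} \<Longrightarrow> \<bar>real (Ncnt A R' (B j \<omega>) \<omega>) - real R' * p (B j \<omega>)\<bar> \<le> E"
  shows "\<bar>mcount A B R S \<omega> - mcount A B R' S' \<omega>
      - (real S * (Gam q A R \<omega> - Gam q A R' \<omega>) + real R' * (Gam p B S \<omega> - Gam p B S' \<omega>))\<bar>
    \<le> (\<bar>real R - real R'\<bar> + \<bar>real S - real S'\<bar>) * E"
proof -
  have "\<bar>mcount A B R S \<omega> - mcount A B R' S \<omega> - real S * (Gam q A R \<omega> - Gam q A R' \<omega>)\<bar>
      \<le> \<bar>real R - real R'\<bar> * E"
    by (rule mcount_diff_abs[OF le(1,2)]) (rule E1)
  moreover have "\<bar>mcount B A S R' \<omega> - mcount B A S' R' \<omega> - real R' * (Gam p B S \<omega> - Gam p B S' \<omega>)\<bar>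
      \<le> \<bar>real S - real S'\<bar> * E"
    by (rule mcount_diff_abs[OF le(3,4)]) (rule E2)
  ultimately show ?thesis
    unfolding mcount_commute[of B A] by (simp add: algebra_simps abs_le_iff)
qed

section \<open>Positions of the greedy and of the alternating path\<close>

lemma Rcnt_0 [simp]: "Rcnt C 0 \<omega> = 0"
  by (simp add: Rcnt_def)

lemma Rcnt_Suc: "Rcnt C (Suc n) \<omega> = Rcnt C n \<omega> + of_bool (C (Suc n) \<omega>)"
proof -
  have "{j \<in> {1..Suc n}. C j \<omega>} = {j \<in> {1..n}. C j \<omega>} \<union> (if C (Suc n) \<omega> then {Suc n} else {})"
    by (auto simp: le_Suc_eq)
  then show ?thesis unfolding Rcnt_def by simp
qed

lemma Rcnt_le: "Rcnt C n \<omega> \<le> n"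
  by (induction n) (auto simp: Rcnt_Suc)

lemma Scnt_Suc: "Scnt C (Suc n) \<omega> = Scnt C n \<omega> + of_bool (\<not> C (Suc n) \<omega>)"
  using Rcnt_le[of C n \<omega>] by (auto simp: Scnt_def Rcnt_Suc)

lemma Gam_0 [simp]: "Gam x L 0 \<omega> = 0"
  by (simp add: Gam_def)

lemma Gam_Suc [simp]: "Gam x L (Suc n) \<omega> = Gam x L n \<omega> + x (L (Suc n) \<omega>)"
  by (simp add: Gam_def)

lemma Gam_mono:
  assumes "prob_vector x" "m \<le> n" shows "Gam x L m \<omega> \<le> Gam x L n \<omega>"
  unfolding Gam_def by (rule sum_mono2) (use assms prob_vector_bounds in auto)

text \<open>The next record always goes to a side whose score sum is not the larger one, and a
  single score lies in [0, 1]; so a gap of at most 1 can shrink, or change sign without growing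
  beyond 1.\<close>

lemma greedy_balance:
  assumes r: "prob_vector r" and s: "prob_vector s"
    and greedy: "greedy_policy M F0 r s LR LS C" and \<omega>: "\<omega> \<in> space M"
  shows "\<bar>Gam s LR (Rcnt C n \<omega>) \<omega> - Gam r LS (Scnt C n \<omega>) \<omega>\<bar> \<le> 1"
proof (induction n)
  case 0
  then show ?case by (simp add: Scnt_def)
next
  case (Suc n)
  have step: "C (Suc n) \<omega> \<Longrightarrow> Gam r LS (Scnt C n \<omega>) \<omega> \<ge> Gam s LR (Rcnt C n \<omega>) \<omega>"
    "\<not> C (Suc n) \<omega> \<Longrightarrow> Gam r LS (Scnt C n \<omega>) \<omega> \<le> Gam s LR (Rcnt C n \<omega>) \<omega>"
  proof -
    \<comment> \<open>The greedy rule leaves the first record free, but for n = 0 both score sums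
      vanish and the required inequalities are trivial.\<close>
    have "n \<ge> 1 \<or> n = 0" by auto
    then show "C (Suc n) \<omega> \<Longrightarrow> Gam r LS (Scnt C n \<omega>) \<omega> \<ge> Gam s LR (Rcnt C n \<omega>) \<omega>"
      "\<not> C (Suc n) \<omega> \<Longrightarrow> Gam r LS (Scnt C n \<omega>) \<omega> \<le> Gam s LR (Rcnt C n \<omega>) \<omega>"
      using greedy \<omega> unfolding greedy_policy_def by (auto simp: Scnt_def not_less[symmetric])
  qed
  show ?case
    using Suc step prob_vector_bounds[OF r, of "LS (Suc (Scnt C n \<omega>)) \<omega>"]
      prob_vector_bounds[OF s, of "LR (Suc (Rcnt C n \<omega>)) \<omega>"]
    by (cases "C (Suc n) \<omega>") (auto simp: Rcnt_Suc Scnt_Suc abs_le_iff)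
qed

lemma alternating_Rcnt:
  assumes "alternating_policy M F0 C" "\<omega> \<in> space M"
  shows "Rcnt C (2 * n) \<omega> = n" "\<bar>2 * real (Rcnt C n \<omega>) - real n\<bar> \<le> 1"
proof -
  have R: "Rcnt C (2 * n) \<omega> = n" for n using assms unfolding alternating_policy_def by auto
  then show "Rcnt C (2 * n) \<omega> = n" .
  show "\<bar>2 * real (Rcnt C n \<omega>) - real n\<bar> \<le> 1"
  proof (cases "even n")
    case True
    then obtain k where "n = 2 * k" by (elim evenE)
    then show ?thesis using R[of k] by simp
  next
    case False
    then obtain k where k: "n = Suc (2 * k)" by (auto elim: oddE)
    show ?thesis using R[of k] unfolding k Rcnt_Suc by auto
  qed
qed

section \<open>Pathwise upper bound for the difference of the match counts\<close>

context match_model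
begin

text \<open>Collects the almost sure estimates at time n for both sequences in one pathwise
  condition; the comparison of two positions is deterministic from here on.\<close>

definition regular :: "nat \<Rightarrow> 'a \<Rightarrow> bool" where
  "regular n \<omega> \<longleftrightarrow>
    (\<forall>l\<le>n. \<forall>k\<le>l. \<bar>incr q mu A k l \<omega>\<bar> \<le> 4 * sqrt (real (l - k) * ln (real n)) \<and>
                 \<bar>incr p mu B k l \<omega>\<bar> \<le> 4 * sqrt (real (l - k) * ln (real n))) \<and>
    (\<forall>m\<le>n. \<forall>j\<in>{1..n}.
       \<bar>real (Ncnt A m (B j \<omega>) \<omega>) - real m * p (B j \<omega>)\<bar> \<le> 4 * sqrt (real n * ln (real n)) \<and>
       \<bar>real (Ncnt B m (A j \<omega>) \<omega>) - real m * q (A j \<omega>)\<bar> \<le> 4 * sqrt (real n * ln (real n))) \<and>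
    (\<forall>m\<le>n. \<bar>incr q mu A 0 m \<omega>\<bar> \<le> 8 * sqrt (real n * ln (ln (real n))) \<and>
           \<bar>incr p mu B 0 m \<omega>\<bar> \<le> 8 * sqrt (real n * ln (ln (real n))))"

lemma AE_regular: "AE \<omega> in M. eventually (\<lambda>n. regular n \<omega>) sequentially"
proof -
  interpret sw: match_model M q p B A by (rule swap)
  have "AE \<omega> in M. eventually (\<lambda>n. \<forall>l\<le>n. \<forall>k\<le>l. \<bar>incr p mu B k l \<omega>\<bar> \<le> 4 * sqrt (real (l - k) * ln (real n))) sequentially"
    "AE \<omega> in M. eventually (\<lambda>n. \<forall>m\<le>n. \<bar>incr p mu B 0 m \<omega>\<bar> \<le> 8 * sqrt (real n * ln (ln (real n)))) sequentially"
    using sw.AE_incr sw.AE_iterated_log unfolding dotp_commute[of q p] by auto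
  with AE_incr AE_iterated_log AE_Ncnt sw.AE_Ncnt show ?thesis
  proof eventually_elim
    case (elim \<omega>)
    then show ?case by eventually_elim (auto simp: regular_def)
  qed
qed

lemma regular_Ncnt:
  assumes "regular n \<omega>" "m \<le> n" "j \<in> {1..n}"
  shows "\<bar>real (Ncnt B m (A j \<omega>) \<omega>) - real m * q (A j \<omega>)\<bar> \<le> 4 * sqrt (real n * ln (real n))"
    and "\<bar>real (Ncnt A m (B j \<omega>) \<omega>) - real m * p (B j \<omega>)\<bar> \<le> 4 * sqrt (real n * ln (real n))"
  using assms unfolding regular_def by blast+

lemma Gam_diff_bound:
  assumes "regular n \<omega>" "l \<le> n" "k \<le> n"
  shows "\<exists>I. Gam q A l \<omega> - Gam q A k \<omega> = mu * (real l - real k) + I \<and> \<bar>I\<bar> \<le> 4 * sqrt (\<bar>real l - real k\<bar> * ln (real n))"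
    and "\<exists>I. Gam p B l \<omega> - Gam p B k \<omega> = mu * (real l - real k) + I \<and> \<bar>I\<bar> \<le> 4 * sqrt (\<bar>real l - real k\<bar> * ln (real n))"
proof -
  have aux: "\<exists>I. Gam x L l \<omega> - Gam x L k \<omega> = mu * (real l - real k) + I \<and> \<bar>I\<bar> \<le> 4 * sqrt (\<bar>real l - real k\<bar> * ln (real n))"
    if reg: "\<And>k l. l \<le> n \<Longrightarrow> k \<le> l \<Longrightarrow> \<bar>incr x mu L k l \<omega>\<bar> \<le> 4 * sqrt (real (l - k) * ln (real n))"
    for x and L :: "nat \<Rightarrow> 'a \<Rightarrow> nat"
  proof (cases "k \<le> l")
    case True
    then show ?thesis using reg[of l k] assms incr_split[of 0 k l x mu L \<omega>]
      by (intro exI[of _ "incr x mu L k l \<omega>"]) (auto simp: Gam_incr[of _ _ _ _ mu] algebra_simps of_nat_diff)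
  next
    case False
    then show ?thesis using reg[of k l] assms incr_split[of 0 l k x mu L \<omega>]
      by (intro exI[of _ "- incr x mu L l k \<omega>"]) (auto simp: Gam_incr[of _ _ _ _ mu] algebra_simps of_nat_diff)
  qed
  show "\<exists>I. Gam q A l \<omega> - Gam q A k \<omega> = mu * (real l - real k) + I \<and> \<bar>I\<bar> \<le> 4 * sqrt (\<bar>real l - real k\<bar> * ln (real n))"
    "\<exists>I. Gam p B l \<omega> - Gam p B k \<omega> = mu * (real l - real k) + I \<and> \<bar>I\<bar> \<le> 4 * sqrt (\<bar>real l - real k\<bar> * ln (real n))"
    by (intro aux; use assms(1) in \<open>simp add: regular_def\<close>)+
qed

text \<open>With s = sqrt (n ln (ln n)), balance and the iterated logarithm give mu \<bar>2 \<rho> -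
  n\<bar> \<le> 1 + 16 s; adding the offset of the alternating path gives at most 18 s, as s \<ge> 1
  and mu \<le> 1. Hence the 9 in \<open>d\<close>. The three terms of the bound are the imperfectly
  cancelled drift, the two walk increments over at most \<open>d\<close> steps, and the errors of
  the label counts.\<close>

lemma difference_bound:
  assumes reg: "regular n \<omega>" and \<rho>: "\<rho> \<le> n" "\<bar>Gam q A \<rho> \<omega> - Gam p B (n - \<rho>) \<omega>\<bar> \<le> 1"
    and \<alpha>: "\<alpha> \<le> n" "\<bar>2 * real \<alpha> - real n\<bar> \<le> 1"
    and n: "ln (ln (real n)) \<ge> 1" "n \<ge> 1"
  defines "d \<equiv> 9 / mu * sqrt (real n * ln (ln (real n)))"
  shows "\<bar>mcount A B \<rho> (n - \<rho>) \<omega> - mcount A B \<alpha> (n - \<alpha>) \<omega>\<bar>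
    \<le> (1 + d) * d + 8 * real n * sqrt (d * ln (real n)) + 8 * d * sqrt (real n * ln (real n))"
proof -
  define s where "s = sqrt (real n * ln (ln (real n)))"
  define \<delta> where "\<delta> = real \<rho> - real \<alpha>"
  have "1 * 1 \<le> real n * ln (ln (real n))" using n by (intro mult_mono) auto
  then have s1: "s \<ge> 1" unfolding s_def by simp
  have lnn: "ln (real n) \<ge> 0" using n by simp
  obtain I1 where I1: "Gam q A \<rho> \<omega> = mu * real \<rho> + I1" "\<bar>I1\<bar> \<le> 8 * s"
    using reg \<rho> Gam_incr[of q A \<rho> \<omega> mu] unfolding regular_def s_def by blast
  obtain I2 where I2: "Gam p B (n - \<rho>) \<omega> = mu * real (n - \<rho>) + I2" "\<bar>I2\<bar> \<le> 8 * s"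
    using reg \<rho> Gam_incr[of p B "n - \<rho>" \<omega> mu] unfolding regular_def s_def by (metis diff_le_self)
  have "mu * \<bar>2 * real \<rho> - real n\<bar> = \<bar>mu * (2 * real \<rho> - real n)\<bar>"
    using mu_pos by (simp add: abs_mult)
  also have "mu * (2 * real \<rho> - real n) = (Gam q A \<rho> \<omega> - Gam p B (n - \<rho>) \<omega>) - I1 + I2"
    using \<rho> by (simp add: I1 I2 of_nat_diff algebra_simps)
  also have "\<bar>\<dots>\<bar> \<le> 1 + 16 * s" using \<rho> I1 I2 by linarith
  finally have "mu * \<bar>2 * real \<rho> - real n\<bar> \<le> 1 + 16 * s" .
  moreover have "\<bar>2 * \<delta>\<bar> \<le> \<bar>2 * real \<rho> - real n\<bar> + 1"
  proof -
    have "2 * \<delta> = (2 * real \<rho> - real n) - (2 * real \<alpha> - real n)" unfolding \<delta>_def by simp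
    then show ?thesis using abs_triangle_ineq4[of "2 * real \<rho> - real n" "2 * real \<alpha> - real n"] \<alpha>(2)
      by linarith
  qed
  then have "mu * \<bar>2 * \<delta>\<bar> \<le> mu * \<bar>2 * real \<rho> - real n\<bar> + mu"
    using mult_left_mono[of _ _ mu] mu_pos by (metis less_imp_le distrib_left mult.right_neutral)
  ultimately have "mu * \<bar>2 * \<delta>\<bar> \<le> 18 * s" using s1 mu_le_1 by linarith
  then have \<delta>: "\<bar>\<delta>\<bar> \<le> d"
    unfolding d_def s_def[symmetric] using mu_pos by (simp add: field_simps abs_mult)
  have d0: "d \<ge> 0" using \<delta> by linarith
  obtain J1 where J1: "Gam q A \<rho> \<omega> - Gam q A \<alpha> \<omega> = mu * \<delta> + J1" "\<bar>J1\<bar> \<le> 4 * sqrt (\<bar>\<delta>\<bar> * ln (real n))"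
    using Gam_diff_bound(1)[OF reg \<rho>(1) \<alpha>(1)] unfolding \<delta>_def by auto
  have \<delta>': "real (n - \<rho>) - real (n - \<alpha>) = - \<delta>" using \<rho> \<alpha> unfolding \<delta>_def by (simp add: of_nat_diff)
  obtain J2 where J2: "Gam p B (n - \<rho>) \<omega> - Gam p B (n - \<alpha>) \<omega> = mu * (- \<delta>) + J2"
      "\<bar>J2\<bar> \<le> 4 * sqrt (\<bar>\<delta>\<bar> * ln (real n))"
    using Gam_diff_bound(2)[OF reg, of "n - \<rho>" "n - \<alpha>"] unfolding \<delta>' by auto
  define e where "e = 4 * sqrt (d * ln (real n))"
  have "4 * sqrt (\<bar>\<delta>\<bar> * ln (real n)) \<le> e" unfolding e_def
    using \<delta> lnn by (simp add: mult_right_mono)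
  then have J: "\<bar>J1\<bar> \<le> e" "\<bar>J2\<bar> \<le> e" using J1 J2 by auto
  have main: "\<bar>mcount A B \<rho> (n - \<rho>) \<omega> - mcount A B \<alpha> (n - \<alpha>) \<omega>
      - (real (n - \<rho>) * (mu * \<delta> + J1) + real \<alpha> * (mu * (- \<delta>) + J2))\<bar>
    \<le> (\<bar>\<delta>\<bar> + \<bar>- \<delta>\<bar>) * (4 * sqrt (real n * ln (real n)))"
    unfolding J1(1)[symmetric] J2(1)[symmetric] unfolding \<delta>'[symmetric] unfolding \<delta>_def
    by (rule match_diff[where n = n]; (rule regular_Ncnt[OF reg])?) (use \<rho> \<alpha> in auto)
  have "real (n - \<rho>) * (mu * \<delta> + J1) + real \<alpha> * (mu * (- \<delta>) + J2)
      = (real n - 2 * real \<alpha> - \<delta>) * (mu * \<delta>) + (real (n - \<rho>) * J1 + real \<alpha> * J2)"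
    using \<rho> unfolding \<delta>_def by (simp add: of_nat_diff algebra_simps)
  also have "\<bar>\<dots>\<bar> \<le> (1 + d) * d + (real n * e + real n * e)"
  proof (intro order_trans[OF abs_triangle_ineq] add_mono)
    have "\<bar>mu * \<delta>\<bar> \<le> 1 * d" unfolding abs_mult
      using mu_pos mu_le_1 \<delta> by (intro mult_mono) auto
    then show "\<bar>(real n - 2 * real \<alpha> - \<delta>) * (mu * \<delta>)\<bar> \<le> (1 + d) * d"
      unfolding abs_mult[of "real n - 2 * real \<alpha> - \<delta>"] using \<alpha> \<delta> d0 by (intro mult_mono) linarith+
    show "\<bar>real (n - \<rho>) * J1\<bar> \<le> real n * e" "\<bar>real \<alpha> * J2\<bar> \<le> real n * e"
      unfolding abs_mult using J \<alpha> by (intro mult_mono; simp)+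
  qed
  finally have "\<bar>mcount A B \<rho> (n - \<rho>) \<omega> - mcount A B \<alpha> (n - \<alpha>) \<omega>\<bar>
      \<le> (1 + d) * d + (real n * e + real n * e) + (\<bar>\<delta>\<bar> + \<bar>- \<delta>\<bar>) * (4 * sqrt (real n * ln (real n)))"
    using main by linarith
  also have "(\<bar>\<delta>\<bar> + \<bar>- \<delta>\<bar>) * (4 * sqrt (real n * ln (real n))) \<le> (d + d) * (4 * sqrt (real n * ln (real n)))"
    using \<delta> lnn by (intro mult_right_mono) auto
  finally show ?thesis unfolding e_def by (simp add: algebra_simps)
qed

text \<open>The dominant term is the middle one: n sqrt (d ln n), with d of order sqrt (n ln (ln
  n)), is exactly the norming factor times sqrt (ln n).\<close>

lemma AE_difference_bigo:
  assumes \<rho>: "\<And>n \<omega>. \<omega> \<in> space M \<Longrightarrow> \<rho> n \<omega> \<le> n"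
      "\<And>n \<omega>. \<omega> \<in> space M \<Longrightarrow> \<bar>Gam q A (\<rho> n \<omega>) \<omega> - Gam p B (n - \<rho> n \<omega>) \<omega>\<bar> \<le> 1"
    and \<alpha>: "\<And>n \<omega>. \<omega> \<in> space M \<Longrightarrow> \<alpha> n \<omega> \<le> n"
      "\<And>n \<omega>. \<omega> \<in> space M \<Longrightarrow> \<bar>2 * real (\<alpha> n \<omega>) - real n\<bar> \<le> 1"
  shows "AE \<omega> in M. (\<lambda>n. (mcount A B (\<rho> n \<omega>) (n - \<rho> n \<omega>) \<omega> - mcount A B (\<alpha> n \<omega>) (n - \<alpha> n \<omega>) \<omega>)
     / (real n powr (5/4) * ln (ln (real n)) powr (1/4))) \<in> O(\<lambda>n. ln (real n) powr (1/2))"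
  using AE_regular
proof (rule AE_mp, intro AE_I2 impI)
  fix \<omega> assume \<omega>: "\<omega> \<in> space M" and reg: "eventually (\<lambda>n. regular n \<omega>) sequentially"
  define c where "c = 9 / mu"
  have c: "c > 0" unfolding c_def using mu_pos by simp
  define d where "d x = c * sqrt (x * ln (ln x))" for x :: real
  define b where "b x = (1 + d x) * d x + 8 * x * sqrt (d x * ln x) + 8 * d x * sqrt (x * ln x)" for x :: real
  define D where "D n = mcount A B (\<rho> n \<omega>) (n - \<rho> n \<omega>) \<omega> - mcount A B (\<alpha> n \<omega>) (n - \<alpha> n \<omega>) \<omega>" for n
  define F where "F x = x powr (5/4) * ln (ln x) powr (1/4)" for x :: real
  have "(\<lambda>x. b x / F x) \<in> O[at_top](\<lambda>x. ln x powr (1/2))"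
    unfolding b_def d_def F_def using c by real_asymp
  then have big: "(\<lambda>n. b (real n) / F (real n)) \<in> O(\<lambda>n. ln (real n) powr (1/2))"
    by (rule landau_o.big.compose[OF _ filterlim_real_sequentially])
  have "eventually (\<lambda>x::real. ln (ln x) \<ge> 1) at_top" by real_asymp
  then have "eventually (\<lambda>n. ln (ln (real n)) \<ge> 1) sequentially"
    by (rule eventually_compose_filterlim[OF _ filterlim_real_sequentially])
  then have "eventually (\<lambda>n. norm (D n / F (real n)) \<le> norm (b (real n) / F (real n))) sequentially"
    using reg eventually_ge_at_top[of 1]
  proof eventually_elim
    case (elim n)
    have "\<bar>D n\<bar> \<le> b (real n)"
      unfolding D_def b_def d_def c_def
      by (rule difference_bound) (use elim \<rho> \<alpha> \<omega> in auto)
    then have "\<bar>D n\<bar> \<le> \<bar>b (real n)\<bar>" by linarith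
    then show ?case by (auto simp: abs_mult divide_right_mono)
  qed
  then have "(\<lambda>n. D n / F (real n)) \<in> O(\<lambda>n. b (real n) / F (real n))"
    by (rule landau_o.big_mono)
  from landau_o.big_trans[OF this big]
  show "(\<lambda>n. (mcount A B (\<rho> n \<omega>) (n - \<rho> n \<omega>) \<omega> - mcount A B (\<alpha> n \<omega>) (n - \<alpha> n \<omega>) \<omega>)
     / (real n powr (5/4) * ln (ln (real n)) powr (1/4))) \<in> O(\<lambda>n. ln (real n) powr (1/2))"
    unfolding D_def F_def .
qed

end

subsection \<open>Large fluctuations at sparse scales\<close>

text \<open>\<open>U x\<close> extends the spatial scale 2^(k^2) to real x, and the time is 2 U^2.
  The leading gain is U^(5/2) sqrt (log x), whereas the norming factor is of order U^(5/2) (ln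
  x)^(1/4), because ln (ln (2 U^2)) grows like 2 ln x. The quiet parts are of order U^(5/2), the
  other losses of order U^2 up to powers of x.\<close>

lemma scale_asymptotics:
  fixes H c C :: real
  assumes "c > 0" "H > 0"
  defines "U \<equiv> \<lambda>x::real. 2 powr (x\<^sup>2)"
  shows "eventually (\<lambda>x. C * ((2 * U x ^ 2) powr (5/4) * ln (ln (2 * U x ^ 2)) powr (1/4))
    \<le> U x ^ 2 * (sqrt (U x * log 16 x) * c / 10 - 36 * sqrt (H * U x)) - 2 * (H * U x)\<^sup>2
       - 8 * (H * U x) * sqrt (2 * U x ^ 2 * ln (2 * U x ^ 2))) at_top"
proof -
  have "filterlim (\<lambda>x. (U x ^ 2 * (sqrt (U x * log 16 x) * c / 10 - 36 * sqrt (H * U x)) - 2 * (H * U x)\<^sup>2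
       - 8 * (H * U x) * sqrt (2 * U x ^ 2 * ln (2 * U x ^ 2)))
      / ((2 * U x ^ 2) powr (5/4) * ln (ln (2 * U x ^ 2)) powr (1/4))) at_top at_top"
    unfolding U_def using assms(1,2) by real_asymp
  then have "eventually (\<lambda>x. C \<le> (U x ^ 2 * (sqrt (U x * log 16 x) * c / 10 - 36 * sqrt (H * U x)) - 2 * (H * U x)\<^sup>2
       - 8 * (H * U x) * sqrt (2 * U x ^ 2 * ln (2 * U x ^ 2)))
      / ((2 * U x ^ 2) powr (5/4) * ln (ln (2 * U x ^ 2)) powr (1/4))) at_top"
    unfolding filterlim_at_top by blast
  moreover have "eventually (\<lambda>x. (2 * U x ^ 2) powr (5/4) * ln (ln (2 * U x ^ 2)) powr (1/4) > 0) at_top"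
    unfolding U_def by real_asymp
  ultimately show ?thesis by eventually_elim (simp add: pos_le_divide_eq)
qed

text \<open>The second root bounds the walks up to the cutoff U^2 / 4^x and is of order U x / 2^x.
  The superexponential spacing of the scales makes it negligible against U: the logarithm of the
  time grows only like x^2.\<close>

lemma scale_error:
  fixes H c :: real
  assumes "c > 0" "H > 0"
  defines "U \<equiv> \<lambda>x::real. 2 powr (x\<^sup>2)"
  shows "eventually (\<lambda>x. 1 + 8 * sqrt (H * U x * ln (2 * U x ^ 2))
     + 8 * sqrt (U x ^ 2 / 4 powr x * ln (2 * U x ^ 2)) < c * U x) at_top"
  unfolding U_def using assms(1,2) by real_asymp

lemma less_two_power_square: "k < 2 ^ (k\<^sup>2)" for k :: nat
proof -
  have "k \<le> k\<^sup>2" by (simp add: power2_eq_square)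
  then have "(2::nat) ^ k \<le> 2 ^ (k\<^sup>2)" by (intro power_increasing) auto
  with less_exp[of k] show ?thesis by linarith
qed

lemma incr_blocks:
  "incr x m A a (a + n * l) \<omega> = (\<Sum>i<n. incr x m A (a + i * l) (a + Suc i * l) \<omega>)"
proof (induction n)
  case 0
  then show ?case by (simp add: incr_def)
next
  case (Suc n)
  then show ?case
    using incr_split[of a "a + n * l" "a + Suc n * l" x m A \<omega>] by simp
qed

context match_model
begin

lemma centred_signed:
  "centred x K \<Longrightarrow> (\<And>i. c i = 1 \<or> c i = -1) \<Longrightarrow> centred (\<lambda>i y. c i * x i y) K"
  unfolding centred_def by (auto simp: abs_mult) (metis abs_minus_cancel abs_one mult_1)

definition varA :: real where "varA = (\<Sum>i. p i * (q i - mu)\<^sup>2)"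

lemma expectation_step_A: "j \<ge> 1 \<Longrightarrow> expectation (\<lambda>\<omega>. (q (A j \<omega>) - mu)\<^sup>2) = varA"
  unfolding varA_def
proof (rule expectation_A[where c = 1])
  fix i
  have "\<bar>q i - mu\<bar> \<le> 1"
    using prob_vector_bounds[OF q, of i] mu_pos mu_le_1 by (auto simp: abs_le_iff)
  then show "\<bar>(q i - mu)\<^sup>2\<bar> \<le> 1" by (simp add: abs_square_le_1)
qed

lemma varA_eq: "varA = variance (\<lambda>\<omega>. q (A 1 \<omega>))"
  using expectation_step_A[of 1] expectation_q_A[of 1] by simp

text \<open>Apply the maximal inequality with t = 6 sqrt h: the exponent is at most -18, exp 18
  \<ge> 19 by the tangent bound, and 4/19 \<le> 1/2.\<close>

lemma prob_oscillation:
  assumes g: "inj g" "g ` {a<..b} \<subseteq> Inl ` {1..} \<union> Inr ` {1..}" and ab: "a < b" "b - a \<le> h"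
  shows "prob (event (\<lambda>f. \<forall>y\<in>{a..b}. \<bar>\<Sum>j\<in>{a<..y}. step (g j) (f (g j))\<bar> \<le> 12 * sqrt (real h))) \<ge> 1 / 2"
proof -
  define t where "t = 6 * sqrt (real h)"
  have t2: "t\<^sup>2 = 36 * real h" unfolding t_def by (simp add: power_mult_distrib)
  have "18 * real (b - a) \<le> 18 * real h" using ab by simp
  then have "- t\<^sup>2 / (2 * real (b - a)) \<le> - 18"
    unfolding t2 using ab by (simp add: field_simps)
  then have "exp (- t\<^sup>2 / (2 * real (b - a))) \<le> exp (- 18)" by simp
  also have "\<dots> \<le> 1 / 19"
    using exp_ge_add_one_self[of "18::real"] by (simp add: exp_minus inverse_eq_divide frac_le)
  finally have e: "exp (- t\<^sup>2 / (2 * real (b - a))) \<le> 1 / 19" .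
  define Q where "Q f \<longleftrightarrow> (\<exists>y\<in>{a..b}. \<bar>\<Sum>j\<in>{a<..y}. step (g j) (f (g j))\<bar> > 2 * t)"
    for f :: "nat + nat \<Rightarrow> nat"
  have "depends_on (g ` {a<..b}) (\<lambda>f. \<exists>y\<in>{a..b}. \<bar>\<Sum>i\<in>g ` {a<..y}. step i (f i)\<bar> > 2 * t)"
    by (intro depends_on_Bex depends_on_sum) auto
  then have dep: "depends_on (g ` {a<..b}) Q"
    unfolding Q_def using g(1) by (simp add: sum.reindex inj_on_subset[of g UNIV])
  have "prob (event Q) \<le> 4 * exp (- t\<^sup>2 / (2 * real (b - a)))"
    unfolding Q_def
    by (rule maximal_inequality[OF g centred_subset[OF step_centred g(2)]])
       (use e ab in \<open>auto simp: t_def\<close>)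
  then have "prob (event Q) \<le> 1 / 2" using e by simp
  moreover have "prob (event (\<lambda>f. \<not> Q f)) = 1 - prob (event Q)"
    by (rule prob_event_neg[OF _ g(2) dep]) simp
  ultimately show ?thesis unfolding Q_def t_def by (simp add: not_less)
qed

end

text \<open>\<open>sg\<close> is the sign of the desired difference. \<open>H\<close> makes windows
  so wide that the drift outweighs the largest lead which \<open>early\<close> permits, so the path
  stays inside; \<open>G\<close> makes the jump blocks so short that the smallest permitted lead
  carries the path past all of them.\<close>

locale scale_events = match_model +
  fixes H G :: nat and sg :: real
  assumes sg: "sg = 1 \<or> sg = -1" and varA_pos: "varA > 0"
    and H: "mu * real H \<ge> 16" and G: "sqrt varA * real G \<ge> 80"
begin

text \<open>Scale k looks at the time \<open>2 N\<close>. The event \<open>early\<close> forces the greedy policy ahead in \<open>A\<close>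
  by an amount between \<open>m l\<close> and \<open>h\<close>; the \<open>m\<close> blocks of length \<open>l\<close> immediately after \<open>N\<close> then
  all \<open>jump\<close> in direction \<open>sg\<close>, while the rest of the windows of length \<open>h\<close> around \<open>N\<close> stay
  quiet. Only labels after \<open>lo\<close> are used, which makes different scales independent. As
  \<open>m\<close> is about \<open>log 16 k\<close>, the probability is of order \<open>1/k\<close>, whereas the gain beats the quiet
  parts by a factor of order \<open>sqrt (ln k)\<close>; the norming factor \<open>(ln (ln n)) powr (1/4)\<close> is only of
  order \<open>(ln k) powr (1/4)\<close>.\<close>

definition u :: "nat \<Rightarrow> nat" where "u k = 2 ^ (k\<^sup>2)"
definition N :: "nat \<Rightarrow> nat" where "N k = (u k)\<^sup>2"
definition lo :: "nat \<Rightarrow> nat" where "lo k = 4 ^ (k * (k - 1))"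
definition h :: "nat \<Rightarrow> nat" where "h k = H * u k"
definition m :: "nat \<Rightarrow> nat" where "m k = Suc (nat \<lfloor>log 16 (real k)\<rfloor>)"
definition l :: "nat \<Rightarrow> nat" where "l k = u k div (G * m k)"

definition early :: "nat \<Rightarrow> (nat + nat \<Rightarrow> nat) \<Rightarrow> bool" where
  "early k f \<longleftrightarrow>
    sqrt varA * real (u k) / 20 \<le> (\<Sum>j\<in>{lo k<..N k - h k}. step (Inr j) (f (Inr j))) - (\<Sum>j\<in>{lo k<..N k}. step (Inl j) (f (Inl j))) \<and>
    (\<Sum>j\<in>{lo k<..N k - h k}. step (Inr j) (f (Inr j))) - (\<Sum>j\<in>{lo k<..N k}. step (Inl j) (f (Inl j))) \<le> 16 * real (u k)"

definition quiet_B :: "nat \<Rightarrow> (nat + nat \<Rightarrow> nat) \<Rightarrow> bool" where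
  "quiet_B k f \<longleftrightarrow> (\<forall>y\<in>{N k - h k..N k}.
     \<bar>\<Sum>j\<in>{N k - h k<..y}. step (Inr j) (f (Inr j))\<bar> \<le> 12 * sqrt (real (h k)))"

definition quiet_A :: "nat \<Rightarrow> (nat + nat \<Rightarrow> nat) \<Rightarrow> bool" where
  "quiet_A k f \<longleftrightarrow> (\<forall>y\<in>{N k + m k * l k..N k + h k}.
     \<bar>\<Sum>j\<in>{N k + m k * l k<..y}. step (Inl j) (f (Inl j))\<bar> \<le> 12 * sqrt (real (h k)))"

definition jump :: "nat \<Rightarrow> nat \<Rightarrow> (nat + nat \<Rightarrow> nat) \<Rightarrow> bool" where
  "jump k i f \<longleftrightarrow> sqrt (varA * real (l k)) / 10
     \<le> sg * (\<Sum>j\<in>{N k + i * l k<..N k + Suc i * l k}. step (Inl j) (f (Inl j)))"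

definition window :: "nat \<Rightarrow> (nat + nat) set" where
  "window k = Inl ` {lo k<..N k + h k} \<union> Inr ` {lo k<..N k}"

text \<open>Geometric conditions that hold for all large k. Being a conjunct of
  \<open>fluctuation\<close>, they make that predicate false at small k, so its dependence on
  \<open>window k\<close> can be stated for every k.\<close>

definition good :: "nat \<Rightarrow> bool" where
  "good k \<longleftrightarrow> k \<ge> 1 \<and> 2 * lo k \<le> N k \<and> lo k + h k \<le> N k \<and> N k + h k \<le> lo (Suc k) \<and>
     1 \<le> l k \<and> 1 \<le> varA * real (l k)"

definition fluctuation :: "nat \<Rightarrow> (nat + nat \<Rightarrow> nat) \<Rightarrow> bool" where
  "fluctuation k f \<longleftrightarrow> good k \<and> early k f \<and> quiet_B k f \<and> quiet_A k f \<and> (\<forall>i\<in>{..<m k}. jump k i f)"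

section \<open>Sizes of the scale parameters\<close>

lemma H_ge: "H \<ge> 16"
proof -
  have "mu * real H \<le> 1 * real H" using mu_le_1 by (intro mult_right_mono) auto
  then have "16 \<le> real H" using H by linarith
  then show ?thesis by simp
qed

lemma varA_le_1: "varA \<le> 1"
proof -
  have "varA = expectation (\<lambda>\<omega>. (q (A 1 \<omega>) - mu)\<^sup>2)" using expectation_step_A[of 1] by simp
  also have "\<dots> \<le> expectation (\<lambda>\<omega>. 1)"
  proof (rule integral_mono)
    have b: "(q y - mu)\<^sup>2 \<le> 1" for y
      using prob_vector_bounds[OF q, of y] mu_pos mu_le_1 by (auto simp: abs_square_le_1 abs_le_iff)
    then show "(q (A 1 \<omega>) - mu)\<^sup>2 \<le> 1" for \<omega> .
    show "integrable M (\<lambda>\<omega>. (q (A 1 \<omega>) - mu)\<^sup>2)"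
      using integrable_label[of "Inl 1" "\<lambda>y. (q y - mu)\<^sup>2" 1] b by simp
  qed simp
  finally show ?thesis by (simp add: prob_space)
qed

lemma G_ge: "G \<ge> 1"
  using G by (cases G) auto

lemma u_pos: "u k \<ge> 1"
  by (simp add: u_def)

lemma ml_le: "G * (m k * l k) \<le> u k"
proof -
  have "G * m k * l k \<le> u k" unfolding l_def by (rule times_div_less_eq_dividend)
  then show ?thesis by (simp add: mult.assoc)
qed

lemma ml_less_h: "m k * l k < h k"
proof -
  have "1 * (m k * l k) \<le> G * (m k * l k)" using G_ge by (intro mult_right_mono) auto
  then have "m k * l k \<le> u k" using ml_le[of k] by linarith
  also have "u k < H * u k" using H_ge u_pos[of k] by simp
  finally show ?thesis unfolding h_def .
qed

text \<open>Times are powers of 4 with exponents k (k - 1), k^2, k (k + 1): each cutoff separates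
  two consecutive scales by a factor that tends to infinity on both sides.\<close>

lemma lo_N: "k \<ge> 1 \<Longrightarrow> 4 ^ k * lo k = N k" and N_lo: "N k * 4 ^ k = lo (Suc k)"
proof -
  have "N k = 2 ^ (k\<^sup>2 * 2)" by (simp only: N_def u_def power_mult)
  also have "\<dots> = (2 ^ 2) ^ (k * k)"
  proof -
    have "k\<^sup>2 * 2 = 2 * (k * k)" by (simp add: power2_eq_square)
    then show ?thesis by (simp only: power_mult)
  qed
  finally have N: "N k = 4 ^ (k * k)" by simp
  show "4 ^ k * lo k = N k" if "k \<ge> 1"
    unfolding N lo_def power_add[symmetric] using that by (cases k) auto
  show "N k * 4 ^ k = lo (Suc k)"
    unfolding N lo_def power_add[symmetric] by (simp add: algebra_simps)
qed

lemma m_le: "k \<ge> 1 \<Longrightarrow> m k \<le> Suc k" and m_power: "k \<ge> 1 \<Longrightarrow> 16 ^ m k \<le> 16 * real k"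
  and m_ge: "k \<ge> 1 \<Longrightarrow> log 16 (real k) \<le> real (m k)"
proof -
  assume k: "k \<ge> 1"
  define n where "n = nat \<lfloor>log 16 (real k)\<rfloor>"
  have l0: "log 16 (real k) \<ge> 0" using k by simp
  have n: "real n \<le> log 16 (real k)" "log 16 (real k) \<le> real n + 1" unfolding n_def using l0 by linarith+
  have "(16::real) ^ n = 16 powr real n" by (simp add: powr_realpow)
  also have "\<dots> \<le> 16 powr log 16 (real k)" using n by simp
  also have "\<dots> = real k" using k by simp
  finally have le: "16 ^ n \<le> real k" .
  then show "16 ^ m k \<le> 16 * real k" unfolding m_def n_def[symmetric] by simp
  have "real n < 2 ^ n" by (rule of_nat_less_two_power)
  also have "(2::real) ^ n \<le> 16 ^ n" by (rule power_mono) auto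
  finally have "real n < real k" using le by simp
  then show "m k \<le> Suc k" unfolding m_def n_def[symmetric] by simp
  show "log 16 (real k) \<le> real (m k)" unfolding m_def n_def[symmetric] using n by simp
qed

lemma eventually_l: "eventually (\<lambda>k. l k \<ge> b) sequentially"
  using eventually_ge_at_top[of "max 2 (G * b)"]
proof eventually_elim
  case (elim k)
  have "G * m k * b \<le> Suc k * (G * b)" using m_le[of k] elim
    by (metis One_nat_def Suc_leD max.boundedE mult.commute mult.left_commute mult_le_mono1 numeral_2_eq_2)
  also have "\<dots> \<le> Suc k * Suc k" using elim by (intro mult_le_mono) auto
  also have "\<dots> \<le> 2 ^ k * 2 ^ k" by (intro mult_le_mono Suc_leI less_exp)
  also have "\<dots> = 2 ^ (2 * k)" by (simp add: power_add[symmetric] mult_2)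
  also have "\<dots> \<le> u k" unfolding u_def
    using elim by (intro power_increasing) (auto simp: power2_eq_square)
  finally have "b * (G * m k) \<le> u k" by (simp add: mult_ac)
  then show ?case unfolding l_def
    using G_ge by (subst less_eq_div_iff_mult_less_eq) (auto simp: m_def)
qed

lemma eventually_good: "eventually good sequentially"
proof -
  obtain b :: nat where b: "1 / varA \<le> real b" using real_arch_simple by blast
  show ?thesis using eventually_l[of "max 1 b"] eventually_ge_at_top[of "2 * H"]
  proof eventually_elim
    case (elim k)
    have k: "k \<ge> 1" using elim H_ge by simp
    have Hu: "2 * H \<le> u k" using elim less_two_power_square[of k] unfolding u_def by simp
    have h: "2 * h k \<le> N k" unfolding h_def N_def power2_eq_square
      using Hu by (metis mult.assoc mult_le_mono1)
    have "(4::nat) ^ 1 \<le> 4 ^ k" using k by (intro power_increasing) auto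
    then have p4: "4 \<le> (4::nat) ^ k" by simp
    have lo: "4 * lo k \<le> N k" using mult_le_mono1[OF p4, of "lo k"] lo_N[OF k] by simp
    have N: "N k * 4 \<le> lo (Suc k)" using mult_le_mono2[OF p4, of "N k"] N_lo[of k] by simp
    have "1 / varA \<le> real (l k)" using b elim by linarith
    then have "1 \<le> varA * real (l k)" using varA_pos by (simp add: divide_simps mult.commute)
    then show ?case unfolding good_def using k h lo N elim by auto
  qed
qed

section \<open>Independence and probability of the events at one scale\<close>

lemma window_subset: "window k \<subseteq> Inl ` {1..} \<union> Inr ` {1..}" "finite (window k)"
  unfolding window_def by auto

text \<open>The \<open>B\<close> part stops at \<open>N k - h k\<close>, leaving the labels of
  \<open>quiet_B\<close> untouched. As \<open>lo k\<close> is at most half of \<open>N k\<close>,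
  the \<open>A\<close> labels alone give variance at least N/2 times \<open>varA\<close>, so
  anti-concentration reaches the lower threshold with probability 1/16. Hoeffding's inequality for
  at most 2 N labels makes exceeding 16 u cost 2 exp (-64), less than 1/32, which leaves
  1/32.\<close>

lemma
  assumes "good k"
  shows early_dep: "depends_on (Inl ` {lo k<..N k} \<union> Inr ` {lo k<..N k - h k}) (early k)"
    and early_prob: "prob (event (early k)) \<ge> 1 / 32"
proof -
  define x where "x i y = case_sum (\<lambda>_. -1) (\<lambda>_. 1) i * step i y" for i :: "nat + nat" and y
  define K where "K = Inl ` {lo k<..N k} \<union> Inr ` {lo k<..N k - h k}"
  have K: "finite K" "K \<subseteq> Inl ` {1..} \<union> Inr ` {1..}" unfolding K_def by auto
  have cardK: "card K \<le> 2 * N k"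
  proof -
    have "card K \<le> card (Inl ` {lo k<..N k} :: (nat + nat) set) + card (Inr ` {lo k<..N k - h k} :: (nat + nat) set)"
      unfolding K_def by (rule card_Un_le)
    also have "\<dots> \<le> N k + N k" by (intro add_mono order_trans[OF card_image_le]) auto
    finally show ?thesis by simp
  qed
  have xc: "centred x K"
    unfolding x_def
    by (rule centred_signed[OF centred_subset[OF step_centred K(2)]]) (auto split: sum.split)
  have Zeq: "(\<Sum>i\<in>K. x i (f i)) = (\<Sum>j\<in>{lo k<..N k - h k}. step (Inr j) (f (Inr j)))
      - (\<Sum>j\<in>{lo k<..N k}. step (Inl j) (f (Inl j)))" for f
  proof -
    have "(\<Sum>i\<in>K. x i (f i)) = (\<Sum>i\<in>Inl ` {lo k<..N k}. x i (f i)) + (\<Sum>i\<in>Inr ` {lo k<..N k - h k}. x i (f i))"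
      unfolding K_def by (rule sum.union_disjoint) auto
    then show ?thesis by (simp add: sum.reindex x_def sum_subtractf sum_negf)
  qed
  have early_eq: "early k f \<longleftrightarrow> sqrt varA * real (u k) / 20 \<le> (\<Sum>i\<in>K. x i (f i)) \<and> (\<Sum>i\<in>K. x i (f i)) \<le> 16 * real (u k)" for f
    unfolding early_def Zeq ..
  have dep: "depends_on K (early k)"
    unfolding early_eq by (rule depends_on_sum) simp
  then show "depends_on (Inl ` {lo k<..N k} \<union> Inr ` {lo k<..N k - h k}) (early k)" unfolding K_def .
  have V: "vsum x K \<ge> real (N k) / 2 * varA"
  proof -
    have "real (N k) / 2 * varA \<le> real (N k - lo k) * varA"
      using assms varA_pos by (intro mult_right_mono) (auto simp: good_def of_nat_diff)
    also have "\<dots> = (\<Sum>j\<in>{lo k<..N k}. expectation (\<lambda>\<omega>. (x (Inl j) (case_sum A B (Inl j) \<omega>))\<^sup>2))"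
    proof -
      have "expectation (\<lambda>\<omega>. (x (Inl j) (case_sum A B (Inl j) \<omega>))\<^sup>2) = varA" if "j \<in> {lo k<..N k}" for j
        using expectation_step_A[of j] that by (simp add: x_def power2_commute)
      then show ?thesis by simp
    qed
    also have "\<dots> = (\<Sum>i\<in>Inl ` {lo k<..N k}. expectation (\<lambda>\<omega>. (x i (case_sum A B i \<omega>))\<^sup>2))"
      by (simp add: sum.reindex)
    also have "\<dots> \<le> vsum x K"
      unfolding vsum_def by (rule sum_mono2) (auto simp: K_def intro!: integral_nonneg)
    finally show ?thesis .
  qed
  have NV: "(sqrt varA * real (u k) / 2)\<^sup>2 \<le> vsum x K"
  proof -
    have "(sqrt varA * real (u k) / 2)\<^sup>2 = real (N k) / 4 * varA"
      using varA_pos unfolding N_def by (simp add: power_mult_distrib power_divide)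
    also have "\<dots> \<le> real (N k) / 2 * varA" using varA_pos by (intro mult_right_mono) auto
    finally show ?thesis using V by simp
  qed
  then have sV: "sqrt varA * real (u k) / 2 \<le> sqrt (vsum x K)" by (rule real_le_rsqrt)
  \<comment> \<open>The variance condition is inherited from a single block:
    \<open>h k \<le> N k\<close> forces u \<ge> H \<ge> 16, whence N \<ge> 2 u \<ge> 2 l, and
    \<open>varA * l \<ge> 1\<close> is part of \<open>good\<close>.\<close>
  have V1: "vsum x K \<ge> 1"
  proof -
    have "2 * lo k \<le> N k" "2 * l k \<le> N k"
    proof -
      have "l k \<le> u k" unfolding l_def by simp
      moreover have "2 * u k \<le> N k"
      proof -
        have "h k \<le> N k" using assms unfolding good_def by simp
        then have "H \<le> u k" unfolding h_def N_def power2_eq_square using u_pos[of k] by simp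
        then show ?thesis using H_ge unfolding N_def power2_eq_square by (intro mult_le_mono1) simp
      qed
      ultimately show "2 * l k \<le> N k" by simp
    qed (use assms in \<open>simp add: good_def\<close>)
    then have "varA * real (l k) \<le> varA * (real (N k) / 2)" using varA_pos by (intro mult_left_mono) auto
    then show ?thesis using V assms unfolding good_def by (simp add: mult.commute)
  qed
  define E1 where "E1 = event (\<lambda>f. (\<Sum>i\<in>K. x i (f i)) \<ge> sqrt (vsum x K) / 10)"
  define E2 where "E2 = event (\<lambda>f. \<bar>\<Sum>i\<in>K. x i (f i)\<bar> > 16 * real (u k))"
  have E_ev: "E1 \<in> events" "E2 \<in> events" "event (early k) \<in> events"
    unfolding E1_def E2_def
    by (rule event_measurable[OF K], rule depends_on_sum[where P = "\<lambda>s. sqrt (vsum x K) / 10 \<le> s"], simp)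
       (rule event_measurable[OF K], rule depends_on_sum[where P = "\<lambda>s. 16 * real (u k) < \<bar>s\<bar>"], simp,
        rule event_measurable[OF K dep])
  have "1 / 16 \<le> prob E1" unfolding E1_def by (rule anti_concentration[OF K xc V1])
  also have "prob E1 \<le> prob (event (early k) \<union> E2)"
  proof (rule finite_measure_mono)
    show "E1 \<subseteq> event (early k) \<union> E2"
      using sV unfolding E1_def E2_def early_eq by auto
  qed (use E_ev in auto)
  also have "\<dots> \<le> prob (event (early k)) + prob E2" by (rule measure_Un_le) (use E_ev in auto)
  also have "prob E2 \<le> 1 / 32"
  proof -
    have "prob E2 \<le> 2 * exp (- (16 * real (u k))\<^sup>2 / (2 * real (2 * N k)))"
      unfolding E2_def by (rule hoeffding[OF K xc cardK]) simp
    also have "- (16 * real (u k))\<^sup>2 / (2 * real (2 * N k)) = - 64"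
      using u_pos[of k] unfolding N_def by (simp add: power_mult_distrib)
    also have "2 * exp (- 64) \<le> (1 / 32 :: real)"
      using exp_ge_add_one_self[of "64::real"] by (simp add: exp_minus inverse_eq_divide divide_simps)
    finally show ?thesis .
  qed
  finally show "prob (event (early k)) \<ge> 1 / 32" by simp
qed

lemma quiet_B_dep: "depends_on (Inr ` {N k - h k<..N k}) (quiet_B k)"
proof -
  have "depends_on (Inr ` {N k - h k<..N k}) (\<lambda>f. \<forall>y\<in>{N k - h k..N k}.
     \<bar>\<Sum>i\<in>Inr ` {N k - h k<..y}. step i (f i)\<bar> \<le> 12 * sqrt (real (h k)))"
    by (intro depends_on_Ball depends_on_sum) auto
  then show ?thesis unfolding quiet_B_def by (simp add: sum.reindex)
qed

lemma quiet_A_dep: "depends_on (Inl ` {N k + m k * l k<..N k + h k}) (quiet_A k)"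
proof -
  have "depends_on (Inl ` {N k + m k * l k<..N k + h k}) (\<lambda>f. \<forall>y\<in>{N k + m k * l k..N k + h k}.
     \<bar>\<Sum>i\<in>Inl ` {N k + m k * l k<..y}. step i (f i)\<bar> \<le> 12 * sqrt (real (h k)))"
    by (intro depends_on_Ball depends_on_sum) auto
  then show ?thesis unfolding quiet_A_def by (simp add: sum.reindex)
qed

lemma quiet_prob:
  assumes "good k"
  shows "prob (event (quiet_B k)) \<ge> 1 / 2" "prob (event (quiet_A k)) \<ge> 1 / 2"
proof -
  have "h k > 0" unfolding h_def using H_ge u_pos[of k] by simp
  with assms ml_less_h[of k]
  show "prob (event (quiet_B k)) \<ge> 1 / 2" "prob (event (quiet_A k)) \<ge> 1 / 2"
    unfolding quiet_B_def quiet_A_def by (intro prob_oscillation; auto simp: good_def)+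
qed

lemma jump_sum: "sg * (\<Sum>j\<in>{a<..b}. step (Inl j) (f (Inl j))) = (\<Sum>i\<in>Inl ` {a<..b}. sg * step i (f i))"
  by (simp add: sum.reindex sum_distrib_left)

lemma jump_eq: "jump k i f \<longleftrightarrow> sqrt (varA * real (l k)) / 10
    \<le> (\<Sum>i\<in>Inl ` {N k + i * l k<..N k + Suc i * l k}. sg * step i (f i))"
  unfolding jump_def jump_sum ..

lemma jump_dep: "depends_on (Inl ` {N k + i * l k<..N k + Suc i * l k}) (jump k i)"
  unfolding jump_eq by (rule depends_on_sum[where x = "\<lambda>i y. sg * step i y"]) simp

lemma jump_prob:
  assumes "good k"
  shows "prob (event (jump k i)) \<ge> 1 / 16"
proof -
  define K where "K = (Inl ` {N k + i * l k<..N k + Suc i * l k} :: (nat + nat) set)"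
  have K: "finite K" "K \<subseteq> Inl ` {1..} \<union> Inr ` {1..}" unfolding K_def by auto
  have c: "centred (\<lambda>i y. sg * step i y) K"
    by (rule centred_signed[OF centred_subset[OF step_centred K(2)]]) (use sg in auto)
  have V: "vsum (\<lambda>i y. sg * step i y) K = varA * real (l k)"
  proof -
    have "expectation (\<lambda>\<omega>. (sg * step (Inl j) (case_sum A B (Inl j) \<omega>))\<^sup>2) = varA"
      if "j \<in> {N k + i * l k<..N k + Suc i * l k}" for j
      using expectation_step_A[of j] that sg by (auto simp: power_mult_distrib)
    then show ?thesis unfolding vsum_def K_def by (simp add: sum.reindex)
  qed
  have "prob (event (\<lambda>f. (\<Sum>i\<in>K. sg * step i (f i)) \<ge> sqrt (vsum (\<lambda>i y. sg * step i y) K) / 10)) \<ge> 1 / 16"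
    by (rule anti_concentration[OF K c]) (use assms V in \<open>simp add: good_def\<close>)
  then show ?thesis unfolding V unfolding K_def jump_eq .
qed

lemma jumps:
  assumes "good k"
  shows "depends_on (Inl ` {N k<..N k + m k * l k}) (\<lambda>f. \<forall>i\<in>{..<m k}. jump k i f)"
    and "prob (event (\<lambda>f. \<forall>i\<in>{..<m k}. jump k i f)) \<ge> (1 / 16) ^ m k"
proof -
  have sub: "{N k + i * l k<..N k + Suc i * l k} \<subseteq> {N k<..N k + m k * l k}" if "i < m k" for i
  proof -
    have "Suc i * l k \<le> m k * l k" using that by (intro mult_le_mono1) auto
    then show ?thesis by auto
  qed
  show "depends_on (Inl ` {N k<..N k + m k * l k}) (\<lambda>f. \<forall>i\<in>{..<m k}. jump k i f)"
    by (intro depends_on_Ball depends_on_mono[OF jump_dep] image_mono sub) simp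
  have "(1 / 16 :: real) ^ m k = (\<Prod>i\<in>{..<m k}. 1 / 16)" by simp
  also have "\<dots> \<le> (\<Prod>i\<in>{..<m k}. prob (event (jump k i)))"
    by (rule prod_mono) (use jump_prob[OF assms] in auto)
  also have "\<dots> = prob (event (\<lambda>f. \<forall>i\<in>{..<m k}. jump k i f))"
  proof (rule prob_event_prod[symmetric, where K = "\<lambda>i. Inl ` {N k + i * l k<..N k + Suc i * l k}"])
    have "{N k + i * l k<..N k + Suc i * l k} \<inter> {N k + j * l k<..N k + Suc j * l k} = {}" if "i < j" for i j
    proof -
      have "Suc i * l k \<le> j * l k" using that by (intro mult_le_mono1) auto
      then show ?thesis by auto
    qed
    then have "i \<noteq> j \<Longrightarrow> {N k + i * l k<..N k + Suc i * l k} \<inter> {N k + j * l k<..N k + Suc j * l k} = {}" for i j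
      by (metis inf_commute linorder_neqE_nat)
    then show "disjoint_family_on (\<lambda>i. Inl ` {N k + i * l k<..N k + Suc i * l k}) {..<m k}"
      unfolding disjoint_family_on_def by (auto simp: image_Int[OF inj_Inl, symmetric])
  qed (use jump_dep in \<open>auto simp: m_def\<close>)
  finally show "prob (event (\<lambda>f. \<forall>i\<in>{..<m k}. jump k i f)) \<ge> (1 / 16) ^ m k" .
qed

lemma fluctuation_dep: "depends_on (window k) (fluctuation k)"
proof (cases "good k")
  case True
  then have le: "lo k \<le> N k - h k" "lo k \<le> N k" "m k * l k < h k"
    using ml_less_h[of k] unfolding good_def by auto
  show ?thesis unfolding fluctuation_def window_def
    by (intro depends_on_conj depends_on_mono[OF early_dep[OF True]] depends_on_mono[OF quiet_B_dep]
        depends_on_mono[OF quiet_A_dep] depends_on_mono[OF jumps(1)[OF True]])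
       (use le in \<open>auto simp: depends_on_def\<close>)
qed (simp add: fluctuation_def depends_on_def)

text \<open>The four ingredients live on disjoint sets of labels, so their probabilities multiply to
  at least 1/32 * 1/2 * 1/2 * 16^(-m). With 16^m \<le> 16 k this is 1 / (2048 k), a multiple of the
  harmonic series.\<close>

lemma fluctuation_prob:
  assumes "good k"
  shows "prob (event (fluctuation k)) \<ge> 1 / 2048 * inverse (real k)"
proof -
  have k: "k \<ge> 1" and le: "lo k \<le> N k - h k" "lo k \<le> N k" "m k * l k < h k"
    using assms ml_less_h[of k] unfolding good_def by auto
  let ?KE = "Inl ` {lo k<..N k} \<union> Inr ` {lo k<..N k - h k} :: (nat + nat) set"
  let ?KB = "Inr ` {N k - h k<..N k} :: (nat + nat) set"
  let ?KA = "Inl ` {N k + m k * l k<..N k + h k} :: (nat + nat) set"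
  let ?KJ = "Inl ` {N k<..N k + m k * l k} :: (nat + nat) set"
  let ?J = "\<lambda>f. \<forall>i\<in>{..<m k}. jump k i f"
  have dAJ: "depends_on (?KA \<union> ?KJ) (\<lambda>f. quiet_A k f \<and> ?J f)"
    by (intro depends_on_conj depends_on_mono[OF quiet_A_dep] depends_on_mono[OF jumps(1)[OF assms]]) auto
  have dBAJ: "depends_on (?KB \<union> (?KA \<union> ?KJ)) (\<lambda>f. quiet_B k f \<and> quiet_A k f \<and> ?J f)"
    by (intro depends_on_conj depends_on_mono[OF dAJ] depends_on_mono[OF quiet_B_dep]) auto
  have "event (fluctuation k) = event (\<lambda>f. early k f \<and> quiet_B k f \<and> quiet_A k f \<and> ?J f)"
    using assms unfolding fluctuation_def by simp
  then have "prob (event (fluctuation k))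
      = prob (event (early k)) * prob (event (\<lambda>f. quiet_B k f \<and> quiet_A k f \<and> ?J f))"
    using le by (simp only:) (rule prob_event_conj[OF _ _ early_dep[OF assms] _ _ dBAJ], auto)
  also have "prob (event (\<lambda>f. quiet_B k f \<and> quiet_A k f \<and> ?J f))
      = prob (event (quiet_B k)) * prob (event (\<lambda>f. quiet_A k f \<and> ?J f))"
    by (rule prob_event_conj[OF _ _ quiet_B_dep _ _ dAJ]) auto
  also have "prob (event (\<lambda>f. quiet_A k f \<and> ?J f)) = prob (event (quiet_A k)) * prob (event ?J)"
    by (rule prob_event_conj[OF _ _ quiet_A_dep _ _ jumps(1)[OF assms]]) auto
  finally have eq: "prob (event (fluctuation k))
      = prob (event (early k)) * (prob (event (quiet_B k)) * (prob (event (quiet_A k)) * prob (event ?J)))" .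
  have "1 / 32 * (1 / 2 * (1 / 2 * (1 / 16) ^ m k)) \<le> prob (event (fluctuation k))"
    unfolding eq
    by (intro mult_mono early_prob[OF assms] quiet_prob[OF assms] jumps(2)[OF assms] mult_nonneg_nonneg) auto
  moreover have "1 / 32 * (1 / 2 * (1 / 2 * (1 / 16) ^ m k)) \<ge> 1 / 2048 * inverse (real k)"
    using m_power[OF k] k by (simp add: power_one_over field_simps)
  ultimately show ?thesis by linarith
qed

lemma window_disjoint:
  assumes start: "\<And>k. k \<ge> start \<Longrightarrow> good k"
  shows "disjoint_family_on window {start..}"
proof -
  have "window i \<inter> window j = {}" if "start \<le> i" "i < j" for i j
  proof -
    have "N i + h i \<le> lo (Suc i)" using start[OF that(1)] unfolding good_def by simp
    also have "\<dots> \<le> lo j" unfolding lo_def using that by (intro power_increasing mult_mono) auto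
    finally show ?thesis unfolding window_def by auto
  qed
  then show ?thesis unfolding disjoint_family_on_def
    by (metis atLeast_iff inf_commute linorder_neqE_nat)
qed

lemma AE_fluctuation: "AE \<omega> in M. frequently (\<lambda>k. fluctuation k (\<lambda>i. case_sum A B i \<omega>)) sequentially"
proof -
  obtain start where start: "\<And>k. k \<ge> start \<Longrightarrow> good k"
    using eventually_good unfolding eventually_sequentially by blast
  show ?thesis
  proof (rule AE_frequently_event[where K = window and start = start])
    show "\<not> summable (\<lambda>k. 1 / 2048 * inverse (real k))"
      using not_summable_harmonic[where 'a = real] by simp
  qed (use start window_subset fluctuation_dep fluctuation_prob window_disjoint in auto)
qed

section \<open>Deterministic consequences of a fluctuation on a regular path\<close>

context
  fixes k \<rho> :: nat and \<omega> :: 'a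
  assumes fluct: "fluctuation k (\<lambda>i. case_sum A B i \<omega>)" and reg: "regular (2 * N k) \<omega>"
    and err: "1 + 8 * sqrt (real (h k) * ln (real (2 * N k))) + 8 * sqrt (real (lo k) * ln (real (2 * N k)))
      < sqrt varA / 40 * real (u k)"
    and \<rho>: "\<rho> \<le> 2 * N k" "\<bar>Gam q A \<rho> \<omega> - Gam p B (2 * N k - \<rho>) \<omega>\<bar> \<le> 1"
begin

lemma good_k: "good k"
  using fluct unfolding fluctuation_def by simp

lemma le_facts: "lo k + h k \<le> N k" "m k * l k < h k" "h k \<le> N k" "lo k \<le> N k"
  using good_k ml_less_h[of k] unfolding good_def by auto

lemma incr_small:
  assumes "a \<le> b" "b \<le> 2 * N k" "b - a \<le> c"
  shows "\<bar>incr q mu A a b \<omega>\<bar> \<le> 4 * sqrt (real c * ln (real (2 * N k)))"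
    and "\<bar>incr p mu B a b \<omega>\<bar> \<le> 4 * sqrt (real c * ln (real (2 * N k)))"
proof -
  have "N k \<ge> 1" unfolding N_def using u_pos[of k] by simp
  then have "ln (real (2 * N k)) \<ge> 0" by simp
  then have "sqrt (real (b - a) * ln (real (2 * N k))) \<le> sqrt (real c * ln (real (2 * N k)))"
    using assms(3) by (intro real_sqrt_le_mono mult_right_mono) auto
  moreover have "\<bar>incr q mu A a b \<omega>\<bar> \<le> 4 * sqrt (real (b - a) * ln (real (2 * N k)))"
    "\<bar>incr p mu B a b \<omega>\<bar> \<le> 4 * sqrt (real (b - a) * ln (real (2 * N k)))"
    using reg assms unfolding regular_def by blast+
  ultimately show "\<bar>incr q mu A a b \<omega>\<bar> \<le> 4 * sqrt (real c * ln (real (2 * N k)))"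
    "\<bar>incr p mu B a b \<omega>\<bar> \<le> 4 * sqrt (real c * ln (real (2 * N k)))" by linarith+
qed

lemma early_bounds:
  "sqrt varA * real (u k) / 20 \<le> incr p mu B (lo k) (N k - h k) \<omega> - incr q mu A (lo k) (N k) \<omega>"
  "incr p mu B (lo k) (N k - h k) \<omega> - incr q mu A (lo k) (N k) \<omega> \<le> 16 * real (u k)"
  using fluct unfolding fluctuation_def early_def incr_A incr_B by auto

text \<open>If \<rho> were larger, monotonicity and balance would keep the score sums at
  \<open>N k + h k\<close> and \<open>N k - h k\<close> within 1 in one direction. But the drift
  between these points is 2 mu H u \<ge> 32 u, and the early lead takes away at most 16 u.\<close>

lemma path_upper: "\<rho> \<le> N k + h k"
proof (rule ccontr)
  assume "\<not> \<rho> \<le> N k + h k"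
  then have "Gam q A (N k + h k) \<omega> \<le> Gam q A \<rho> \<omega>" "Gam p B (2 * N k - \<rho>) \<omega> \<le> Gam p B (N k - h k) \<omega>"
    using p q by (auto intro!: Gam_mono)
  then have "Gam q A (N k + h k) \<omega> - Gam p B (N k - h k) \<omega> \<le> 1" using \<rho>(2) by linarith
  moreover have "Gam q A (N k + h k) \<omega> = mu * real (N k + h k) + (incr q mu A 0 (lo k) \<omega>
      + incr q mu A (lo k) (N k) \<omega> + incr q mu A (N k) (N k + h k) \<omega>)"
    using Gam_incr[of q A "N k + h k" \<omega> mu] incr_split[of 0 "N k" "N k + h k" q mu A \<omega>]
      incr_split[of 0 "lo k" "N k" q mu A \<omega>] le_facts by simp
  moreover have "Gam p B (N k - h k) \<omega> = mu * real (N k - h k) + (incr p mu B 0 (lo k) \<omega>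
      + incr p mu B (lo k) (N k - h k) \<omega>)"
    using Gam_incr[of p B "N k - h k" \<omega> mu] incr_split[of 0 "lo k" "N k - h k" p mu B \<omega>] le_facts by simp
  moreover have "mu * real (N k + h k) - mu * real (N k - h k) = 2 * (mu * real H * real (u k))"
    using le_facts unfolding h_def by (simp add: of_nat_diff algebra_simps)
  moreover have "16 * real (u k) \<le> mu * real H * real (u k)"
    by (rule mult_right_mono[OF H]) simp
  moreover have "\<bar>incr q mu A 0 (lo k) \<omega>\<bar> \<le> 4 * sqrt (real (lo k) * ln (real (2 * N k)))"
    "\<bar>incr p mu B 0 (lo k) \<omega>\<bar> \<le> 4 * sqrt (real (lo k) * ln (real (2 * N k)))"
    "\<bar>incr q mu A (N k) (N k + h k) \<omega>\<bar> \<le> 4 * sqrt (real (h k) * ln (real (2 * N k)))"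
    by (rule incr_small; use le_facts in auto)+
  moreover have "sqrt varA / 40 * real (u k) \<le> 1 * real (u k)"
    using varA_le_1 varA_pos by (intro mult_right_mono) (auto intro: order_trans[of _ 1])
  moreover have "0 \<le> sqrt (real (h k) * ln (real (2 * N k)))"
    using le_facts ml_less_h[of k] by simp
  ultimately show False using early_bounds err by linarith
qed

text \<open>The reverse comparison at N + c and N - c, where c is the total length of the jump
  blocks. The drift is at most 2 c, hence at most sqrt varA * u / 40 by the choice of
  \<open>G\<close>: half of what the early lead guarantees. The other half exceeds the four error
  increments plus the balance error 1, which is precisely the assumption \<open>err\<close>.\<close>

lemma path_lower: "N k + m k * l k \<le> \<rho>"
proof (rule ccontr)
  define c where "c = m k * l k"
  note le_facts = le_facts[folded c_def]
  assume "\<not> N k + m k * l k \<le> \<rho>"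
  then have "Gam q A \<rho> \<omega> \<le> Gam q A (N k + c) \<omega>" "Gam p B (N k - c) \<omega> \<le> Gam p B (2 * N k - \<rho>) \<omega>"
    using p q unfolding c_def[symmetric] by (auto intro!: Gam_mono)
  then have "- 1 \<le> Gam q A (N k + c) \<omega> - Gam p B (N k - c) \<omega>" using \<rho>(2) by linarith
  moreover have "Gam q A (N k + c) \<omega> = mu * real (N k + c) + (incr q mu A 0 (lo k) \<omega>
      + incr q mu A (lo k) (N k) \<omega> + incr q mu A (N k) (N k + c) \<omega>)"
    using Gam_incr[of q A "N k + c" \<omega> mu] incr_split[of 0 "N k" "N k + c" q mu A \<omega>]
      incr_split[of 0 "lo k" "N k" q mu A \<omega>] le_facts by simp
  moreover have "Gam p B (N k - c) \<omega> = mu * real (N k - c) + (incr p mu B 0 (lo k) \<omega>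
      + incr p mu B (lo k) (N k - h k) \<omega> + incr p mu B (N k - h k) (N k - c) \<omega>)"
    using Gam_incr[of p B "N k - c" \<omega> mu] incr_split[of 0 "lo k" "N k - h k" p mu B \<omega>]
      incr_split[of 0 "N k - h k" "N k - c" p mu B \<omega>] le_facts by simp
  moreover have "mu * real (N k + c) - mu * real (N k - c) = 2 * (mu * real c)"
    using le_facts by (simp add: of_nat_diff algebra_simps)
  moreover have "mu * real c \<le> 1 * real c" using mu_le_1 by (intro mult_right_mono) auto
  moreover have "80 * real c \<le> sqrt varA * real (u k)"
  proof -
    have "80 * real c \<le> sqrt varA * real G * real c" using G by (intro mult_right_mono) auto
    also have "\<dots> = sqrt varA * real (G * c)" by simp
    also have "\<dots> \<le> sqrt varA * real (u k)"
      using ml_le[of k] varA_pos unfolding c_def by (intro mult_left_mono of_nat_mono) auto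
    finally show ?thesis .
  qed
  moreover have "\<bar>incr q mu A 0 (lo k) \<omega>\<bar> \<le> 4 * sqrt (real (lo k) * ln (real (2 * N k)))"
    "\<bar>incr p mu B 0 (lo k) \<omega>\<bar> \<le> 4 * sqrt (real (lo k) * ln (real (2 * N k)))"
    "\<bar>incr q mu A (N k) (N k + c) \<omega>\<bar> \<le> 4 * sqrt (real (h k) * ln (real (2 * N k)))"
    "\<bar>incr p mu B (N k - h k) (N k - c) \<omega>\<bar> \<le> 4 * sqrt (real (h k) * ln (real (2 * N k)))"
    by (rule incr_small; use le_facts in auto)+
  ultimately show False using early_bounds err by linarith
qed

lemma walk_A_gain: "sg * incr q mu A (N k) \<rho> \<omega> \<ge> real (m k) * (sqrt (varA * real (l k)) / 10) - 12 * sqrt (real (h k))"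
proof -
  define c where "c = m k * l k"
  have "real (m k) * (sqrt (varA * real (l k)) / 10) = (\<Sum>i<m k. sqrt (varA * real (l k)) / 10)" by simp
  also have "\<dots> \<le> (\<Sum>i<m k. sg * incr q mu A (N k + i * l k) (N k + Suc i * l k) \<omega>)"
    using fluct unfolding fluctuation_def jump_def incr_A by (intro sum_mono) auto
  also have "\<dots> = sg * incr q mu A (N k) (N k + c) \<omega>"
    unfolding c_def incr_blocks sum_distrib_left ..
  finally have 1: "real (m k) * (sqrt (varA * real (l k)) / 10) \<le> sg * incr q mu A (N k) (N k + c) \<omega>" .
  have "\<bar>incr q mu A (N k + c) \<rho> \<omega>\<bar> \<le> 12 * sqrt (real (h k))"
    using fluct path_lower path_upper unfolding fluctuation_def quiet_A_def incr_A c_def by auto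
  then have 2: "\<bar>sg * incr q mu A (N k + c) \<rho> \<omega>\<bar> \<le> 12 * sqrt (real (h k))" using sg by auto
  have "incr q mu A (N k) \<rho> \<omega> = incr q mu A (N k) (N k + c) \<omega> + incr q mu A (N k + c) \<rho> \<omega>"
    using path_lower unfolding c_def by (intro incr_split) auto
  then show ?thesis using 1 2 by (simp add: distrib_left)
qed

text \<open>\<open>quiet_B\<close> measures from the left end of the window while the increment ends
  at N, so it is a difference of two quiet values; hence twice 12.\<close>

lemma walk_B_loss: "\<bar>incr p mu B (2 * N k - \<rho>) (N k) \<omega>\<bar> \<le> 24 * sqrt (real (h k))"
proof -
  have r: "N k - h k \<le> 2 * N k - \<rho>" "2 * N k - \<rho> \<le> N k" using path_lower path_upper \<rho>(1) by auto
  have "\<bar>incr p mu B (N k - h k) (2 * N k - \<rho>) \<omega>\<bar> \<le> 12 * sqrt (real (h k))"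
    "\<bar>incr p mu B (N k - h k) (N k) \<omega>\<bar> \<le> 12 * sqrt (real (h k))"
    using fluct r unfolding fluctuation_def quiet_B_def incr_B by auto
  moreover have "incr p mu B (N k - h k) (N k) \<omega>
      = incr p mu B (N k - h k) (2 * N k - \<rho>) \<omega> + incr p mu B (2 * N k - \<rho>) (N k) \<omega>"
    by (rule incr_split[OF r])
  ultimately show ?thesis by linarith
qed

text \<open>At alternating position (N, N) the drift cancels and leaves N (I - J) - \<delta> (mu
  \<delta> + I), with the two walk increments I and J. For the last product the trivial bound
  \<bar>I\<bar> \<le> \<delta> suffices: with \<delta> \<le> h it is of order N, below N^(5/4). The
  36 is 12 lost in \<open>A\<close> after the jumps plus 24 in \<open>B\<close>.\<close>

lemma fluctuation_gain:
  "sg * (mcount A B \<rho> (2 * N k - \<rho>) \<omega> - mcount A B (N k) (N k) \<omega>)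
    \<ge> real (N k) * (real (m k) * (sqrt (varA * real (l k)) / 10) - 36 * sqrt (real (h k)))
      - 2 * (real (h k))\<^sup>2 - 8 * real (h k) * sqrt (real (2 * N k) * ln (real (2 * N k)))"
proof -
  define \<delta> where "\<delta> = real \<rho> - real (N k)"
  define I where "I = incr q mu A (N k) \<rho> \<omega>"
  define J where "J = incr p mu B (2 * N k - \<rho>) (N k) \<omega>"
  define E where "E = 4 * sqrt (real (2 * N k) * ln (real (2 * N k)))"
  define D where "D = mcount A B \<rho> (2 * N k - \<rho>) \<omega> - mcount A B (N k) (N k) \<omega>"
  have N1: "N k \<ge> 1" unfolding N_def using u_pos[of k] by simp
  have E0: "E \<ge> 0" unfolding E_def using N1 by simp
  have \<delta>: "0 \<le> \<delta>" "\<delta> \<le> real (h k)" using path_lower path_upper unfolding \<delta>_def by auto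
  have S: "real (2 * N k - \<rho>) = real (N k) - \<delta>" using \<rho>(1) unfolding \<delta>_def by (simp add: of_nat_diff)
  have "Gam q A \<rho> \<omega> - Gam q A (N k) \<omega> = mu * \<delta> + I"
    unfolding \<delta>_def I_def using incr_split[of 0 "N k" \<rho> q mu A \<omega>] path_lower
    by (simp add: Gam_incr[of _ _ _ _ mu] algebra_simps)
  moreover have "Gam p B (2 * N k - \<rho>) \<omega> - Gam p B (N k) \<omega> = - (mu * \<delta> + J)"
  proof -
    have "incr p mu B 0 (N k) \<omega> = incr p mu B 0 (2 * N k - \<rho>) \<omega> + J"
      unfolding J_def by (rule incr_split) (use path_lower in auto)
    then show ?thesis
      unfolding Gam_incr[of _ _ _ _ mu] S by (simp add: algebra_simps)
  qed
  moreover have "\<bar>D - (real (2 * N k - \<rho>) * (Gam q A \<rho> \<omega> - Gam q A (N k) \<omega>)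
      + real (N k) * (Gam p B (2 * N k - \<rho>) \<omega> - Gam p B (N k) \<omega>))\<bar>
    \<le> (\<bar>real \<rho> - real (N k)\<bar> + \<bar>real (2 * N k - \<rho>) - real (N k)\<bar>) * E"
    unfolding D_def E_def
    by (rule match_diff[where n = "2 * N k"]; (rule regular_Ncnt[OF reg])?) (use \<rho> in auto)
  ultimately have "\<bar>D - ((real (N k) - \<delta>) * (mu * \<delta> + I) + real (N k) * (- (mu * \<delta> + J)))\<bar> \<le> (\<delta> + \<delta>) * E"
    unfolding S \<delta>_def[symmetric] using \<delta> by simp
  moreover have "(real (N k) - \<delta>) * (mu * \<delta> + I) + real (N k) * (- (mu * \<delta> + J))
      = real (N k) * (I - J) - \<delta> * (mu * \<delta> + I)"
    by (simp add: algebra_simps)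
  ultimately have 1: "\<bar>D - (real (N k) * (I - J) - \<delta> * (mu * \<delta> + I))\<bar> \<le> (\<delta> + \<delta>) * E" by simp
  have "\<bar>\<delta> * (mu * \<delta> + I)\<bar> \<le> real (h k) * (2 * real (h k))"
  proof -
    have "\<bar>I\<bar> \<le> \<delta>" unfolding I_def \<delta>_def
      using abs_incr_le[of "N k" \<rho> \<omega>] path_lower by (simp add: of_nat_diff)
    moreover have "\<bar>mu * \<delta>\<bar> \<le> 1 * \<delta>" unfolding abs_mult using mu_le_1 mu_pos \<delta> by (intro mult_mono) auto
    ultimately have "\<bar>mu * \<delta> + I\<bar> \<le> 2 * real (h k)" using \<delta> by linarith
    then show ?thesis unfolding abs_mult using \<delta> by (intro mult_mono) auto
  qed
  moreover have "(\<delta> + \<delta>) * E \<le> (real (h k) + real (h k)) * E"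
    using \<delta> E0 by (intro mult_right_mono) auto
  moreover have "real (N k) * (sg * I - sg * J)
      \<ge> real (N k) * (real (m k) * (sqrt (varA * real (l k)) / 10) - 36 * sqrt (real (h k)))"
  proof (rule mult_left_mono)
    have "\<bar>sg * J\<bar> \<le> 24 * sqrt (real (h k))" using walk_B_loss sg unfolding J_def by auto
    then show "real (m k) * (sqrt (varA * real (l k)) / 10) - 36 * sqrt (real (h k)) \<le> sg * I - sg * J"
      using walk_A_gain unfolding I_def by linarith
  qed simp
  moreover have "sg * D \<ge> real (N k) * (sg * I - sg * J) - \<bar>\<delta> * (mu * \<delta> + I)\<bar> - (\<delta> + \<delta>) * E"
    using sg 1 by (auto simp: algebra_simps abs_le_iff)
  ultimately show ?thesis unfolding D_def[symmetric] E_def by (simp add: power2_eq_square algebra_simps)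
qed

end

section \<open>From the gain at single scales to the normalised difference\<close>

lemma AE_large_at_scales:
  assumes \<rho>: "\<And>n \<omega>. \<omega> \<in> space M \<Longrightarrow> \<rho> n \<omega> \<le> n"
      "\<And>n \<omega>. \<omega> \<in> space M \<Longrightarrow> \<bar>Gam q A (\<rho> n \<omega>) \<omega> - Gam p B (n - \<rho> n \<omega>) \<omega>\<bar> \<le> 1"
    and \<alpha>: "\<And>n \<omega>. \<omega> \<in> space M \<Longrightarrow> \<alpha> (2 * n) \<omega> = n"
  shows "AE \<omega> in M. \<forall>C. frequently (\<lambda>n. C \<le> sg * ((mcount A B (\<rho> n \<omega>) (n - \<rho> n \<omega>) \<omega>
      - mcount A B (\<alpha> n \<omega>) (n - \<alpha> n \<omega>) \<omega>)
     / (real n powr (5/4) * ln (ln (real n)) powr (1/4)))) sequentially"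
  using AE_space AE_regular AE_fluctuation
proof eventually_elim
  fix \<omega> assume \<omega>: "\<omega> \<in> space M" and reg: "eventually (\<lambda>n. regular n \<omega>) sequentially"
    and fr: "frequently (\<lambda>k. fluctuation k (\<lambda>i. case_sum A B i \<omega>)) sequentially"
  show "\<forall>C. frequently (\<lambda>n. C \<le> sg * ((mcount A B (\<rho> n \<omega>) (n - \<rho> n \<omega>) \<omega>
      - mcount A B (\<alpha> n \<omega>) (n - \<alpha> n \<omega>) \<omega>)
     / (real n powr (5/4) * ln (ln (real n)) powr (1/4)))) sequentially"
  proof
    fix C :: real
    define U where "U x = 2 powr (x\<^sup>2)" for x :: real
    define F where "F x = x powr (5/4) * ln (ln x) powr (1/4)" for x :: real
    define c where "c = sqrt (varA / (2 * real G))"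
    have c: "c > 0" unfolding c_def using varA_pos G_ge by simp
    have uU: "real (u k) = U (real k)" for k 
      using powr_realpow[of 2 "k\<^sup>2"] unfolding u_def U_def by simp
    have NU: "real (N k) = U (real k) ^ 2" for k unfolding N_def by (simp add: uU)
    have hU: "real (h k) = real H * U (real k)" for k unfolding h_def by (simp add: uU)
    have n2: "real (2 * N k) = 2 * U (real k) ^ 2" for k by (simp add: NU)
    have H0: "real H > 0" using H_ge by simp
    have mono_N: "filterlim (\<lambda>k. 2 * N k) at_top sequentially"
    proof (rule filterlim_at_top_mono[OF filterlim_ident])
      have "k \<le> 2 * N k" for k
      proof -
        have "k \<le> u k" using less_two_power_square[of k] unfolding u_def by simp
        also have "u k \<le> N k" unfolding N_def power2_eq_square using u_pos[of k] by simp
        finally show ?thesis by simp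
      qed
      then show "eventually (\<lambda>k. k \<le> 2 * N k) sequentially" by simp
    qed
    have ev1: "eventually (\<lambda>k. regular (2 * N k) \<omega>) sequentially"
      by (rule eventually_compose_filterlim[OF reg mono_N])
    have ev2: "eventually (\<lambda>k. C * F (2 * U (real k) ^ 2)
      \<le> U (real k) ^ 2 * (sqrt (U (real k) * log 16 (real k)) * c / 10 - 36 * sqrt (real H * U (real k)))
         - 2 * (real H * U (real k))\<^sup>2
         - 8 * (real H * U (real k)) * sqrt (2 * U (real k) ^ 2 * ln (2 * U (real k) ^ 2))) sequentially"
      using eventually_compose_filterlim[OF scale_asymptotics[OF c H0, of C] filterlim_real_sequentially]
      unfolding F_def U_def by simp
    have ev3: "eventually (\<lambda>k. 1 + 8 * sqrt (real H * U (real k) * ln (2 * U (real k) ^ 2))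
       + 8 * sqrt (U (real k) ^ 2 / 4 powr real k * ln (2 * U (real k) ^ 2)) < sqrt varA / 40 * U (real k)) sequentially"
      using eventually_compose_filterlim[OF scale_error[of "sqrt varA / 40" "real H"] filterlim_real_sequentially]
        H0 varA_pos unfolding U_def by simp
    define X where "X n = (mcount A B (\<rho> n \<omega>) (n - \<rho> n \<omega>) \<omega> - mcount A B (\<alpha> n \<omega>) (n - \<alpha> n \<omega>) \<omega>)
     / F (real n)" for n
    have large: "C \<le> sg * X (2 * N k)"
      if fl: "fluctuation k (\<lambda>i. case_sum A B i \<omega>)" and rg: "regular (2 * N k) \<omega>" and k3: "k \<ge> 3"
        and e2: "C * F (2 * U (real k) ^ 2)
      \<le> U (real k) ^ 2 * (sqrt (U (real k) * log 16 (real k)) * c / 10 - 36 * sqrt (real H * U (real k)))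
         - 2 * (real H * U (real k))\<^sup>2
         - 8 * (real H * U (real k)) * sqrt (2 * U (real k) ^ 2 * ln (2 * U (real k) ^ 2))"
        and e3: "1 + 8 * sqrt (real H * U (real k) * ln (2 * U (real k) ^ 2))
       + 8 * sqrt (U (real k) ^ 2 / 4 powr real k * ln (2 * U (real k) ^ 2)) < sqrt varA / 40 * U (real k)"
      for k
    proof -
      have gk: "good k" using fl unfolding fluctuation_def by simp
      have k1: "k \<ge> 1" using k3 by simp
      have loU: "real (lo k) = U (real k) ^ 2 / 4 powr real k"
      proof -
        have "4 ^ k * real (lo k) = real (4 ^ k * lo k)" by simp
        also have "\<dots> = U (real k) ^ 2" using lo_N[OF k1] NU by simp
        finally show ?thesis by (simp add: powr_realpow field_simps)
      qed
      have "N k \<ge> 3" using k3 less_two_power_square[of k] u_pos[of k]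
        unfolding N_def power2_eq_square u_def[symmetric]
        by (metis less_imp_le_nat mult_le_mono nat_mult_1_right order_trans power2_eq_square u_def)
      then have n3: "real (2 * N k) \<ge> 6" by simp
      \<comment> \<open>The time is at least 6 > exp 1, so the iterated logarithm is positive and
        dividing by the norming factor preserves the inequality.\<close>
      have Fpos: "F (real (2 * N k)) > 0"
      proof -
        have "exp 1 < real (2 * N k)" using exp_le n3 by linarith
        then have "ln (exp 1) < ln (real (2 * N k))" using n3 by (subst ln_less_cancel_iff) auto
        then have "ln (ln (real (2 * N k))) > 0" by simp
        then show ?thesis unfolding F_def using n3 by simp
      qed
      \<comment> \<open>Rounding loses at most a factor 2, as l \<ge> 1: u \<le> 2 G m l. Therefore
        m^2 l \<ge> m u / (2 G) with m \<ge> log 16 k, which is where the constant \<open>c\<close>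
        comes from: splitting into m blocks multiplies the total gain by sqrt m.\<close>
      have jumps_ge: "sqrt (U (real k) * log 16 (real k)) * c \<le> real (m k) * sqrt (varA * real (l k))"
      proof -
        have "u k < (l k + 1) * (G * m k)" unfolding l_def
          using G_ge by (metis Suc_eq_plus1 dividend_less_div_times m_def mult.commute mult_is_0 not_one_le_zero
              old.nat.distinct(2) zero_less_iff_neq_zero add.commute mult_Suc)
        also have "\<dots> \<le> (2 * l k) * (G * m k)" using gk unfolding good_def by (intro mult_right_mono) auto
        finally have "real (u k) \<le> real ((2 * l k) * (G * m k))" by (intro of_nat_mono) simp
        then have ul: "U (real k) \<le> 2 * real G * (real (m k) * real (l k))" by (simp add: uU mult_ac)
        have U0: "U (real k) > 0" unfolding U_def by simp
        have "(sqrt (U (real k) * log 16 (real k)) * c)\<^sup>2 = U (real k) * log 16 (real k) * (varA / (2 * real G))"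
          using k1 U0 varA_pos unfolding c_def by (simp add: power_mult_distrib)
        also have "\<dots> \<le> (2 * real G * (real (m k) * real (l k))) * real (m k) * (varA / (2 * real G))"
          using ul U0 m_ge[OF k1] k1 varA_pos by (intro mult_mono mult_nonneg_nonneg) auto
        also have "\<dots> = (real (m k) * sqrt (varA * real (l k)))\<^sup>2"
          using G_ge varA_pos by (simp add: power_mult_distrib power2_eq_square)
        finally show ?thesis by (rule power2_le_imp_le) (use varA_pos in simp)
      qed
      have "C * F (2 * U (real k) ^ 2) \<le> real (N k) * (real (m k) * (sqrt (varA * real (l k)) / 10) - 36 * sqrt (real (h k)))
        - 2 * (real (h k))\<^sup>2 - 8 * real (h k) * sqrt (real (2 * N k) * ln (real (2 * N k)))"
      proof -
        have "U (real k) ^ 2 * (sqrt (U (real k) * log 16 (real k)) * c / 10 - 36 * sqrt (real H * U (real k)))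
           \<le> U (real k) ^ 2 * (real (m k) * (sqrt (varA * real (l k)) / 10) - 36 * sqrt (real H * U (real k)))"
          using jumps_ge by (intro mult_left_mono) auto
        then show ?thesis using e2 unfolding n2 NU hU by linarith
      qed
      also have "\<dots> \<le> sg * (mcount A B (\<rho> (2 * N k) \<omega>) (2 * N k - \<rho> (2 * N k) \<omega>) \<omega> - mcount A B (N k) (N k) \<omega>)"
      proof (rule fluctuation_gain[OF fl rg])
        show "1 + 8 * sqrt (real (h k) * ln (real (2 * N k))) + 8 * sqrt (real (lo k) * ln (real (2 * N k)))
            < sqrt varA / 40 * real (u k)"
          using e3 unfolding n2 hU loU uU .
      qed (use \<rho> \<omega> in auto)
      finally have "C * F (real (2 * N k)) \<le> sg * (mcount A B (\<rho> (2 * N k) \<omega>) (2 * N k - \<rho> (2 * N k) \<omega>) \<omega> - mcount A B (N k) (N k) \<omega>)"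
        unfolding n2 .
      moreover have "2 * N k - N k = N k" by simp
      ultimately show ?thesis unfolding X_def \<alpha>[OF \<omega>]
        using Fpos by (simp add: pos_le_divide_eq del: of_nat_mult)
    qed
    have "eventually (\<lambda>k. fluctuation k (\<lambda>i. case_sum A B i \<omega>) \<longrightarrow> C \<le> sg * X (2 * N k)) sequentially"
      using ev1 ev2 ev3 eventually_ge_at_top[of "3::nat"]
    proof eventually_elim
      case (elim k)
      then show ?case using large[of k] by blast
    qed
    with fr have "frequently (\<lambda>k. C \<le> sg * X (2 * N k)) sequentially"
      by (rule frequently_rev_mp)
    then have "frequently (\<lambda>n. C \<le> sg * X n) sequentially"
      unfolding frequently_def using eventually_compose_filterlim[OF _ mono_N] by blast
    then show "frequently (\<lambda>n. C \<le> sg * ((mcount A B (\<rho> n \<omega>) (n - \<rho> n \<omega>) \<omega>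
      - mcount A B (\<alpha> n \<omega>) (n - \<alpha> n \<omega>) \<omega>)
     / (real n powr (5/4) * ln (ln (real n)) powr (1/4)))) sequentially"
      unfolding X_def F_def .
  qed
qed

end

lemma (in match_model) AE_frequently_large:
  assumes varA: "varA > 0" and sg: "sg = 1 \<or> sg = -1"
    and \<rho>: "\<And>n \<omega>. \<omega> \<in> space M \<Longrightarrow> \<rho> n \<omega> \<le> n"
      "\<And>n \<omega>. \<omega> \<in> space M \<Longrightarrow> \<bar>Gam q A (\<rho> n \<omega>) \<omega> - Gam p B (n - \<rho> n \<omega>) \<omega>\<bar> \<le> 1"
    and \<alpha>: "\<And>n \<omega>. \<omega> \<in> space M \<Longrightarrow> \<alpha> (2 * n) \<omega> = n"
  shows "AE \<omega> in M. \<forall>C. frequently (\<lambda>n. C \<le> sg * ((mcount A B (\<rho> n \<omega>) (n - \<rho> n \<omega>) \<omega>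
      - mcount A B (\<alpha> n \<omega>) (n - \<alpha> n \<omega>) \<omega>)
     / (real n powr (5/4) * ln (ln (real n)) powr (1/4)))) sequentially"
proof -
  obtain H :: nat where "16 / mu \<le> real H" using real_arch_simple by blast
  then have H: "mu * real H \<ge> 16" using mu_pos by (simp add: divide_simps mult.commute)
  obtain G :: nat where "80 / sqrt varA \<le> real G" using real_arch_simple by blast
  then have G: "sqrt varA * real G \<ge> 80" using varA by (simp add: divide_simps mult.commute)
  interpret scale_events M p q A B H G sg
    by unfold_locales (use sg varA H G in auto)
  show ?thesis by (rule AE_large_at_scales[OF \<rho> \<alpha>])
qed

section \<open>Extended-real limits and conclusion\<close>

lemma limsup_eq_infinity:
  assumes "\<And>C. frequently (\<lambda>n. C \<le> X n) sequentially"
  shows "limsup (\<lambda>n. ereal (X n)) = \<infinity>"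
proof (rule ereal_top)
  fix C
  show "ereal C \<le> limsup (\<lambda>n. ereal (X n))"
  proof (rule ccontr)
    assume "\<not> ?thesis"
    then have "eventually (\<lambda>n. ereal (X n) < ereal C) sequentially"
      by (intro Limsup_lessD) auto
    then show False using assms[of C] unfolding frequently_def by (simp add: not_le)
  qed
qed

lemma liminf_eq_minus_infinity:
  assumes "\<And>C. frequently (\<lambda>n. C \<le> - X n) sequentially"
  shows "liminf (\<lambda>n. ereal (X n)) = -\<infinity>"
  using limsup_eq_infinity[OF assms] ereal_Liminf_uminus[of sequentially "\<lambda>n. ereal (- X n)"] by simp

theorem theorem4p3:
  fixes M :: "'a measure" and F0 :: "'a set set"
    and r s :: "nat \<Rightarrow> real" and LR LS :: "nat \<Rightarrow> 'a \<Rightarrow> nat"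
    and CG CA :: "nat \<Rightarrow> 'a \<Rightarrow> bool"
  assumes P: "prob_space M"
    and r: "prob_vector r" and s: "prob_vector s"
    and mu: "(\<Sum>i. r i * s i) > 0"
    and LR_meas: "\<And>j. j \<ge> 1 \<Longrightarrow> LR j \<in> measurable M (count_space UNIV)"
    and LS_meas: "\<And>j. j \<ge> 1 \<Longrightarrow> LS j \<in> measurable M (count_space UNIV)"
    and LR_dist: "\<And>j i. j \<ge> 1 \<Longrightarrow> measure M {\<omega> \<in> space M. LR j \<omega> = i} = r i"
    and LS_dist: "\<And>j i. j \<ge> 1 \<Longrightarrow> measure M {\<omega> \<in> space M. LS j \<omega> = i} = s i"
    and F0: "sigma_algebra (space M) F0"
    and indep: "prob_space.indep_sets M
        (\<lambda>x. case x of None \<Rightarrow> F0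
                     | Some (Inl j) \<Rightarrow> {LR j -` A \<inter> space M | A. True}
                     | Some (Inr j) \<Rightarrow> {LS j -` A \<inter> space M | A. True})
        ({None} \<union> Some ` (Inl ` {1..} \<union> Inr ` {1..}))"
    and sigma_pos: "sqrt (prob_space.variance M (\<lambda>\<omega>. s (LR 1 \<omega>)))
                    + sqrt (prob_space.variance M (\<lambda>\<omega>. r (LS 1 \<omega>))) > 0"
    and G: "greedy_policy M F0 r s LR LS CG"
    and A: "alternating_policy M F0 CA"
  shows "(AE \<omega> in M. liminf (\<lambda>n. ereal ((matches LR LS CG n \<omega> - matches LR LS CA n \<omega>)
                / (real n powr (5/4) * ln (ln (real n)) powr (1/4)))) = -\<infinity>) \<and>
         (AE \<omega> in M. limsup (\<lambda>n. ereal ((matches LR LS CG n \<omega> - matches LR LS CA n \<omega>)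
                / (real n powr (5/4) * ln (ln (real n)) powr (1/4)))) = \<infinity>) \<and>
         (AE \<omega> in M. (\<lambda>n. (matches LR LS CG n \<omega> - matches LR LS CA n \<omega>)
                / (real n powr (5/4) * ln (ln (real n)) powr (1/4)))
              \<in> O(\<lambda>n. ln (real n) powr (1/2)))"
proof -
  interpret prob_space M by (rule P)
  interpret match_model M r s LR LS
  proof unfold_locales
    let ?I = "Inl ` {1..} \<union> Inr ` {1..} :: (nat + nat) set"
    let ?F = "\<lambda>x. case x of None \<Rightarrow> F0
                     | Some (Inl j) \<Rightarrow> {LR j -` A \<inter> space M | A. True}
                     | Some (Inr j) \<Rightarrow> {LS j -` A \<inter> space M | A. True}"
    have "indep_sets ?F (Some ` ?I)"
      by (rule indep_sets_mono_index[OF _ indep]) auto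
    then have "indep_sets (\<lambda>i. ?F (Some i)) ?I" 
      by (rule indep_sets_reindex[where h = Some and I = ?I and F = ?F, rotated]) simp
    then have "indep_sets (\<lambda>i. {case_sum LR LS i -` A \<inter> space M | A. A \<in> sets (count_space UNIV)}) ?I"
      by (rule indep_sets_mono_sets) (auto, blast+)
    then show "indep_vars (\<lambda>_. count_space UNIV) (case_sum LR LS) ?I"
      unfolding indep_vars_def2 using LR_meas LS_meas by auto
  qed (use r s LR_dist LS_dist mu in \<open>auto simp: dotp_def\<close>)
  interpret sw: match_model M s r LS LR by (rule swap)
  define X where "X n \<omega> = (matches LR LS CG n \<omega> - matches LR LS CA n \<omega>)
                / (real n powr (5/4) * ln (ln (real n)) powr (1/4))" for n \<omega>
  let ?\<rho> = "Rcnt CG" and ?\<alpha> = "Rcnt CA"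
  have X_eq: "X n \<omega> = (mcount LR LS (?\<rho> n \<omega>) (n - ?\<rho> n \<omega>) \<omega> - mcount LR LS (?\<alpha> n \<omega>) (n - ?\<alpha> n \<omega>) \<omega>)
     / (real n powr (5/4) * ln (ln (real n)) powr (1/4))" for n \<omega>
    unfolding X_def matches_mcount Scnt_def ..
  have bal: "\<bar>Gam s LR (?\<rho> n \<omega>) \<omega> - Gam r LS (n - ?\<rho> n \<omega>) \<omega>\<bar> \<le> 1" if "\<omega> \<in> space M" for n \<omega>
    using greedy_balance[OF r s G that] unfolding Scnt_def .
  \<comment> \<open>One of the two score variances is positive. If it is that of the S scores, the
    sequences are exchanged and the position counts S records; the match count is symmetric, so the
    sign \<open>sg\<close> keeps its meaning. The sign -1 yields the lower limit and 1 the upper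
    one.\<close>
  have large: "AE \<omega> in M. \<forall>C. frequently (\<lambda>n. C \<le> sg * X n \<omega>) sequentially" if sg: "sg = 1 \<or> sg = -1" for sg
  proof (cases "varA > 0")
    case True
    show ?thesis unfolding X_eq
      by (rule AE_frequently_large[OF True sg]) (auto simp: Rcnt_le bal alternating_Rcnt[OF A])
  next
    case False
    have "sw.varA > 0"
    proof (rule ccontr)
      assume "\<not> sw.varA > 0"
      with False have "sqrt varA + sqrt sw.varA \<le> 0" by (intro add_nonpos_nonpos) auto
      then show False using sigma_pos unfolding varA_eq sw.varA_eq by simp
    qed
    have X_eq': "X n \<omega> = (mcount LS LR (n - ?\<rho> n \<omega>) (n - (n - ?\<rho> n \<omega>)) \<omega>
        - mcount LS LR (n - ?\<alpha> n \<omega>) (n - (n - ?\<alpha> n \<omega>)) \<omega>)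
     / (real n powr (5/4) * ln (ln (real n)) powr (1/4))" for n \<omega>
      unfolding X_eq mcount_commute[of LR LS] by (simp add: Rcnt_le)
    show ?thesis unfolding X_eq'
    proof (rule sw.AE_frequently_large[OF \<open>sw.varA > 0\<close> sg])
      fix n \<omega> assume \<omega>: "\<omega> \<in> space M"
      show "\<bar>Gam r LS (n - ?\<rho> n \<omega>) \<omega> - Gam s LR (n - (n - ?\<rho> n \<omega>)) \<omega>\<bar> \<le> 1"
        using bal[OF \<omega>, of n] by (simp add: Rcnt_le abs_minus_commute)
      show "2 * n - ?\<alpha> (2 * n) \<omega> = n" using alternating_Rcnt(1)[OF A \<omega>] by simp
    qed simp
  qed
  have "AE \<omega> in M. liminf (\<lambda>n. ereal (X n \<omega>)) = -\<infinity>"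
    using large[of "-1"] by (rule AE_mp) (auto intro!: AE_I2 liminf_eq_minus_infinity)
  moreover have "AE \<omega> in M. limsup (\<lambda>n. ereal (X n \<omega>)) = \<infinity>"
    using large[of 1] by (rule AE_mp) (auto intro!: AE_I2 limsup_eq_infinity)
  moreover have "AE \<omega> in M. (\<lambda>n. X n \<omega>) \<in> O(\<lambda>n. ln (real n) powr (1/2))"
    unfolding X_eq by (rule AE_difference_bigo) (auto simp: Rcnt_le bal alternating_Rcnt[OF A])
  ultimately show ?thesis unfolding X_def by blast
qed

end
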